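(* (Integral 1, generating function.) Let $n\ge1$, let $x=(x_1<\dots<x_n)$ and $y=(y_1<\dots<y_n)$ be strictly increasing tuples of nonnegative integers, and let $\mu,\lambda$ be the partitions with at most $n$ rows given by $\mu_{n-j+1}=x_j-j+1$, $\lambda_{n-j+1}=y_j-j+1$ for $j=1,\dots,n$. Let $b^{(k)}_{xy}$ be the number of ways that $n$ non-intersecting walkers in $\mathbb Z$ move during $k$ instants from $x_1<\dots<x_n$ to $y_1<\dots<y_n$, where at each instant exactly one walker moves, either one step to the left or one step to the right. Then $$\sum_{k\ge0}\frac{z^k}{k!}b^{(k)}_{xy}=\int_{U(n)}\mathbf s_\lambda(M)\mathbf s_\mu(\bar M)e^{z\operatorname{Tr}(M+\bar M)}\,dM=:a_{\lambda\mu}(z).$$ Furthermore, a generating function for the $a_{\lambda\mu}$'s is $$\sum_{\lambda,\mu:\ \lambda_1^\top,\mu_1^\top\le n}a_{\lambda\mu}(z)\,\mathbf s_\lambda(t)\,\mathbf s_\mu(-s)=\int_{U(n)}e^{z\operatorname{Tr}(M+\bar M)}e^{\sum_{i\ge1}\operatorname{Tr}(t_iM^i-s_i\bar M^i)}\,dM.$$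
   Context: $dM$ is normalized Haar measure on the unitary group $U(n)$, $\bar M$ the complex conjugate of $M$. The elementary Schur polynomials are defined by $e^{\sum_{i\ge1}t_iz^i}=\sum_{k\ge0}\mathbf s_k(t)z^k$, $\mathbf s_k=0$ for $k<0$; $\mathbf s_\lambda(t)=\det(\mathbf s_{\lambda_i-i+j}(t))$. For a matrix $M$, $\mathbf s_\lambda(M):=\mathbf s_\lambda(\operatorname{Tr}M,\frac12\operatorname{Tr}M^2,\frac13\operatorname{Tr}M^3,\dots)$, i.e. the Schur function of the eigenvalues of $M$. $\lambda_1^\top$ is the number of rows of $\lambda$. The last identity is understood as an identity of formal power series in $t=(t_1,t_2,\dots)$, $s=(s_1,s_2,\dots)$. Non-intersecting means that the walkers' positions remain strictly increasing at all instants. *)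

theory Defs
  imports
    "HOL-Probability.Probability"
    "HOL-Computational_Algebra.Formal_Power_Series"
    "HOL-Library.Poly_Mapping"
    "Jordan_Normal_Form.Determinant"
begin

section \<open>Formal power series in arbitrarily many variables\<close>

text \<open>
  A monomial is a finitely supported exponent vector \<open>'v \<Rightarrow>\<^sub>0 nat\<close>; a formal power series
  over \<open>complex\<close> assigns a coefficient to every monomial, without any support condition.
\<close>

typedef 'v mfps = "UNIV :: (('v \<Rightarrow>\<^sub>0 nat) \<Rightarrow> complex) set"
  morphisms mcoeff Abs_mfps ..

setup_lifting type_definition_mfps

lemma mfps_eqI: "(\<And>m. mcoeff f m = mcoeff g m) \<Longrightarrow> f = g"
  by (metis ext mcoeff_inject)

definition splits :: "('v \<Rightarrow>\<^sub>0 nat) \<Rightarrow> (('v \<Rightarrow>\<^sub>0 nat) \<times> ('v \<Rightarrow>\<^sub>0 nat)) set" where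
  "splits m = {(a, b). a + b = m}"

lemma finite_splits: "finite (splits m)"
proof -
  let ?D = "{a. \<exists>b. a + b = m}"
  let ?F = "PiE (Poly_Mapping.keys m) (\<lambda>v. {..Poly_Mapping.lookup m v})"
  have dom: "Poly_Mapping.lookup a v \<le> Poly_Mapping.lookup m v" if "a \<in> ?D" for a v
    using that by (auto simp: lookup_add)
  have "finite ?F" by (intro finite_PiE) auto
  moreover have "(\<lambda>a. restrict (Poly_Mapping.lookup a) (Poly_Mapping.keys m)) ` ?D \<subseteq> ?F"
    using dom by auto
  moreover have "inj_on (\<lambda>a. restrict (Poly_Mapping.lookup a) (Poly_Mapping.keys m)) ?D"
  proof (rule inj_onI, rule poly_mapping_eqI)
    fix a b v
    assume ab: "a \<in> ?D" "b \<in> ?D"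
      and eq: "restrict (Poly_Mapping.lookup a) (Poly_Mapping.keys m) =
               restrict (Poly_Mapping.lookup b) (Poly_Mapping.keys m)"
    show "Poly_Mapping.lookup a v = Poly_Mapping.lookup b v"
    proof (cases "v \<in> Poly_Mapping.keys m")
      case True
      with fun_cong[OF eq, of v] show ?thesis by simp
    next
      case False
      hence "Poly_Mapping.lookup m v = 0" by (simp add: in_keys_iff)
      with dom[OF ab(1), of v] dom[OF ab(2), of v] show ?thesis by simp
    qed
  qed
  ultimately have "finite ?D"
    by (meson finite_imageD finite_subset)
  moreover have "splits m \<subseteq> ?D \<times> ?D"
    unfolding splits_def using add.commute by fastforce
  ultimately show ?thesis
    by (meson finite_SigmaI finite_subset)
qed

instantiation mfps :: (type) comm_ring_1
begin

lift_definition zero_mfps :: "'a mfps" is "\<lambda>m. 0" .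
lift_definition one_mfps :: "'a mfps" is "\<lambda>m. if m = 0 then 1 else 0" .
lift_definition plus_mfps :: "'a mfps \<Rightarrow> 'a mfps \<Rightarrow> 'a mfps" is "\<lambda>f g m. f m + g m" .
lift_definition minus_mfps :: "'a mfps \<Rightarrow> 'a mfps \<Rightarrow> 'a mfps" is "\<lambda>f g m. f m - g m" .
lift_definition uminus_mfps :: "'a mfps \<Rightarrow> 'a mfps" is "\<lambda>f m. - f m" .
lift_definition times_mfps :: "'a mfps \<Rightarrow> 'a mfps \<Rightarrow> 'a mfps"
  is "\<lambda>f g m. \<Sum>(a, b)\<in>splits m. f a * g b" .

instance
proof
  fix a b c :: "'a mfps"
  show "a * b * c = a * (b * c)"
  proof transfer
    fix f g h :: "('a \<Rightarrow>\<^sub>0 nat) \<Rightarrow> complex"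
    have "(\<Sum>(p, c)\<in>splits m. (\<Sum>(a, b)\<in>splits p. f a * g b) * h c) =
          (\<Sum>(a, q)\<in>splits m. f a * (\<Sum>(b, c)\<in>splits q. g b * h c))" for m
    proof -
      have "(\<Sum>(p, c)\<in>splits m. (\<Sum>(a, b)\<in>splits p. f a * g b) * h c) =
            (\<Sum>x\<in>splits m. \<Sum>y\<in>splits (fst x). f (fst y) * g (snd y) * h (snd x))"
        by (simp add: case_prod_beta sum_distrib_right)
      also have "\<dots> = (\<Sum>(x, y)\<in>Sigma (splits m) (\<lambda>x. splits (fst x)).
                      f (fst y) * g (snd y) * h (snd x))"
        by (subst sum.Sigma) (auto simp: finite_splits)
      also have "\<dots> = (\<Sum>(x, y)\<in>Sigma (splits m) (\<lambda>x. splits (snd x)).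
                      f (fst x) * (g (fst y) * h (snd y)))"
        by (rule sum.reindex_bij_witness
              [where i = "\<lambda>((a, q), (b, c)). ((a + b, c), (a, b))"
                 and j = "\<lambda>((p, c), (a, b)). ((a, b + c), (b, c))"])
           (auto simp: splits_def algebra_simps)
      also have "\<dots> = (\<Sum>x\<in>splits m. \<Sum>y\<in>splits (snd x). f (fst x) * (g (fst y) * h (snd y)))"
        by (subst sum.Sigma) (auto simp: finite_splits)
      also have "\<dots> = (\<Sum>(a, q)\<in>splits m. f a * (\<Sum>(b, c)\<in>splits q. g b * h c))"
        by (simp add: case_prod_beta sum_distrib_left)
      finally show ?thesis .
    qed
    thus "(\<lambda>m. \<Sum>(p, c)\<in>splits m. (\<Sum>(a, b)\<in>splits p. f a * g b) * h c) =
          (\<lambda>m. \<Sum>(a, q)\<in>splits m. f a * (\<Sum>(b, c)\<in>splits q. g b * h c))"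
      by blast
  qed
  show "a * b = b * a"
  proof transfer
    fix f g :: "('a \<Rightarrow>\<^sub>0 nat) \<Rightarrow> complex"
    have "(\<Sum>(a, b)\<in>splits m. f a * g b) = (\<Sum>(a, b)\<in>splits m. g a * f b)" for m
      by (rule sum.reindex_bij_witness[where i = prod.swap and j = prod.swap])
         (auto simp: splits_def algebra_simps)
    thus "(\<lambda>m. \<Sum>(a, b)\<in>splits m. f a * g b) = (\<lambda>m. \<Sum>(a, b)\<in>splits m. g a * f b)"
      by blast
  qed
  show "1 * a = a"
  proof transfer
    fix f :: "('a \<Rightarrow>\<^sub>0 nat) \<Rightarrow> complex"
    have "(\<Sum>(a, b)\<in>splits m. (if a = 0 then 1 else 0) * f b) = f m" for m
    proof -
      have "(\<Sum>(a, b)\<in>splits m. (if a = 0 then 1 else 0) * f b) =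
            (\<Sum>(a, b)\<in>{(0 :: 'a \<Rightarrow>\<^sub>0 nat, m)}. (if a = 0 then 1 else 0) * f b)"
      proof (rule sum.mono_neutral_right[OF finite_splits])
        show "{(0 :: 'a \<Rightarrow>\<^sub>0 nat, m)} \<subseteq> splits m" by (simp add: splits_def)
        show "\<forall>x\<in>splits m - {(0, m)}. (case x of (a, b) \<Rightarrow> (if a = 0 then 1 else 0) * f b) = 0"
          by (auto simp: splits_def split: if_splits)
      qed
      thus ?thesis by simp
    qed
    thus "(\<lambda>m. \<Sum>(a, b)\<in>splits m. (if a = 0 then 1 else 0) * f b) = f" by blast
  qed
  show "(a + b) * c = a * c + b * c"
    by transfer (simp add: case_prod_beta distrib_right sum.distrib)
  show "(0 :: 'a mfps) \<noteq> 1"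
    by transfer (metis zero_neq_one)
qed (transfer; simp add: fun_eq_iff algebra_simps)+

end

instantiation mfps :: (type) real_algebra_1
begin

lift_definition scaleR_mfps :: "real \<Rightarrow> 'a mfps \<Rightarrow> 'a mfps" is "\<lambda>r f m. r *\<^sub>R f m" .

instance
  by standard
     (transfer; simp add: fun_eq_iff algebra_simps case_prod_beta scaleR_sum_right)+

end

lift_definition mconst :: "complex \<Rightarrow> 'v mfps" is "\<lambda>c m. if m = 0 then c else 0" .

lift_definition mvar :: "'v \<Rightarrow> 'v mfps"
  is "\<lambda>v m. if m = Poly_Mapping.single v 1 then 1 else 0" .

text \<open>
  Infinite sums of formal power series are taken coefficientwise. A family is summable in the
  formal sense if only finitely many of its members contribute to each given monomial; for
  other families \<open>formal_sum\<close> is meaningless.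
\<close>

definition formal_summable :: "('i \<Rightarrow> 'v mfps) \<Rightarrow> 'i set \<Rightarrow> bool" where
  "formal_summable f A \<longleftrightarrow> (\<forall>m. finite {a \<in> A. mcoeff (f a) m \<noteq> 0})"

definition formal_sum :: "('i \<Rightarrow> 'v mfps) \<Rightarrow> 'i set \<Rightarrow> 'v mfps" where
  "formal_sum f A = Abs_mfps (\<lambda>m. \<Sum>a | a \<in> A \<and> mcoeff (f a) m \<noteq> 0. mcoeff (f a) m)"

text \<open>The exponential series; its terms are formally summable if \<open>f\<close> has no constant term.\<close>

definition mexp :: "'v mfps \<Rightarrow> 'v mfps" where
  "mexp f = formal_sum (\<lambda>k. mconst (1 / fact k) * f ^ k) UNIV"

definition formal_integral :: "'b measure \<Rightarrow> ('b \<Rightarrow> 'v mfps) \<Rightarrow> 'v mfps" where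
  "formal_integral N F = Abs_mfps (\<lambda>m. \<integral>M. mcoeff (F M) m \<partial>N)"


section \<open>Partitions and Schur functions\<close>

text \<open>
  Parts are indexed from 0, so \<open>lam i\<close> is the part $\lambda_{i+1}$; all but finitely many
  parts vanish.
\<close>

definition is_partition :: "(nat \<Rightarrow> nat) \<Rightarrow> bool" where
  "is_partition lam \<longleftrightarrow> antimono lam \<and> finite {i. lam i \<noteq> 0}"

definition num_parts :: "(nat \<Rightarrow> nat) \<Rightarrow> nat" where
  "num_parts lam = card {i. lam i \<noteq> 0}"

text \<open>
  Time sequences $t = (t_1, t_2, \dots)$ are functions on \<open>nat\<close> whose value at 0 is ignored.
  The composition below is the formal series $\exp(\sum_{i \ge 1} t_i z^i)$ in $z$
  (\<open>fps_exp\<close> itself is available over fields only).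
\<close>

definition elem_schur :: "(nat \<Rightarrow> 'a :: {comm_ring_1, real_algebra_1}) \<Rightarrow> int \<Rightarrow> 'a" where
  "elem_schur t k =
     (if k < 0 then 0
      else fps_nth (fps_compose (Abs_fps (\<lambda>j. of_real (1 / fact j)))
                                (Abs_fps (\<lambda>i. if i = 0 then 0 else t i))) (nat k))"

definition schur :: "(nat \<Rightarrow> nat) \<Rightarrow> (nat \<Rightarrow> 'a :: {comm_ring_1, real_algebra_1}) \<Rightarrow> 'a" where
  "schur lam t =
     Determinant.det (Matrix.mat (num_parts lam) (num_parts lam)
       (\<lambda>(i, j). elem_schur t (int (lam i) - int i + int j)))"


section \<open>The unitary group\<close>

text \<open>The product \<open>*\<close> on the matrix type is entrywise, so \<open>M ^ k\<close> is not the matrix power.\<close>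

definition matrix_power :: "complex^'n^'n \<Rightarrow> nat \<Rightarrow> complex^'n^'n" where
  "matrix_power M k = (((**) M) ^^ k) (Finite_Cartesian_Product.mat 1)"

definition matrix_cnj :: "complex^'n^'n \<Rightarrow> complex^'n^'n" where
  "matrix_cnj M = map_matrix cnj M"

definition unitary_group :: "(complex^'n^'n) set" where
  "unitary_group =
     {M. Finite_Cartesian_Product.transpose (matrix_cnj M) ** M = Finite_Cartesian_Product.mat 1 \<and>
         M ** Finite_Cartesian_Product.transpose (matrix_cnj M) = Finite_Cartesian_Product.mat 1}"

text \<open>
  The normalized Haar measure: the left-invariant Borel probability measure. On a compact group
  it exists, is unique, and is automatically right-invariant.
\<close>

definition normalized_haar :: "(complex^'n^'n) measure \<Rightarrow> bool" where
  "normalized_haar H \<longleftrightarrow>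
     prob_space H \<and> space H = unitary_group \<and>
     sets H = sets (restrict_space borel unitary_group) \<and>
     (\<forall>V\<in>unitary_group. distr H H (\<lambda>M. V ** M) = H)"

definition schur_matrix :: "(nat \<Rightarrow> nat) \<Rightarrow> complex^'n^'n \<Rightarrow> complex" where
  "schur_matrix lam M = schur lam (\<lambda>i. Determinants.trace (matrix_power M i) / of_nat i)"

definition schur_integral ::
    "(complex^'n^'n) measure \<Rightarrow> (nat \<Rightarrow> nat) \<Rightarrow> (nat \<Rightarrow> nat) \<Rightarrow> complex \<Rightarrow> complex" where
  "schur_integral H lam mu z =
     (\<integral>M. schur_matrix lam M * schur_matrix mu (matrix_cnj M) *
          exp (z * Determinants.trace (M + matrix_cnj M)) \<partial>H)"

text \<open>The variables \<open>T i\<close> and \<open>S i\<close> stand for $t_i$ and $s_i$; only $i \ge 1$ is used.\<close>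

datatype ts_var = T nat | S nat

definition ts_exponent :: "complex^'n^'n \<Rightarrow> ts_var mfps" where
  "ts_exponent M =
     formal_sum (\<lambda>i. mconst (Determinants.trace (matrix_power M i)) * mvar (T i)
                   - mconst (Determinants.trace (matrix_power (matrix_cnj M) i)) * mvar (S i)) {1..}"


section \<open>Non-intersecting walkers\<close>

definition walk_step :: "int list \<Rightarrow> int list \<Rightarrow> bool" where
  "walk_step c c' \<longleftrightarrow> (\<exists>i<length c. \<exists>d\<in>{-1, 1}. c' = c[i := c ! i + d])"

text \<open>A walk of \<open>k\<close> instants is the list of its \<open>k + 1\<close> successive configurations.\<close>

definition walks :: "nat \<Rightarrow> int list \<Rightarrow> int list \<Rightarrow> int list list set" where
  "walks k x y =
     {w. length w = k + 1 \<and> w ! 0 = x \<and> w ! k = y \<and>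
         (\<forall>l\<le>k. sorted_wrt (<) (w ! l)) \<and>
         (\<forall>l<k. walk_step (w ! l) (w ! (l + 1)))}"

definition num_walks :: "nat \<Rightarrow> int list \<Rightarrow> int list \<Rightarrow> nat" where
  "num_walks k x y = card (walks k x y)"

end

theory Submission
  imports Defs "Jordan_Normal_Form.Schur_Decomposition"
begin

text \<open>
  Schur functions and power traces depend only on the eigenvalues, so the first identity reduces to
  integrating symmetric Laurent polynomials in the eigenvalues. A Schur function divided by a power of
  the determinant is an eigenfunction of the quadratic Casimir operator, with nonzero eigenvalue
  unless it is constant. Images of the Casimir operator integrate to zero by invariance of Haar
  measure. Hence its integral is 0 or 1, and the integral of a symmetric Laurent polynomial is a
  constant term against alternants. Multiplying an alternant by \<open>\<Sum>i. x i + 1 / x i\<close> moves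
  one exponent by one step in either direction, and alternants with a repeated exponent vanish: this is
  the rule for non-intersecting walks. The second identity is the Cauchy identity in the
  \<open>n\<close> eigenvalues, applied coefficientwise to both exponentials and integrated.
\<close>

section \<open>Complete symmetric functions and power sums\<close>

text \<open>The Haar measure enters only through left invariance: no Weyl integration formula is
  assumed, the Casimir argument recovers it for symmetric Laurent polynomials. Powers of the
  determinant occur because Jacobi-Trudi needs nonnegative exponents: these are reached by a factor
  det^K, whose inverse on the unitary group is a power of the conjugate determinant, a continuous
  factor carried through all integrals. The Casimir relation for such twisted integrals does not
  suffice alone (for n = 1 it reads lambda^2 = k lambda); the Euler relation, from the direction of
  scalar matrices, fixes the degree, and only then is the eigenvalue gap positive. The Casimir
  operator is computed on products of complete symmetric functions of the traces, where Newton's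
  identities keep all sums finite, and compared with the sum of the (x_i d/dx_i)^2 on alternants.
  Spectra may have multiplicities, where the Vandermonde alternant vanishes, so division by it is a
  limit argument. Constant terms are averages over roots of unity, exact on fine grids, so no
  integral over the torus appears.\<close>

lemma of_nat_times_of_real_inverse_fact:
  "of_nat (Suc j) * (of_real (1 / fact (Suc j)) :: 'a :: real_algebra_1) = of_real (1 / fact j)"
proof -
  have "of_nat (Suc j) * (of_real (1 / fact (Suc j)) :: 'a) = of_real (real (Suc j) * (1 / fact (Suc j)))"
    by (simp only: of_real_mult of_real_of_nat_eq)
  also have "real (Suc j) * (1 / fact (Suc j)) = 1 / fact j"
    by (simp add: divide_simps del: of_nat_Suc)
  finally show ?thesis .
qed

text \<open>Compare coefficients in G' = f' G for G = exp f. The coefficient ring is general because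
  the recursion is needed both for numerical power sums and for formal variables; later facts on
  complete symmetric functions rest on it instead of on the composition of series.\<close>

lemma elem_schur_newton:
  fixes t :: "nat \<Rightarrow> 'a :: {comm_ring_1, real_algebra_1}"
  shows "of_nat k * elem_schur t (int k) =
    (\<Sum>i=1..k. of_nat i * t i * elem_schur t (int k - int i))"
proof (cases k)
  case (Suc n)
  define f :: "'a fps" where "f = Abs_fps (\<lambda>i. if i = 0 then 0 else t i)"
  define E :: "'a fps" where "E = Abs_fps (\<lambda>j. of_real (1 / fact j))"
  define G where "G = fps_compose E f"
  have f0: "fps_nth f 0 = 0" by (simp add: f_def)
  have es: "elem_schur t (int j) = fps_nth G j" for j
    by (simp add: elem_schur_def G_def E_def f_def)
  have van: "fps_nth (f ^ j) m = 0" if "m < j" for j m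
    using startsby_zero_power_prefix[of f j] f0 that by auto
  \<comment> \<open>Since f has no constant term, f^j starts in degree j; one cutoff N therefore
    serves all coefficients up to N, and the finite sum can be differentiated term by term.\<close>
  have G: "fps_nth G m = (\<Sum>j\<le>N. fps_nth E j * fps_nth (f ^ j) m)" if "m \<le> N" for m N
    unfolding G_def fps_compose_nth using that van
    by (intro sum.mono_neutral_left) auto
  have "of_nat (Suc n) * fps_nth G (Suc n) =
        (\<Sum>j\<le>Suc n. fps_nth E j * fps_nth (fps_deriv (f ^ j)) n)"
    by (subst G[of _ "Suc n"]) (auto simp: sum_distrib_left algebra_simps simp del: of_nat_Suc intro!: sum.cong)
  also have "\<dots> = (\<Sum>j\<le>n. fps_nth E (Suc j) * fps_nth (fps_deriv (f ^ Suc j)) n)"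
    by (subst sum.atMost_Suc_shift) simp
  also have "\<dots> = (\<Sum>j\<le>n. fps_nth E j * fps_nth (fps_deriv f * f ^ j) n)"
  proof (rule sum.cong)
    fix j
    have "fps_deriv (f ^ Suc j) = of_nat (Suc j) * (fps_deriv f * f ^ j)"
      by (subst fps_deriv_power') (simp add: algebra_simps)
    hence "fps_nth (fps_deriv (f ^ Suc j)) n = of_nat (Suc j) * fps_nth (fps_deriv f * f ^ j) n"
      by (simp add: fps_of_nat[symmetric] del: of_nat_Suc)
    thus "fps_nth E (Suc j) * fps_nth (fps_deriv (f ^ Suc j)) n =
          fps_nth E j * fps_nth (fps_deriv f * f ^ j) n"
      using of_nat_times_of_real_inverse_fact[of j, where 'a = 'a]
      by (simp add: E_def mult.assoc[symmetric] mult.commute del: of_nat_Suc of_real_divide)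
  qed auto
  also have "\<dots> = (\<Sum>j\<le>n. \<Sum>m=0..n. fps_nth (fps_deriv f) m * (fps_nth E j * fps_nth (f ^ j) (n - m)))"
    by (simp add: fps_mult_nth sum_distrib_left algebra_simps)
  also have "\<dots> = (\<Sum>m=0..n. fps_nth (fps_deriv f) m * fps_nth G (n - m))"
    by (subst sum.swap) (simp add: G[of _ n] sum_distrib_left)
  also have "\<dots> = (\<Sum>m=0..n. of_nat (Suc m) * t (Suc m) * elem_schur t (int (Suc n) - int (Suc m)))"
  proof (rule sum.cong)
    fix m assume "m \<in> {0..n}"
    hence "int (Suc n) - int (Suc m) = int (n - m)" by auto
    thus "fps_nth (fps_deriv f) m * fps_nth G (n - m) =
          of_nat (Suc m) * t (Suc m) * elem_schur t (int (Suc n) - int (Suc m))"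
      by (simp only: es) (simp add: f_def)
  qed auto
  also have "\<dots> = (\<Sum>i=1..Suc n. of_nat i * t i * elem_schur t (int (Suc n) - int i))"
    by (simp only: One_nat_def sum.shift_bounds_cl_Suc_ivl)
  finally show ?thesis using es[of "Suc n"] by (simp only: Suc)
qed auto

lemma elem_schur_neg [simp]: "k < 0 \<Longrightarrow> elem_schur t k = 0"
  by (simp add: elem_schur_def)

lemma elem_schur_0 [simp]: "elem_schur t 0 = 1"
  by (simp add: elem_schur_def)

text \<open>With t_i = p_i / i this is the complete symmetric function h_k, written in the power
  sums p.\<close>

definition hsym :: "(nat \<Rightarrow> complex) \<Rightarrow> int \<Rightarrow> complex" where
  "hsym p k = elem_schur (\<lambda>i. p i / of_nat i) k"

lemma hsym_neg [simp]: "k < 0 \<Longrightarrow> hsym p k = 0"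
  and hsym_0 [simp]: "hsym p 0 = 1"
  by (simp_all add: hsym_def)

text \<open>Terms with r > k vanish, so any upper limit R is allowed. A common R lets sums belonging
  to different degrees be combined without adjusting their ranges.\<close>

lemma hsym_newton:
  assumes "int R \<ge> k"
  shows "of_int k * hsym p k = (\<Sum>r=1..R. p r * hsym p (k - int r))"
proof (cases "k < 0")
  case False
  define m where "m = nat k"
  have k: "k = int m" using False by (simp add: m_def)
  have "of_nat m * hsym p (int m) = (\<Sum>i=1..m. p i * hsym p (int m - int i))"
    unfolding hsym_def elem_schur_newton by (intro sum.cong) auto
  also have "\<dots> = (\<Sum>i=1..R. p i * hsym p (int m - int i))"
    using assms k by (intro sum.mono_neutral_left) auto
  finally show ?thesis by (simp add: k)
qed simp

lemma hsym_unique: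
  assumes "c 0 = 1" "\<And>m. of_nat (Suc m) * c (Suc m) = (\<Sum>r=1..Suc m. p r * c (Suc m - r))"
  shows "hsym p (int m) = c m"
proof (induction m rule: less_induct)
  case (less m)
  show ?case
  proof (cases m)
    case (Suc k)
    have "of_nat m * hsym p (int m) = (\<Sum>r=1..m. p r * hsym p (int m - int r))"
      using hsym_newton[of "int m" m p] by simp
    also have "\<dots> = (\<Sum>r=1..m. p r * c (m - r))"
    proof (rule sum.cong)
      fix r assume r: "r \<in> {1..m}"
      hence "hsym p (int m - int r) = hsym p (int (m - r))" by (simp add: of_nat_diff)
      also have "\<dots> = c (m - r)" using r by (intro less) auto
      finally show "p r * hsym p (int m - int r) = p r * c (m - r)" by simp
    qed simp
    also have "\<dots> = of_nat m * c m" using assms(2)[of k] Suc by simp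
    finally show ?thesis using Suc by (simp del: of_nat_Suc)
  qed (use assms in auto)
qed

lemma hsym_cnj: "hsym (\<lambda>r. cnj (p r)) k = cnj (hsym p k)"
proof (cases "k < 0")
  case False
  have "hsym (\<lambda>r. cnj (p r)) (int (nat k)) = cnj (hsym p (int (nat k)))"
  proof (rule hsym_unique)
    fix m
    have "of_int (int (Suc m)) * hsym p (int (Suc m)) = (\<Sum>r=1..Suc m. p r * hsym p (int (Suc m) - int r))"
      by (rule hsym_newton) simp
    also have "\<dots> = (\<Sum>r=1..Suc m. p r * hsym p (int (Suc m - r)))"
      by (intro sum.cong refl arg_cong2[where f = "(*)"]) (auto simp: of_nat_diff)
    finally have "cnj (of_int (int (Suc m)) * hsym p (int (Suc m))) = 
        cnj (\<Sum>r=1..Suc m. p r * hsym p (int (Suc m - r)))" by simp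
    thus "of_nat (Suc m) * cnj (hsym p (int (Suc m))) = (\<Sum>r=1..Suc m. cnj (p r) * cnj (hsym p (int (Suc m - r))))"
      by simp
  qed simp
  thus ?thesis using False by simp
qed simp

text \<open>
  The power sums \<open>p r\<close> vary along a curve with velocity \<open>r * tau r\<close>; the complete symmetric
  functions then follow the derivative of $\exp(\sum_r p_r z^r / r)$.
\<close>

lemma hsym_has_field_derivative:
  fixes p :: "nat \<Rightarrow> complex \<Rightarrow> complex"
  assumes p: "\<And>r. r \<ge> 1 \<Longrightarrow> (p r has_field_derivative of_nat r * tau r) (at w)"
    and R: "int R \<ge> k"
  shows "((\<lambda>u. hsym (\<lambda>r. p r u) k) has_field_derivative
           (\<Sum>r=1..R. tau r * hsym (\<lambda>r. p r w) (k - int r))) (at w)"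
proof (cases "k < 0")
  case False
  define m where "m = nat k"
  define h where "h = (\<lambda>u. hsym (\<lambda>r. p r u))"
  have k: "k = int m" using False by (simp add: m_def)
  have main: "((\<lambda>u. h u (int m)) has_field_derivative
        (\<Sum>r=1..R. tau r * h w (int m - int r))) (at w)" if "R \<ge> m" for m R
    using that
  proof (induction m arbitrary: R rule: less_induct)
    case (less m)
    show ?case
    proof (cases "m = 0")
      case True
      hence "(\<Sum>r=1..R. tau r * h w (int m - int r)) = 0"
        by (intro sum.neutral) (auto simp: h_def)
      thus ?thesis using True by (simp add: h_def)
    next
      case False
      have rew: "h u (int m) = (\<Sum>r=1..m. p r u * h u (int m - int r)) / of_nat m" for u
        using hsym_newton[of "int m" m "\<lambda>r. p r u"] False by (simp add: h_def field_simps)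
      have D: "((\<lambda>u. h u (int m - int r)) has_field_derivative
            (\<Sum>s=1..m. tau s * h w (int m - int r - int s))) (at w)" if "r \<in> {1..m}" for r
        using less.IH[of "m - r" m] that by (auto simp: of_nat_diff)
      have "((\<lambda>u. (\<Sum>r=1..m. p r u * h u (int m - int r)) / of_nat m) has_field_derivative
          (\<Sum>r=1..m. of_nat r * tau r * h w (int m - int r) +
             (\<Sum>s=1..m. tau s * h w (int m - int r - int s)) * p r w) / of_nat m) (at w)"
        by (intro DERIV_cdivide DERIV_sum DERIV_mult p D) auto
      also have "(\<Sum>r=1..m. of_nat r * tau r * h w (int m - int r) +
             (\<Sum>s=1..m. tau s * h w (int m - int r - int s)) * p r w) =
           (\<Sum>r=1..m. of_nat r * tau r * h w (int m - int r)) +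
           (\<Sum>s=1..m. tau s * (\<Sum>r=1..m. p r w * h w (int m - int s - int r)))"
        unfolding sum.distrib sum_distrib_left sum_distrib_right
        by (subst (2) sum.swap) (simp add: algebra_simps)
      \<comment> \<open>Newton's identity evaluates the inner sum to (m - s) h_{m-s}. Together with
        the term s h_{m-s} from the derivative of the power sums this gives m h_{m-s}, which cancels
        the division by m.\<close>
      also have "(\<Sum>s=1..m. tau s * (\<Sum>r=1..m. p r w * h w (int m - int s - int r))) =
          (\<Sum>s=1..m. tau s * (of_int (int m - int s) * h w (int m - int s)))"
        unfolding h_def by (intro sum.cong refl arg_cong2[where f = "(*)"] hsym_newton[symmetric]) auto
      also have "(\<Sum>r=1..m. of_nat r * tau r * h w (int m - int r)) + \<dots> =
          of_nat m * (\<Sum>r=1..m. tau r * h w (int m - int r))"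
        by (simp add: sum.distrib[symmetric] sum_distrib_left algebra_simps)
      also have "\<dots> / of_nat m = (\<Sum>r=1..m. tau r * h w (int m - int r))"
        using False by simp
      also have "\<dots> = (\<Sum>r=1..R. tau r * h w (int m - int r))"
        using less.prems by (intro sum.mono_neutral_left) (auto simp: h_def)
      finally show ?thesis by (simp only: rew)
    qed
  qed
  show ?thesis using main[of m R] R by (simp add: k h_def)
next
  case True
  have "(\<Sum>r=1..R. tau r * hsym (\<lambda>r. p r w) (k - int r)) = 0"
    using True by (intro sum.neutral) auto
  thus ?thesis using True by simp
qed

definition psum :: "nat \<Rightarrow> (nat \<Rightarrow> complex) \<Rightarrow> nat \<Rightarrow> complex" where
  "psum n x r = (\<Sum>j<n. x j ^ r)"

text \<open>Each geometric series g solves z g' = P g, where P is the series of the positive powers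
  of its variable. Logarithmic derivatives add under products, so the coefficients of the product
  satisfy Newton's recursion, which determines them.\<close>

lemma hsym_psum_eq_coeff:
  "hsym (psum n x) (int k) = fps_nth (\<Prod>j<n. Abs_fps (\<lambda>k. x j ^ k)) k"
proof -
  define g where "g = (\<lambda>j. Abs_fps (\<lambda>k. x j ^ k))"
  define P where "P = (\<lambda>j. Abs_fps (\<lambda>r. if r = 0 then 0 else x j ^ r))"
  define G where "G = (\<lambda>n. \<Prod>j<n. g j)"
  have g: "fps_X * fps_deriv (g j) = P j * g j" for j
  proof (rule fps_ext)
    fix k
    have "fps_nth (P j * g j) k = (\<Sum>i=0..k. if i = 0 then 0 else x j ^ k)"
      unfolding fps_mult_nth by (intro sum.cong) (auto simp: P_def g_def power_add[symmetric])
    also have "\<dots> = of_nat k * x j ^ k"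
      by (subst sum.atLeast_Suc_atMost) (auto intro!: sum.neutral)
    also have "\<dots> = fps_nth (fps_X * fps_deriv (g j)) k"
      by (cases k) (auto simp: g_def)
    finally show "fps_nth (fps_X * fps_deriv (g j)) k = fps_nth (P j * g j) k" ..
  qed
  have G: "fps_X * fps_deriv (G n) = (\<Sum>j<n. P j) * G n" for n
  proof (induction n)
    case (Suc n)
    have "fps_X * fps_deriv (G (Suc n)) = (fps_X * fps_deriv (G n)) * g n + G n * (fps_X * fps_deriv (g n))"
      by (simp add: G_def algebra_simps)
    thus ?case unfolding Suc g by (simp add: G_def algebra_simps)
  qed (simp add: G_def)
  have "hsym (psum n x) (int k) = fps_nth (G n) k"
  proof (rule hsym_unique)
    show "fps_nth (G n) 0 = 1"
      by (induction n) (auto simp: G_def g_def)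
    fix m
    have "of_nat (Suc m) * fps_nth (G n) (Suc m) = fps_nth ((\<Sum>j<n. P j) * G n) (Suc m)"
      using arg_cong[OF G[of n], of "\<lambda>f. fps_nth f (Suc m)"] by simp
    also have "\<dots> = (\<Sum>r=0..Suc m. (\<Sum>j<n. fps_nth (P j) r) * fps_nth (G n) (Suc m - r))"
      by (simp add: fps_mult_nth fps_sum_nth)
    also have "\<dots> = (\<Sum>r=1..Suc m. (\<Sum>j<n. fps_nth (P j) r) * fps_nth (G n) (Suc m - r))"
      by (subst sum.atLeast_Suc_atMost) (auto simp: P_def)
    also have "\<dots> = (\<Sum>r=1..Suc m. psum n x r * fps_nth (G n) (Suc m - r))"
      by (intro sum.cong) (auto simp: P_def psum_def)
    finally show "of_nat (Suc m) * fps_nth (G n) (Suc m) = 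
       (\<Sum>r=1..Suc m. psum n x r * fps_nth (G n) (Suc m - r))" .
  qed
  thus ?thesis by (simp add: G_def g_def)
qed

section \<open>Alternants and the Jacobi--Trudi identity\<close>

definition lmon :: "nat \<Rightarrow> (nat \<Rightarrow> int) \<Rightarrow> (nat \<Rightarrow> complex) \<Rightarrow> complex" where
  "lmon n w x = (\<Prod>i<n. x i powi w i)"

definition alternant :: "nat \<Rightarrow> (nat \<Rightarrow> int) \<Rightarrow> (nat \<Rightarrow> complex) \<Rightarrow> complex" where
  "alternant n w x = (\<Sum>\<sigma> | \<sigma> permutes {..<n}. of_int (sign \<sigma>) * lmon n w (x \<circ> \<sigma>))"

text \<open>The vector delta = (n-1, ..., 1, 0), with integer values so that it can be subtracted
  from arbitrary exponents; the alternant with these exponents is the Vandermonde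
  determinant.\<close>

definition staircase :: "nat \<Rightarrow> nat \<Rightarrow> int" where
  "staircase n j = int n - 1 - int j"

lemma staircase_eq: "j < n \<Longrightarrow> staircase n j = int (n - Suc j)"
  by (simp add: staircase_def)

definition jdet :: "nat \<Rightarrow> (nat \<Rightarrow> complex) \<Rightarrow> (nat \<Rightarrow> int) \<Rightarrow> complex" where
  "jdet n p g = Determinant.det (Matrix.mat n n (\<lambda>(i, j). hsym p (g i - staircase n j)))"

lemma alternant_eq_det:
  "alternant n w x = Determinant.det (Matrix.mat n n (\<lambda>(i, j). x j powi w i))"
  by (subst det_def'[of _ n])
     (auto simp: alternant_def lmon_def atLeast0LessThan permutes_in_image intro!: sum.cong prod.cong)

lemma jdet_eq_sum:
  "jdet n p g = (\<Sum>\<sigma> | \<sigma> permutes {..<n}. of_int (sign \<sigma>) * (\<Prod>i<n. hsym p (g i - staircase n (\<sigma> i))))"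
  unfolding jdet_def
  by (subst det_def'[of _ n])
     (auto simp: atLeast0LessThan permutes_in_image intro!: sum.cong prod.cong)

lemma lmon_permute:
  assumes "\<sigma> permutes {..<n}"
  shows "lmon n (w \<circ> \<sigma>) (x \<circ> \<sigma>) = lmon n w x"
  unfolding lmon_def o_def
  by (rule prod.reindex_bij_betw[OF permutes_imp_bij[OF assms], of "\<lambda>i. x i powi w i"])

lemma finite_permutes_lessThan [simp]: "finite {\<sigma>. \<sigma> permutes {..<n :: nat}}"
  by (simp add: finite_permutations)

lemma permutes_lessThan_permutation: "\<sigma> permutes {..<n :: nat} \<Longrightarrow> permutation \<sigma>"
  using permutation_permutes by blast

lemma sign_compose_lessThan:
  "\<sigma> permutes {..<n :: nat} \<Longrightarrow> \<tau> permutes {..<n} \<Longrightarrow> sign (\<sigma> \<circ> \<tau>) = sign \<sigma> * sign \<tau>"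
  by (intro sign_compose permutes_lessThan_permutation)

lemma of_int_sign_square [simp]: "of_int (sign \<sigma>) * (of_int (sign \<sigma>) :: 'a :: ring_1) = 1"
  by (simp add: sign_def)

lemma alternant_permute_vars:
  assumes "\<tau> permutes {..<n}"
  shows "alternant n w (x \<circ> \<tau>) = of_int (sign \<tau>) * alternant n w x"
proof -
  have "alternant n w x = (\<Sum>\<sigma> | \<sigma> permutes {..<n}. of_int (sign (\<tau> \<circ> \<sigma>)) * lmon n w (x \<circ> (\<tau> \<circ> \<sigma>)))"
    unfolding alternant_def by (rule setum_permutations_compose_left[OF assms])
  also have "\<dots> = of_int (sign \<tau>) * alternant n w (x \<circ> \<tau>)"
    unfolding alternant_def sum_distrib_left
    by (intro sum.cong) (auto simp: sign_compose_lessThan[OF assms] o_assoc)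
  finally have "of_int (sign \<tau>) * alternant n w x = 
      (of_int (sign \<tau>) * of_int (sign \<tau>)) * alternant n w (x \<circ> \<tau>)"
    by (simp only: mult.assoc)
  thus ?thesis by simp
qed

lemma alternant_permute:
  assumes "\<tau> permutes {..<n}"
  shows "alternant n (w \<circ> \<tau>) x = of_int (sign \<tau>) * alternant n w x"
proof -
  have "alternant n (w \<circ> \<tau>) x =
      (\<Sum>\<sigma> | \<sigma> permutes {..<n}. of_int (sign (\<sigma> \<circ> \<tau>)) * lmon n (w \<circ> \<tau>) (x \<circ> (\<sigma> \<circ> \<tau>)))"
    unfolding alternant_def by (rule sum_permutations_compose_right[OF assms])
  also have "\<dots> = of_int (sign \<tau>) * alternant n w x"
    unfolding alternant_def sum_distrib_left
    by (intro sum.cong) (auto simp: sign_compose_lessThan[OF _ assms] o_assoc lmon_permute[OF assms])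
  finally show ?thesis .
qed

lemma jdet_permute:
  assumes "\<tau> permutes {..<n}"
  shows "jdet n p (w \<circ> \<tau>) = of_int (sign \<tau>) * jdet n p w"
proof -
  let ?A = "Matrix.mat n n (\<lambda>(i, j). hsym p (w i - staircase n j))"
  have "Matrix.mat n n (\<lambda>(i, j). hsym p ((w \<circ> \<tau>) i - staircase n j)) =
        Matrix.mat n n (\<lambda>(i, j). ?A $$ (\<tau> i, j))"
    using permutes_in_image[OF assms] by (intro cong_mat) auto
  thus ?thesis
    using det_permute_rows[of ?A n \<tau>] assms by (simp add: jdet_def atLeast0LessThan)
qed

text \<open>Common source of the vanishing results for alternants, Jacobi-Trudi determinants and
  their coefficients: whatever is antisymmetric in w is its own negative when two entries
  agree.\<close>

lemma repeated_entry_swap: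
  assumes "i < n" "j < n" "i \<noteq> j" "w i = w j"
  shows "\<exists>\<tau>. \<tau> permutes {..<n} \<and> w \<circ> \<tau> = w \<and> sign \<tau> = -1"
proof (intro exI conjI)
  show "Transposition.transpose i j permutes {..<n}" using assms by (intro permutes_swap_id) auto
  show "w \<circ> Transposition.transpose i j = w" using assms by (auto simp: Transposition.transpose_def)
  show "sign (Transposition.transpose i j) = -1" using assms by (simp add: sign_swap_id)
qed

lemma alternant_repeated:
  assumes "i < n" "j < n" "i \<noteq> j" "w i = w j"
  shows "alternant n w x = 0"
proof -
  obtain \<tau> where "\<tau> permutes {..<n}" "w \<circ> \<tau> = w" "sign \<tau> = -1"
    using repeated_entry_swap[OF assms] by blast
  with alternant_permute[of \<tau> n w x] show ?thesis by simp
qed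

lemma jdet_repeated:
  assumes "i < n" "j < n" "i \<noteq> j" "w i = w j"
  shows "jdet n p w = 0"
proof -
  obtain \<tau> where "\<tau> permutes {..<n}" "w \<circ> \<tau> = w" "sign \<tau> = -1"
    using repeated_entry_swap[OF assms] by blast
  with jdet_permute[of \<tau> n p w] show ?thesis by simp
qed

lemma alternant_cong:
  assumes "\<And>i. i < n \<Longrightarrow> v i = w i"
  shows "alternant n v x = alternant n w x"
  using assms by (auto simp: alternant_def lmon_def intro!: sum.cong)

lemma jdet_cong:
  assumes "\<And>i. i < n \<Longrightarrow> v i = w i"
  shows "jdet n p v = jdet n p w"
  unfolding jdet_def using assms by (intro arg_cong[where f = Determinant.det] cong_mat) auto

lemma prod_permute_vars:
  "\<sigma> permutes {..<n} \<Longrightarrow> (\<Prod>i<n. f (x (\<sigma> i))) = (\<Prod>i<n. f (x i :: 'a) :: 'b :: comm_monoid_mult)"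
  using prod.reindex_bij_betw[OF permutes_imp_bij, of \<sigma> "{..<n}" "\<lambda>i. f (x i)"] by simp

text \<open>The product of all variables is symmetric and hence factors out of the alternating sum.
  This moves negative exponents into the range where Jacobi-Trudi applies.\<close>

lemma alternant_shift:
  assumes "\<And>i. i < n \<Longrightarrow> x i \<noteq> 0"
  shows "alternant n (\<lambda>i. w i + K) x = (\<Prod>i<n. x i powi K) * alternant n w x"
proof -
  have "lmon n (\<lambda>i. w i + K) (x \<circ> \<sigma>) = (\<Prod>i<n. x i powi K) * lmon n w (x \<circ> \<sigma>)"
    if "\<sigma> permutes {..<n}" for \<sigma>
  proof -
    have "x (\<sigma> i) \<noteq> 0" if "i < n" for i
      using assms[of "\<sigma> i"] permutes_in_image[OF \<open>\<sigma> permutes _\<close>, of i] that by auto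
    hence "lmon n (\<lambda>i. w i + K) (x \<circ> \<sigma>) = (\<Prod>i<n. x (\<sigma> i) powi K) * lmon n w (x \<circ> \<sigma>)"
      unfolding lmon_def prod.distrib[symmetric] by (intro prod.cong) (auto simp: power_int_add)
    thus ?thesis by (simp add: prod_permute_vars[OF that, of "\<lambda>y. y powi K"])
  qed
  thus ?thesis by (simp add: alternant_def sum_distrib_left algebra_simps)
qed

text \<open>A kernel vector of the Vandermonde matrix is the coefficient vector of a nonzero
  polynomial of degree below n with the n distinct roots x_i.\<close>

lemma alternant_staircase_nonzero:
  assumes "inj_on x {..<n}"
  shows "alternant n (staircase n) x \<noteq> 0"
proof
  assume 0: "alternant n (staircase n) x = 0"
  define A where "A = Matrix.mat n n (\<lambda>(i, j). x i powi staircase n j)"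
  have A: "A \<in> carrier_mat n n" by (simp add: A_def)
  have "transpose_mat A = Matrix.mat n n (\<lambda>(i, j). x j powi staircase n i)"
    by (auto simp: A_def)
  hence "Determinant.det A = 0"
    using 0 det_transpose[OF A] by (simp add: alternant_eq_det)
  then obtain v where v: "v \<in> carrier_vec n" "v \<noteq> 0\<^sub>v n" "A *\<^sub>v v = 0\<^sub>v n"
    using det_0_iff_vec_prod_zero[OF A] by blast
  \<comment> \<open>The exponents of the staircase decrease, so the coefficients of q are the
    entries of v in reverse order.\<close>
  define q where "q = (\<Sum>j<n. Polynomial.monom (vec_index v j) (n - Suc j))"
  have coeff: "poly.coeff q r = (if r < n then vec_index v (n - Suc r) else 0)" for r
  proof -
    have "poly.coeff q r = (\<Sum>j<n. if j = n - Suc r \<and> r < n then vec_index v j else 0)"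
      unfolding q_def coeff_sum by (intro sum.cong) auto
    thus ?thesis by (auto simp: sum.delta)
  qed
  have root: "poly q (x i) = 0" if "i < n" for i
  proof -
    have "poly q (x i) = (\<Sum>j<n. x i powi staircase n j * vec_index v j)"
      unfolding q_def poly_sum
      by (intro sum.cong) (auto simp: poly_monom staircase_eq simp del: of_nat_diff of_nat_Suc)
    also have "\<dots> = vec_index (A *\<^sub>v v) i"
      using that v(1) by (simp add: A_def scalar_prod_def atLeast0LessThan)
    finally show ?thesis using v(3) that by simp
  qed
  have "q \<noteq> 0"
  proof
    assume "q = 0"
    have "vec_index v j = 0" if "j < n" for j
      using coeff[of "n - Suc j"] that \<open>q = 0\<close> by simp
    hence "v = 0\<^sub>v n" using v(1) by (intro eq_vecI) auto
    with v(2) show False by simp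
  qed
  have "n > 0" using v by (cases n) auto
  have "n = card (x ` {..<n})" using card_image[OF assms] by simp
  also have "\<dots> \<le> card {z. poly q z = 0}"
    using root poly_roots_finite[OF \<open>q \<noteq> 0\<close>] by (intro card_mono) auto
  also have "\<dots> \<le> degree q" using card_poly_roots_bound[OF \<open>q \<noteq> 0\<close>] by simp
  also have "\<dots> < n" using \<open>n > 0\<close> coeff by (intro degree_lessI) auto
  finally show False by simp
qed

lemma one_minus_times_geometric:
  "(1 - fps_const c * fps_X) * Abs_fps (\<lambda>k. c ^ k) = (1 :: complex fps)"
proof (rule fps_ext)
  fix m
  have "(1 - fps_const c * fps_X) * Abs_fps (\<lambda>k. c ^ k) = 
      Abs_fps (\<lambda>k. c ^ k) - fps_const c * (fps_X * Abs_fps (\<lambda>k. c ^ k))"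
    by (simp add: algebra_simps)
  thus "fps_nth ((1 - fps_const c * fps_X) * Abs_fps (\<lambda>k. c ^ k)) m = fps_nth (1 :: complex fps) m"
    by (cases m) simp_all
qed

lemma fps_nth_prod_linear_eq_0:
  assumes "finite A" "card A < m"
  shows "fps_nth (\<Prod>i\<in>A. 1 - fps_const (c i) * fps_X) m = (0 :: complex)"
  using assms
proof (induction A arbitrary: m rule: finite_induct)
  case (insert a A)
  define F where "F = (\<Prod>i\<in>A. 1 - fps_const (c i) * fps_X)"
  have "(\<Prod>i\<in>insert a A. 1 - fps_const (c i) * fps_X) = F - fps_const (c a) * (fps_X * F)"
    using insert by (simp add: F_def algebra_simps)
  moreover have "fps_nth F m = 0" "fps_nth F (m - 1) = 0"
    using insert by (auto simp: F_def)
  ultimately show ?case by simp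
qed simp

text \<open>The generating polynomial of the signed elementary symmetric functions in all variables
  except x_k.\<close>

definition esym_omit :: "nat \<Rightarrow> (nat \<Rightarrow> complex) \<Rightarrow> nat \<Rightarrow> complex fps" where
  "esym_omit n x k = (\<Prod>i\<in>{..<n} - {k}. 1 - fps_const (x i) * fps_X)"

text \<open>The generating series of the complete symmetric functions is the product of all 1 / (1 -
  x_i z). Multiplying by the factors with i different from k leaves 1 / (1 - x_k z), whose
  coefficients are the powers of x_k.\<close>

lemma hsym_esym_omit:
  assumes "k < n"
  shows "(\<Sum>j<n. hsym (psum n x) (int m - staircase n j) * fps_nth (esym_omit n x k) (n - Suc j)) = x k ^ m"
proof -
  define g where "g = (\<lambda>j. Abs_fps (\<lambda>k. x j ^ k))"
  define G where "G = (\<Prod>j<n. g j)"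
  define e where "e = esym_omit n x k"
  have "e * G = g k * (\<Prod>i\<in>{..<n} - {k}. (1 - fps_const (x i) * fps_X) * g i)"
    unfolding e_def G_def esym_omit_def prod.distrib using assms
    by (subst prod.remove[of "{..<n}" k g]) (auto simp: algebra_simps)
  also have "\<dots> = g k" by (simp add: g_def one_minus_times_geometric)
  finally have eG: "e * G = g k" .
  \<comment> \<open>The polynomial has only n - 1 factors. The sum over n columns is therefore the
    full convolution, whatever the size of m.\<close>
  have e0: "fps_nth e r = 0" if "r \<ge> n" for r
    unfolding e_def esym_omit_def using assms that by (intro fps_nth_prod_linear_eq_0) auto
  have "(\<Sum>j<n. hsym (psum n x) (int m - staircase n j) * fps_nth e (n - Suc j)) =
        (\<Sum>j<n. hsym (psum n x) (int m - int (n - Suc j)) * fps_nth e (n - Suc j))"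
    by (intro sum.cong) (auto simp: staircase_eq)
  also have "\<dots> = (\<Sum>r<n. hsym (psum n x) (int m - int r) * fps_nth e r)"
    by (rule sum.nat_diff_reindex[of "\<lambda>r. hsym (psum n x) (int m - int r) * fps_nth e r"])
  also have "\<dots> = (\<Sum>r<n + Suc m. hsym (psum n x) (int m - int r) * fps_nth e r)"
    using e0 by (intro sum.mono_neutral_left) auto
  also have "\<dots> = (\<Sum>r\<in>{0..m}. hsym (psum n x) (int m - int r) * fps_nth e r)"
    by (intro sum.mono_neutral_right) auto
  also have "\<dots> = (\<Sum>r\<in>{0..m}. fps_nth e r * fps_nth G (m - r))"
  proof (rule sum.cong)
    fix r assume "r \<in> {0..m}"
    hence "int m - int r = int (m - r)" by auto
    thus "hsym (psum n x) (int m - int r) * fps_nth e r = fps_nth e r * fps_nth G (m - r)"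
      by (simp only: hsym_psum_eq_coeff) (simp add: G_def g_def)
  qed simp
  also have "\<dots> = fps_nth (e * G) m" by (simp add: fps_mult_nth)
  also have "\<dots> = x k ^ m" unfolding eG by (simp add: g_def)
  finally show ?thesis by (simp add: e_def)
qed

lemma jdet_staircase: "jdet n p (staircase n) = 1"
proof -
  let ?A = "Matrix.mat n n (\<lambda>(i, j). hsym p (staircase n i - staircase n j))"
  have "Determinant.det ?A = prod_list (diag_mat ?A)"
    by (rule det_upper_triangular[of _ n]) (auto simp: upper_triangular_def staircase_def)
  also have "diag_mat ?A = map (\<lambda>i. 1) [0..<n]"
    by (auto simp: diag_mat_def)
  finally show ?thesis by (simp add: jdet_def map_replicate_const)
qed

text \<open>
  Both alternants are the determinant of a matrix of complete symmetric functions times one and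
  the same matrix of elementary symmetric functions with one variable omitted.
\<close>

lemma jacobi_trudi:
  assumes "\<And>i. i < n \<Longrightarrow> g i \<ge> 0"
  shows "alternant n g x = jdet n (psum n x) g * alternant n (staircase n) x"
proof -
  define E where "E = Matrix.mat n n (\<lambda>(j, k). fps_nth (esym_omit n x k) (n - Suc j))"
  have factor: "alternant n g x = jdet n (psum n x) g * Determinant.det E"
    if g: "\<And>i. i < n \<Longrightarrow> g i \<ge> 0" for g
  proof -
    let ?H = "Matrix.mat n n (\<lambda>(i, j). hsym (psum n x) (g i - staircase n j))"
    have "Matrix.mat n n (\<lambda>(i, j). x j powi g i) = ?H * E"
    proof (rule eq_matI)
      fix i j assume "i < dim_row (?H * E)" "j < dim_col (?H * E)"
      hence ij: "i < n" "j < n" by (auto simp: E_def)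
      have "(?H * E) $$ (i, j) =
          (\<Sum>l<n. hsym (psum n x) (g i - staircase n l) * fps_nth (esym_omit n x j) (n - Suc l))"
        using ij by (simp add: E_def scalar_prod_def atLeast0LessThan)
      also have "\<dots> = x j ^ nat (g i)"
        using hsym_esym_omit[of j n x "nat (g i)"] ij g by simp
      finally show "Matrix.mat n n (\<lambda>(i, j). x j powi g i) $$ (i, j) = (?H * E) $$ (i, j)"
        using ij g[of i] by (simp add: power_int_def)
    qed (auto simp: E_def)
    thus ?thesis unfolding alternant_eq_det jdet_def
      by (simp only:) (rule det_mult, auto simp: E_def)
  qed
  \<comment> \<open>At g = delta the matrix of complete symmetric functions is unitriangular, so the
    common second factor is the Vandermonde alternant itself.\<close>
  have "alternant n (staircase n) x = Determinant.det E"
    using factor[of "staircase n"] by (simp add: staircase_eq jdet_staircase del: of_nat_diff)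
  thus ?thesis using factor[OF assms] by simp
qed

section \<open>Laurent polynomials on the torus\<close>

definition torus :: "nat \<Rightarrow> (nat \<Rightarrow> complex) set" where
  "torus n = {x. \<forall>i<n. cmod (x i) = 1}"

text \<open>A condition on the values on the torus only, so that conjugation counts as inversion of
  the variables and stays inside the class. The exponents in the list may repeat.\<close>

definition laurent :: "nat \<Rightarrow> ((nat \<Rightarrow> complex) \<Rightarrow> complex) \<Rightarrow> bool" where
  "laurent n F \<longleftrightarrow> (\<exists>ts. \<forall>x\<in>torus n. F x = (\<Sum>(c, w)\<leftarrow>ts. c * lmon n w x))"

lemma torus_nonzero: "x \<in> torus n \<Longrightarrow> i < n \<Longrightarrow> x i \<noteq> 0"
  by (auto simp: torus_def)

lemma torus_permute: "x \<in> torus n \<Longrightarrow> \<sigma> permutes {..<n} \<Longrightarrow> x \<circ> \<sigma> \<in> torus n"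
  using permutes_in_image by (fastforce simp: torus_def)

lemma torus_cnj: "x \<in> torus n \<Longrightarrow> i < n \<Longrightarrow> cnj (x i) = inverse (x i)"
  using complex_norm_square[of "x i"] torus_nonzero[of x n i]
  by (auto simp: torus_def field_simps)

lemma lmon_add: "x \<in> torus n \<Longrightarrow> lmon n (\<lambda>i. v i + w i) x = lmon n v x * lmon n w x"
  unfolding lmon_def prod.distrib[symmetric]
  by (intro prod.cong) (auto simp: power_int_add dest: torus_nonzero)

lemma lmon_cnj: "x \<in> torus n \<Longrightarrow> cnj (lmon n w x) = lmon n (\<lambda>i. - w i) x"
  unfolding lmon_def cnj_prod
  by (intro prod.cong) (auto simp: torus_cnj power_int_minus power_int_inverse)

lemma lmon_0 [simp]: "lmon n (\<lambda>_. 0) x = 1"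
  by (simp add: lmon_def)

lemma lmon_unit: "i < n \<Longrightarrow> lmon n (\<lambda>j. if j = i then k else 0) x = x i powi k"
  unfolding lmon_def by (subst prod.remove[of _ i]) (auto intro!: prod.neutral)

lemma lmon_permute_inv:
  assumes "\<sigma> permutes {..<n}"
  shows "lmon n w (x \<circ> \<sigma>) = lmon n (w \<circ> inv_into UNIV \<sigma>) x"
  using lmon_permute[OF assms, of "w \<circ> inv_into UNIV \<sigma>" x] permutes_inv_o[OF assms]
  by (simp add: o_assoc[symmetric])

lemma laurentI: "(\<And>x. x \<in> torus n \<Longrightarrow> F x = (\<Sum>(c, w)\<leftarrow>ts. c * lmon n w x)) \<Longrightarrow> laurent n F"
  by (auto simp: laurent_def)

lemma laurent_cong: "laurent n F \<Longrightarrow> (\<And>x. x \<in> torus n \<Longrightarrow> F x = G x) \<Longrightarrow> laurent n G"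
  by (auto simp: laurent_def)

lemma laurent_lmon: "laurent n (lmon n w)"
  by (rule laurentI[of _ _ "[(1, w)]"]) auto

lemma laurent_const: "laurent n (\<lambda>x. c)"
  by (rule laurentI[of _ _ "[(c, \<lambda>_. 0)]"]) auto

lemma laurent_var: "i < n \<Longrightarrow> laurent n (\<lambda>x. x i)"
  using laurent_lmon[of n "\<lambda>j. if j = i then 1 else 0"] by (rule laurent_cong) (simp add: lmon_unit)

lemma laurent_add:
  assumes "laurent n F" "laurent n G"
  shows "laurent n (\<lambda>x. F x + G x)"
proof -
  from assms obtain ts us where
    "\<And>x. x \<in> torus n \<Longrightarrow> F x = (\<Sum>(c, w)\<leftarrow>ts. c * lmon n w x)"
    "\<And>x. x \<in> torus n \<Longrightarrow> G x = (\<Sum>(c, w)\<leftarrow>us. c * lmon n w x)"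
    unfolding laurent_def by blast
  thus ?thesis by (intro laurentI[of _ _ "ts @ us"]) auto
qed

lemma laurent_mult:
  assumes "laurent n F" "laurent n G"
  shows "laurent n (\<lambda>x. F x * G x)"
proof -
  from assms obtain ts us where ts:
    "\<And>x. x \<in> torus n \<Longrightarrow> F x = (\<Sum>(c, w)\<leftarrow>ts. c * lmon n w x)" and us:
    "\<And>x. x \<in> torus n \<Longrightarrow> G x = (\<Sum>(c, w)\<leftarrow>us. c * lmon n w x)"
    unfolding laurent_def by blast
  have single: "c * lmon n w x * (\<Sum>(d, v)\<leftarrow>us. d * lmon n v x) =
      (\<Sum>(d, v)\<leftarrow>map (\<lambda>(d, v). (c * d, \<lambda>i. w i + v i)) us. d * lmon n v x)"
    if "x \<in> torus n" for c w x
    by (induction us) (auto simp: lmon_add[OF that] algebra_simps)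
  have "(\<Sum>(c, w)\<leftarrow>ts. c * lmon n w x) * (\<Sum>(d, v)\<leftarrow>us. d * lmon n v x) =
      (\<Sum>(d, v)\<leftarrow>concat (map (\<lambda>(c, w). map (\<lambda>(d, v). (c * d, \<lambda>i. w i + v i)) us) ts). d * lmon n v x)"
    if "x \<in> torus n" for x
    by (induction ts) (auto simp: distrib_right single[OF that])
  hence "\<forall>x\<in>torus n. F x * G x =
      (\<Sum>(d, v)\<leftarrow>concat (map (\<lambda>(c, w). map (\<lambda>(d, v). (c * d, \<lambda>i. w i + v i)) us) ts). d * lmon n v x)"
    by (auto simp only: ts us)
  thus ?thesis unfolding laurent_def by (rule exI)
qed

lemma laurent_sum:
  assumes "\<And>a. a \<in> A \<Longrightarrow> laurent n (F a)"
  shows "laurent n (\<lambda>x. \<Sum>a\<in>A. F a x)"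
  using assms
  by (induction A rule: infinite_finite_induct) (auto intro: laurent_const laurent_add)

lemma laurent_prod:
  assumes "\<And>a. a \<in> A \<Longrightarrow> laurent n (F a)"
  shows "laurent n (\<lambda>x. \<Prod>a\<in>A. F a x)"
  using assms
  by (induction A rule: infinite_finite_induct) (auto intro: laurent_const laurent_mult)

lemma laurent_power: "laurent n F \<Longrightarrow> laurent n (\<lambda>x. F x ^ k)"
  by (induction k) (auto intro: laurent_const laurent_mult)

lemma laurent_cnj:
  assumes "laurent n F"
  shows "laurent n (\<lambda>x. cnj (F x))"
proof -
  from assms obtain ts where ts:
    "\<And>x. x \<in> torus n \<Longrightarrow> F x = (\<Sum>(c, w)\<leftarrow>ts. c * lmon n w x)"
    unfolding laurent_def by blast
  have "cnj (\<Sum>(c, w)\<leftarrow>ts. c * lmon n w x) =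
      (\<Sum>(c, w)\<leftarrow>map (\<lambda>(c, w). (cnj c, \<lambda>i. - w i)) ts. c * lmon n w x)"
    if "x \<in> torus n" for x
    by (induction ts) (auto simp: lmon_cnj[OF that])
  hence "\<forall>x\<in>torus n. cnj (F x) =
      (\<Sum>(c, w)\<leftarrow>map (\<lambda>(c, w). (cnj c, \<lambda>i. - w i)) ts. c * lmon n w x)"
    by (auto simp only: ts)
  thus ?thesis unfolding laurent_def by (rule exI)
qed

lemma laurent_psum: "laurent n (\<lambda>x. psum n x r)"
  unfolding psum_def by (intro laurent_sum laurent_power laurent_var) auto

lemma laurent_hsym: "laurent n (\<lambda>x. hsym (psum n x) k)"
proof (cases "k < 0")
  case False
  have "laurent n (\<lambda>x. hsym (psum n x) (int m))" for m
  proof (induction m rule: less_induct)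
    case (less m)
    show ?case
    proof (cases "m = 0")
      case False
      have "laurent n (\<lambda>x. (1 / of_nat m) * (\<Sum>r=1..m. psum n x r * hsym (psum n x) (int m - int r)))"
      proof (intro laurent_mult laurent_const laurent_sum laurent_psum)
        fix r assume "r \<in> {1..m}"
        hence "int m - int r = int (m - r)" "m - r < m" by auto
        with less.IH show "laurent n (\<lambda>x. hsym (psum n x) (int m - int r))" by metis
      qed
      thus ?thesis
      proof (rule laurent_cong)
        fix x
        show "(1 / of_nat m) * (\<Sum>r=1..m. psum n x r * hsym (psum n x) (int m - int r)) =
            hsym (psum n x) (int m)"
          using hsym_newton[of "int m" m "psum n x"] False by (simp add: field_simps)
      qed
    qed (simp add: laurent_const)
  qed
  from this[of "nat k"] False show ?thesis by simp
qed (simp add: laurent_const)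

lemma laurent_jdet: "laurent n (\<lambda>x. jdet n (psum n x) g)"
  unfolding jdet_eq_sum by (intro laurent_sum laurent_mult laurent_const laurent_prod laurent_hsym)

text \<open>By symmetry G may be evaluated at the permuted point inside each term of the alternating
  sum, where it multiplies a single monomial. The list of terms depends on G alone and serves all
  exponents w and all points x.\<close>

lemma alternant_times_symmetric:
  assumes "laurent n G"
    and sym: "\<And>x \<sigma>. x \<in> torus n \<Longrightarrow> \<sigma> permutes {..<n} \<Longrightarrow> G (x \<circ> \<sigma>) = G x"
  obtains ts where "\<And>w x. x \<in> torus n \<Longrightarrow>
      alternant n w x * G x = (\<Sum>(c, v)\<leftarrow>ts. c * alternant n (\<lambda>i. w i + v i) x)"
proof -
  from assms obtain ts where ts:
    "\<And>x. x \<in> torus n \<Longrightarrow> G x = (\<Sum>(c, w)\<leftarrow>ts. c * lmon n w x)"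
    unfolding laurent_def by blast
  show ?thesis
  proof (rule that)
    fix w x assume x: "x \<in> torus n"
    have "alternant n w x * G x =
        (\<Sum>\<sigma> | \<sigma> permutes {..<n}. of_int (sign \<sigma>) * lmon n w (x \<circ> \<sigma>) * G (x \<circ> \<sigma>))"
      unfolding alternant_def sum_distrib_right by (intro sum.cong) (auto simp: sym[OF x])
    also have "\<dots> = (\<Sum>\<sigma> | \<sigma> permutes {..<n}. 
        (\<Sum>(c, v)\<leftarrow>ts. c * (of_int (sign \<sigma>) * lmon n (\<lambda>i. w i + v i) (x \<circ> \<sigma>))))"
    proof (rule sum.cong)
      fix \<sigma> assume "\<sigma> \<in> {\<sigma>. \<sigma> permutes {..<n}}"
      hence x': "x \<circ> \<sigma> \<in> torus n" using torus_permute[OF x] by simp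
      have "a * lmon n w (x \<circ> \<sigma>) * (\<Sum>(c, v)\<leftarrow>us. c * lmon n v (x \<circ> \<sigma>)) =
          (\<Sum>(c, v)\<leftarrow>us. c * (a * lmon n (\<lambda>i. w i + v i) (x \<circ> \<sigma>)))" for a us
        by (induction us) (auto simp: lmon_add[OF x'] ring_distribs mult_ac simp del: comp_def o_apply)
      thus "of_int (sign \<sigma>) * lmon n w (x \<circ> \<sigma>) * G (x \<circ> \<sigma>) =
          (\<Sum>(c, v)\<leftarrow>ts. c * (of_int (sign \<sigma>) * lmon n (\<lambda>i. w i + v i) (x \<circ> \<sigma>)))"
        unfolding ts[OF x'] .
    qed simp
    also have "\<dots> = (\<Sum>(c, v)\<leftarrow>ts. c * alternant n (\<lambda>i. w i + v i) x)"
      unfolding alternant_def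
      by (induction ts) (auto simp: sum.distrib sum_distrib_left)
    finally show "alternant n w x * G x = (\<Sum>(c, v)\<leftarrow>ts. c * alternant n (\<lambda>i. w i + v i) x)" .
  qed
qed

section \<open>Cancelling the Vandermonde alternant on the torus\<close>

lemma laurent_tendsto_perturb:
  assumes F: "laurent n F" and x: "x \<in> torus n"
  shows "((\<lambda>e. F (\<lambda>i. x i * cis (e * real i))) \<longlongrightarrow> F x) (at_right 0)"
proof -
  from assms obtain ts where ts:
    "\<And>x. x \<in> torus n \<Longrightarrow> F x = (\<Sum>(c, w)\<leftarrow>ts. c * lmon n w x)"
    unfolding laurent_def by blast
  have x': "(\<lambda>i. x i * cis (e * real i)) \<in> torus n" for e
    using x by (auto simp: torus_def norm_mult)
  have lm: "((\<lambda>e. lmon n w (\<lambda>i. x i * cis (e * real i))) \<longlongrightarrow> lmon n w x) (at_right 0)" for w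
  proof -
    have "((\<lambda>e. (x i * cis (e * real i)) powi w i) \<longlongrightarrow> (x i * cis (0 * real i)) powi w i) (at_right 0)"
      if "i < n" for i
      using torus_nonzero[OF x that]
      by (intro tendsto_intros) auto
    thus ?thesis unfolding lmon_def by (intro tendsto_prod) auto
  qed
  have "((\<lambda>e. \<Sum>(c, w)\<leftarrow>ts. c * lmon n w (\<lambda>i. x i * cis (e * real i))) \<longlongrightarrow>
      (\<Sum>(c, w)\<leftarrow>ts. c * lmon n w x)) (at_right 0)"
    by (induction ts) (auto intro!: tendsto_intros lm)
  thus ?thesis by (simp add: ts x x')
qed

text \<open>Coordinate i is rotated with speed i. Coordinates that coincide separate at once because
  their speeds differ; coordinates that differ remain different for small angles by
  continuity.\<close>

lemma perturb_inj:
  assumes x: "x \<in> torus n"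
  shows "\<forall>\<^sub>F e in at_right 0. inj_on (\<lambda>i. x i * cis (e * real i)) {..<n}"
proof -
  have pair: "\<forall>\<^sub>F e in at_right 0. x i * cis (e * real i) \<noteq> x j * cis (e * real j)"
    if ij: "i < j" "j < n" for i j
  proof (cases "x i = x j")
    case True
    have "\<forall>\<^sub>F e in at_right 0. 0 < e \<and> e < 1 / real (j - i)"
      using ij by (intro eventually_conj eventually_at_right_less eventually_at_rightI[of 0 "1 / real (j - i)"]) auto
    thus ?thesis
    proof eventually_elim
      case (elim e)
      \<comment> \<open>The relative angle lies strictly between 0 and 1, hence below pi, where the
        cosine is strictly less than 1.\<close>
      have th: "0 < e * real (j - i)" "e * real (j - i) < 1"
        using elim ij by (auto simp: field_simps)
      have "cos (e * real (j - i)) < cos 0"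
        using th pi_gt3 cos_monotone_0_pi[of 0 "e * real (j - i)"] by linarith
      hence ne: "cis (e * real (j - i)) \<noteq> 1" by (auto simp: complex_eq_iff)
      have "cis (e * real j) = cis (e * real i) * cis (e * real (j - i))"
        using ij by (simp add: cis_mult of_nat_diff algebra_simps)
      thus ?case using ne True torus_nonzero[OF x ij(2)] by auto
    qed
  next
    case False
    have "((\<lambda>e. x i * cis (e * real i) - x j * cis (e * real j)) \<longlongrightarrow> 
        x i * cis (0 * real i) - x j * cis (0 * real j)) (at_right 0)"
      by (intro tendsto_intros)
    hence "((\<lambda>e. x i * cis (e * real i) - x j * cis (e * real j)) \<longlongrightarrow> x i - x j) (at_right 0)"
      by simp
    from tendsto_imp_eventually_ne[OF this, of 0] False show ?thesis
      by (auto elim!: eventually_mono)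
  qed
  have "\<forall>\<^sub>F e in at_right 0. \<forall>p\<in>{(i, j). i < j \<and> j < n}.
      x (fst p) * cis (e * real (fst p)) \<noteq> x (snd p) * cis (e * real (snd p))"
  proof (rule eventually_ball_finite)
    show "finite {(i, j). i < j \<and> j < n}"
      by (rule finite_subset[of _ "{..<n} \<times> {..<n}"]) auto
  qed (use pair in auto)
  thus ?thesis
  proof eventually_elim
    case (elim e)
    show ?case
    proof (rule inj_onI)
      fix i j assume "i \<in> {..<n}" "j \<in> {..<n}" "x i * cis (e * real i) = x j * cis (e * real j)"
      thus "i = j" using elim by (cases i j rule: linorder_cases) (auto dest: sym)
    qed
  qed
qed

text \<open>The alternant vanishes at points with repeated coordinates. These are limits of points
  with distinct coordinates, where it can be cancelled, and both sides are continuous along the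
  perturbation. Identities thus reach spectra with multiplicities.\<close>

lemma laurent_cancel_alternant:
  assumes F: "laurent n F" and G: "laurent n G"
    and eq: "\<And>x. x \<in> torus n \<Longrightarrow> F x * alternant n (staircase n) x = G x * alternant n (staircase n) x"
    and x: "x \<in> torus n"
  shows "F x = G x"
proof (rule tendsto_unique)
  show "((\<lambda>e. F (\<lambda>i. x i * cis (e * real i))) \<longlongrightarrow> F x) (at_right 0)"
    by (rule laurent_tendsto_perturb[OF F x])
  have "((\<lambda>e. G (\<lambda>i. x i * cis (e * real i))) \<longlongrightarrow> G x) (at_right 0)"
    by (rule laurent_tendsto_perturb[OF G x])
  moreover have "\<forall>\<^sub>F e in at_right 0. G (\<lambda>i. x i * cis (e * real i)) = F (\<lambda>i. x i * cis (e * real i))"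
    using perturb_inj[OF x]
  proof eventually_elim
    case (elim e)
    have "(\<lambda>i. x i * cis (e * real i)) \<in> torus n"
      using x by (auto simp: torus_def norm_mult)
    from eq[OF this] alternant_staircase_nonzero[OF elim] show ?case by simp
  qed
  ultimately show "((\<lambda>e. F (\<lambda>i. x i * cis (e * real i))) \<longlongrightarrow> G x) (at_right 0)"
    using tendsto_cong by fast
qed auto

lemma psum_permute: "\<sigma> permutes {..<n} \<Longrightarrow> psum n (x \<circ> \<sigma>) = psum n x"
  unfolding psum_def fun_eq_iff o_def
  using sum.reindex_bij_betw[OF permutes_imp_bij, of \<sigma> "{..<n}"] by auto

section \<open>Constant terms as averages over roots of unity\<close>

definition grid_point :: "nat \<Rightarrow> (nat \<Rightarrow> nat) \<Rightarrow> nat \<Rightarrow> complex" where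
  "grid_point N k i = cis (2 * pi * real (k i) / real N)"

text \<open>Average over the n-tuples of N-th roots of unity. On Laurent polynomials whose exponents
  are smaller than N in absolute value it is exactly the constant term.\<close>

definition grid_avg :: "nat \<Rightarrow> nat \<Rightarrow> ((nat \<Rightarrow> complex) \<Rightarrow> complex) \<Rightarrow> complex" where
  "grid_avg n N f = (\<Sum>k\<in>{..<n} \<rightarrow>\<^sub>E {..<N}. f (grid_point N k)) / of_nat N ^ n"

lemma grid_point_torus: "grid_point N k \<in> torus n"
  by (simp add: torus_def grid_point_def)

lemma grid_avg_cong: "(\<And>x. x \<in> torus n \<Longrightarrow> f x = g x) \<Longrightarrow> grid_avg n N f = grid_avg n N g"
  unfolding grid_avg_def by (simp add: grid_point_torus)

lemma grid_avg_add: "grid_avg n N (\<lambda>x. f x + g x) = grid_avg n N f + grid_avg n N g"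
  by (simp add: grid_avg_def sum.distrib add_divide_distrib)

lemma grid_avg_cmult: "grid_avg n N (\<lambda>x. c * f x) = c * grid_avg n N f"
  by (simp add: grid_avg_def sum_distrib_left)

lemma grid_avg_0 [simp]: "grid_avg n N (\<lambda>x. 0) = 0"
  by (simp add: grid_avg_def)

lemma grid_avg_sum: "grid_avg n N (\<lambda>x. \<Sum>a\<in>A. f a x) = (\<Sum>a\<in>A. grid_avg n N (f a))"
  by (induction A rule: infinite_finite_induct) (auto simp: grid_avg_add)

text \<open>The bound on w excludes the nonzero multiples of N, so for nonzero w the ratio of the
  geometric sum is an N-th root of unity other than 1.\<close>

lemma sum_cis_powi:
  assumes "N > 0" "\<bar>w\<bar> < int N"
  shows "(\<Sum>k<N. cis (2 * pi * real k / real N) powi w) = (if w = 0 then of_nat N else 0)"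
proof (cases "w = 0")
  case False
  define z where "z = cis (2 * pi * of_int w / real N)"
  have pow: "cis (2 * pi * real k / real N) powi w = z ^ k" for k
    unfolding z_def cis_power_int Complex.DeMoivre by (rule arg_cong[where f = cis]) simp
  have "z \<noteq> 1"
  proof
    assume "z = 1"
    hence "cos (2 * pi * of_int w / real N) = 1" by (simp add: z_def complex_eq_iff)
    then obtain m :: int where "2 * pi * of_int w / real N = of_int m * 2 * pi"
      using cos_one_2pi_int by auto
    hence "real_of_int w = of_int m * real N" using assms by (simp add: field_simps)
    hence "w = m * int N" by (metis of_int_eq_iff of_int_mult of_int_of_nat_eq)
    with assms False show False
      by (metis abs_mult abs_of_nat dvd_triv_right dvd_imp_le_int not_le)
  qed
  moreover have "z ^ N = 1"
    using assms by (simp add: z_def Complex.DeMoivre)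
  ultimately show ?thesis using False by (simp add: pow sum_gp_strict)
qed auto

lemma grid_avg_lmon:
  assumes "N > 0" "\<And>i. i < n \<Longrightarrow> \<bar>w i\<bar> < int N"
  shows "grid_avg n N (lmon n w) = (if \<forall>i<n. w i = 0 then 1 else 0)"
proof -
  have "(\<Sum>k\<in>{..<n} \<rightarrow>\<^sub>E {..<N}. lmon n w (grid_point N k)) =
      (\<Prod>i<n. \<Sum>k<N. cis (2 * pi * real k / real N) powi w i)"
    unfolding lmon_def grid_point_def by (rule prod_sum_PiE[symmetric]) auto
  also have "\<dots> = (\<Prod>i<n. if w i = 0 then of_nat N else 0)"
    using assms by (intro prod.cong refl sum_cis_powi) auto
  also have "\<dots> = (if \<forall>i<n. w i = 0 then of_nat N ^ n else 0)"
    by (auto intro!: prod_zero)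
  finally show ?thesis using assms(1) by (simp add: grid_avg_def)
qed

lemma grid_avg_permute:
  assumes s: "\<sigma> permutes {..<n}"
  shows "grid_avg n N (\<lambda>x. f (x \<circ> \<sigma>)) = grid_avg n N f"
proof -
  have *: "k \<circ> \<tau> \<in> {..<n} \<rightarrow>\<^sub>E {..<N}" if "k \<in> {..<n} \<rightarrow>\<^sub>E {..<N}" "\<tau> permutes {..<n}" for k \<tau>
    using that permutes_in_image[OF that(2)] permutes_not_in[OF that(2)]
    by (auto simp: PiE_def Pi_def extensional_def)
  have "(\<Sum>k\<in>{..<n} \<rightarrow>\<^sub>E {..<N}. f (grid_point N k \<circ> \<sigma>)) = (\<Sum>k\<in>{..<n} \<rightarrow>\<^sub>E {..<N}. f (grid_point N k))"
  proof (rule sum.reindex_bij_witness[where i = "\<lambda>k. k \<circ> inv_into UNIV \<sigma>" and j = "\<lambda>k. k \<circ> \<sigma>"])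
    show "f (grid_point N (k \<circ> \<sigma>)) = f (grid_point N k \<circ> \<sigma>)" for k
      by (simp add: grid_point_def o_def fun_eq_iff arg_cong[where f = f])
  qed (use * s permutes_inv[OF s] permutes_inv_o[OF s] in \<open>auto simp: o_assoc[symmetric]\<close>)
  thus ?thesis by (simp add: grid_avg_def)
qed

section \<open>The Casimir operator on Jacobi--Trudi determinants\<close>

text \<open>Up to sign, these are the terms in the Leibniz expansion of \<open>jdet\<close>;
  derivations act on them by the product rule.\<close>

definition hprod :: "nat \<Rightarrow> (nat \<Rightarrow> complex) \<Rightarrow> (nat \<Rightarrow> int) \<Rightarrow> complex" where
  "hprod n p \<beta> = (\<Prod>a<n. hsym p (\<beta> a))"

text \<open>Differentiating h_k with respect to p_r gives h_{k-r} / r, so a derivative of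
  \<open>hprod\<close> lowers one index by r.\<close>

definition lower :: "(nat \<Rightarrow> int) \<Rightarrow> nat \<Rightarrow> nat \<Rightarrow> nat \<Rightarrow> int" where
  "lower \<beta> a r = \<beta>(a := \<beta> a - int r)"

text \<open>
  The action of the Casimir operator $\sum_{i,j} D_{E_{ij}} D_{E_{ji}}$ of the unitary group on the
  function \<open>M \<mapsto> hprod n p \<beta>\<close>, where \<open>p r\<close> is the trace of the \<open>r\<close>-th power of \<open>M\<close>. The sums
  over \<open>r\<close> and \<open>s\<close> are finite because complete symmetric functions of negative degree vanish.
\<close>

definition casimir :: "nat \<Rightarrow> nat \<Rightarrow> (nat \<Rightarrow> complex) \<Rightarrow> (nat \<Rightarrow> int) \<Rightarrow> complex" where
  "casimir n R p \<beta> = (\<Sum>a<n. \<Sum>r=1..R.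
     (\<Sum>c<r. p c * p (r - c)) * hprod n p (lower \<beta> a r) +
     (\<Sum>b<n. \<Sum>s=1..R. p (r + s) * hprod n p (lower (lower \<beta> a r) b s)))"

lemma sum_compositions:
  fixes f :: "nat \<Rightarrow> nat \<Rightarrow> 'a :: comm_monoid_add"
  assumes "\<And>c d. c + d > R \<Longrightarrow> f c d = 0"
  shows "(\<Sum>r=1..R. \<Sum>c=1..<r. f c (r - c)) = (\<Sum>c=1..R. \<Sum>d=1..R. f c d)"
proof -
  have "(\<Sum>r=1..R. \<Sum>c=1..<r. f c (r - c)) = (\<Sum>(r, c)\<in>Sigma {1..R} (\<lambda>r. {1..<r}). f c (r - c))"
    by (rule sum.Sigma) auto
  also have "\<dots> = (\<Sum>(c, d)\<in>{(c, d). c \<in> {1..R} \<and> d \<in> {1..R} \<and> c + d \<le> R}. f c d)"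
    by (rule sum.reindex_bij_witness[where i = "\<lambda>(c, d). (c + d, c)" and j = "\<lambda>(r, c). (c, r - c)"]) auto
  also have "\<dots> = (\<Sum>(c, d)\<in>{1..R} \<times> {1..R}. f c d)"
    by (rule sum.mono_neutral_left) (auto intro!: assms)
  also have "\<dots> = (\<Sum>c=1..R. \<Sum>d=1..R. f c d)"
    by (rule sum.cartesian_product[symmetric])
  finally show ?thesis .
qed

text \<open>The case of one factor. The splittings with c = 0 give p_0 k h_k by Newton's identity.
  The remaining splittings become the sum of the p_c (k - c) h_{k-c}, the merging terms the sum of
  the (r - 1) p_r h_{k-r}, and together they are (k - 1) k h_k.\<close>

lemma casimir_single:
  assumes R: "k \<le> int R"
  shows "(\<Sum>r=1..R. (\<Sum>c<r. p c * p (r - c)) * hsym p (k - int r) +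
           (\<Sum>s=1..R. p (r + s) * hsym p (k - int r - int s))) =
         (of_int k ^ 2 + (p 0 - 1) * of_int k) * hsym p k"
proof -
  let ?N = "\<lambda>k. of_int k * hsym p k"
  have "(\<Sum>r=1..R. (\<Sum>c<r. p c * p (r - c)) * hsym p (k - int r)) =
      (\<Sum>r=1..R. p 0 * (p r * hsym p (k - int r))) +
      (\<Sum>r=1..R. \<Sum>c=1..<r. p c * p (r - c) * hsym p (k - int c - int (r - c)))"
    unfolding sum.distrib[symmetric]
  proof (rule sum.cong)
    fix r assume "r \<in> {1..R}"
    hence "{..<r} = insert 0 {1..<r}" by auto
    hence "(\<Sum>c<r. p c * p (r - c)) = p 0 * p r + (\<Sum>c=1..<r. p c * p (r - c))" by simp
    thus "(\<Sum>c<r. p c * p (r - c)) * hsym p (k - int r) = p 0 * (p r * hsym p (k - int r)) +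
        (\<Sum>c=1..<r. p c * p (r - c) * hsym p (k - int c - int (r - c)))"
      by (simp add: distrib_right sum_distrib_right of_nat_diff mult.assoc)
  qed simp
  also have "(\<Sum>r=1..R. p 0 * (p r * hsym p (k - int r))) = p 0 * ?N k"
    unfolding hsym_newton[OF R] by (rule sum_distrib_left[symmetric])
  also have "(\<Sum>r=1..R. \<Sum>c=1..<r. p c * p (r - c) * hsym p (k - int c - int (r - c))) =
      (\<Sum>c=1..R. \<Sum>d=1..R. p c * p d * hsym p (k - int c - int d))"
    using R by (intro sum_compositions[where f = "\<lambda>c d. p c * p d * hsym p (k - int c - int d)"]) simp
  also have "\<dots> = (\<Sum>c=1..R. p c * ?N (k - int c))"
  proof (rule sum.cong)
    fix c assume "c \<in> {1..R}"
    hence "k - int c \<le> int R" using R by simp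
    from hsym_newton[OF this, of p]
    show "(\<Sum>d=1..R. p c * p d * hsym p (k - int c - int d)) = p c * ?N (k - int c)"
      by (simp add: sum_distrib_left mult.assoc)
  qed simp
  finally have first: "(\<Sum>r=1..R. (\<Sum>c<r. p c * p (r - c)) * hsym p (k - int r)) =
      p 0 * ?N k + (\<Sum>c=1..R. p c * ?N (k - int c))" .
  have "(\<Sum>r=1..R. \<Sum>s=1..R. p (r + s) * hsym p (k - int r - int s)) =
      (\<Sum>r=1..R. \<Sum>c=1..<r. p (c + (r - c)) * hsym p (k - int c - int (r - c)))"
    using R by (intro sum_compositions[where f = "\<lambda>c d. p (c + d) * hsym p (k - int c - int d)", symmetric]) simp
  also have "\<dots> = (\<Sum>r=1..R. of_int (int r - 1) * (p r * hsym p (k - int r)))"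
  proof (rule sum.cong)
    fix r assume "r \<in> {1..R}"
    have "(\<Sum>c=1..<r. p (c + (r - c)) * hsym p (k - int c - int (r - c))) =
        (\<Sum>c=1..<r. p r * hsym p (k - int r))"
      by (intro sum.cong) (auto simp: of_nat_diff)
    thus "(\<Sum>c=1..<r. p (c + (r - c)) * hsym p (k - int c - int (r - c))) =
        of_int (int r - 1) * (p r * hsym p (k - int r))"
      using \<open>r \<in> {1..R}\<close> by (simp add: of_nat_diff)
  qed simp
  finally have second: "(\<Sum>r=1..R. \<Sum>s=1..R. p (r + s) * hsym p (k - int r - int s)) =
      (\<Sum>r=1..R. of_int (int r - 1) * (p r * hsym p (k - int r)))" .
  have "(\<Sum>c=1..R. p c * ?N (k - int c)) + (\<Sum>r=1..R. of_int (int r - 1) * (p r * hsym p (k - int r))) =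
      (\<Sum>r=1..R. of_int (k - 1) * (p r * hsym p (k - int r)))"
    unfolding sum.distrib[symmetric] by (intro sum.cong) (auto simp: algebra_simps)
  also have "\<dots> = of_int (k - 1) * ?N k"
    unfolding hsym_newton[OF R] by (rule sum_distrib_left[symmetric])
  finally show ?thesis
    unfolding sum.distrib first second by (simp add: algebra_simps power2_eq_square)
qed

lemma hprod_lower:
  "a < n \<Longrightarrow> hprod n p (lower \<beta> a r) = hsym p (\<beta> a - int r) * (\<Prod>b\<in>{..<n} - {a}. hsym p (\<beta> b))"
  unfolding hprod_def lower_def by (subst prod.remove[of _ a]) (auto intro!: prod.cong)

lemma hprod_remove: "a < n \<Longrightarrow> hprod n p \<beta> = hsym p (\<beta> a) * (\<Prod>b\<in>{..<n} - {a}. hsym p (\<beta> b))"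
  unfolding hprod_def by (rule prod.remove) auto

lemma hprod_lower_lower_same:
  "a < n \<Longrightarrow> hprod n p (lower (lower \<beta> a r) a s) =
     hsym p (\<beta> a - int r - int s) * (\<Prod>b\<in>{..<n} - {a}. hsym p (\<beta> b))"
  unfolding hprod_def lower_def by (subst prod.remove[of _ a]) (auto intro!: prod.cong)

lemma hprod_lower_lower:
  "a < n \<Longrightarrow> b < n \<Longrightarrow> b \<noteq> a \<Longrightarrow> hprod n p (lower (lower \<beta> a r) b s) =
     hsym p (\<beta> a - int r) * hsym p (\<beta> b - int s) * (\<Prod>c\<in>{..<n} - {a} - {b}. hsym p (\<beta> c))"
  unfolding hprod_def lower_def
  by (subst prod.remove[of _ a], simp, simp, subst prod.remove[of _ b])
     (auto simp: mult.assoc intro!: prod.cong)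

text \<open>Products of complete symmetric functions are not eigenfunctions: each factor contributes
  a scalar through \<open>casimir_single\<close>, but pairs of different factors exchange degree.
  This exchange part is isolated here because the radial computation produces the same sums.\<close>

lemma casimir_eq:
  assumes R: "\<And>a. a < n \<Longrightarrow> \<beta> a \<le> int R"
  shows "casimir n R p \<beta> =
     (\<Sum>a<n. of_int (\<beta> a) ^ 2 + (p 0 - 1) * of_int (\<beta> a)) * hprod n p \<beta> +
     (\<Sum>a<n. \<Sum>b\<in>{..<n} - {a}. (\<Sum>r=1..R. \<Sum>s=1..R. p (r + s) * (hsym p (\<beta> a - int r) * hsym p (\<beta> b - int s))) *
        (\<Prod>c\<in>{..<n} - {a} - {b}. hsym p (\<beta> c)))"
proof -
  have "(\<Sum>r=1..R. (\<Sum>c<r. p c * p (r - c)) * hprod n p (lower \<beta> a r) +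
     (\<Sum>b<n. \<Sum>s=1..R. p (r + s) * hprod n p (lower (lower \<beta> a r) b s))) =
     (of_int (\<beta> a) ^ 2 + (p 0 - 1) * of_int (\<beta> a)) * hprod n p \<beta> +
     (\<Sum>b\<in>{..<n} - {a}. (\<Sum>r=1..R. \<Sum>s=1..R. p (r + s) * (hsym p (\<beta> a - int r) * hsym p (\<beta> b - int s))) *
        (\<Prod>c\<in>{..<n} - {a} - {b}. hsym p (\<beta> c)))" if a: "a < n" for a
  proof -
    let ?Q = "\<Prod>b\<in>{..<n} - {a}. hsym p (\<beta> b)"
    note outer = sum_distrib_right[of "\<lambda>r. (\<Sum>c<r. p c * p (r - c)) * hsym p (\<beta> a - int r) +
           (\<Sum>s=1..R. p (r + s) * hsym p (\<beta> a - int r - int s))" "{1..R}" ?Q]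
    have "(\<Sum>r=1..R. (\<Sum>c<r. p c * p (r - c)) * hprod n p (lower \<beta> a r) +
       (\<Sum>b<n. \<Sum>s=1..R. p (r + s) * hprod n p (lower (lower \<beta> a r) b s))) =
      (\<Sum>r=1..R. (\<Sum>c<r. p c * p (r - c)) * hsym p (\<beta> a - int r) +
           (\<Sum>s=1..R. p (r + s) * hsym p (\<beta> a - int r - int s))) * ?Q +
      (\<Sum>r=1..R. \<Sum>b\<in>{..<n} - {a}. \<Sum>s=1..R. p (r + s) * hprod n p (lower (lower \<beta> a r) b s))"
      unfolding outer sum.distrib[symmetric]
    proof (rule sum.cong)
      fix r
      have "(\<Sum>b<n. \<Sum>s=1..R. p (r + s) * hprod n p (lower (lower \<beta> a r) b s)) =
         (\<Sum>s=1..R. p (r + s) * hprod n p (lower (lower \<beta> a r) a s)) +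
         (\<Sum>b\<in>{..<n} - {a}. \<Sum>s=1..R. p (r + s) * hprod n p (lower (lower \<beta> a r) b s))"
        using a by (intro sum.remove) auto
      thus "(\<Sum>c<r. p c * p (r - c)) * hprod n p (lower \<beta> a r) +
         (\<Sum>b<n. \<Sum>s=1..R. p (r + s) * hprod n p (lower (lower \<beta> a r) b s)) =
        ((\<Sum>c<r. p c * p (r - c)) * hsym p (\<beta> a - int r) +
         (\<Sum>s=1..R. p (r + s) * hsym p (\<beta> a - int r - int s))) * ?Q +
        (\<Sum>b\<in>{..<n} - {a}. \<Sum>s=1..R. p (r + s) * hprod n p (lower (lower \<beta> a r) b s))"
        using a by (simp add: hprod_lower[of a n p \<beta>] hprod_lower_lower_same distrib_right sum_distrib_right mult.assoc)
    qed simp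
    also have "(\<Sum>r=1..R. (\<Sum>c<r. p c * p (r - c)) * hsym p (\<beta> a - int r) +
           (\<Sum>s=1..R. p (r + s) * hsym p (\<beta> a - int r - int s))) * ?Q =
         (of_int (\<beta> a) ^ 2 + (p 0 - 1) * of_int (\<beta> a)) * hprod n p \<beta>"
      unfolding casimir_single[OF R[OF a]] by (simp add: hprod_remove[OF a])
    also have "(\<Sum>r=1..R. \<Sum>b\<in>{..<n} - {a}. \<Sum>s=1..R. p (r + s) * hprod n p (lower (lower \<beta> a r) b s)) =
        (\<Sum>b\<in>{..<n} - {a}. (\<Sum>r=1..R. \<Sum>s=1..R. p (r + s) * (hsym p (\<beta> a - int r) * hsym p (\<beta> b - int s))) *
          (\<Prod>c\<in>{..<n} - {a} - {b}. hsym p (\<beta> c)))"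
      by (subst sum.swap) (auto simp: hprod_lower_lower a sum_distrib_right mult.assoc intro!: sum.cong)
    finally show ?thesis .
  qed
  note row = this
  have "casimir n R p \<beta> = (\<Sum>a<n. (of_int (\<beta> a) ^ 2 + (p 0 - 1) * of_int (\<beta> a)) * hprod n p \<beta> +
     (\<Sum>b\<in>{..<n} - {a}. (\<Sum>r=1..R. \<Sum>s=1..R. p (r + s) * (hsym p (\<beta> a - int r) * hsym p (\<beta> b - int s))) *
        (\<Prod>c\<in>{..<n} - {a} - {b}. hsym p (\<beta> c))))"
    unfolding casimir_def by (intro sum.cong refl row) auto
  also have "\<dots> = (\<Sum>a<n. of_int (\<beta> a) ^ 2 + (p 0 - 1) * of_int (\<beta> a)) * hprod n p \<beta> +
     (\<Sum>a<n. \<Sum>b\<in>{..<n} - {a}. (\<Sum>r=1..R. \<Sum>s=1..R. p (r + s) * (hsym p (\<beta> a - int r) * hsym p (\<beta> b - int s))) *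
        (\<Prod>c\<in>{..<n} - {a} - {b}. hsym p (\<beta> c)))"
    by (subst sum.distrib, subst sum_distrib_right[symmetric]) (rule refl)
  finally show ?thesis .
qed

section \<open>Logarithmic derivatives in the eigenvalue variables\<close>

text \<open>The operator x_i d/dx_i, taken as the derivative along x_i e^t at t = 0, for which every
  monomial is an eigenvector. The relation is required at all points with nonzero coordinates, so
  that it can be iterated.\<close>

definition euler_deriv ::
    "nat \<Rightarrow> nat \<Rightarrow> ((nat \<Rightarrow> complex) \<Rightarrow> complex) \<Rightarrow> ((nat \<Rightarrow> complex) \<Rightarrow> complex) \<Rightarrow> bool" where
  "euler_deriv n i F G \<longleftrightarrow> (\<forall>x. (\<forall>j<n. x j \<noteq> 0) \<longrightarrow>
     ((\<lambda>t. F (x(i := x i * exp t))) has_field_derivative G x) (at 0))"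

lemma euler_derivD: "euler_deriv n i F G \<Longrightarrow> (\<And>j. j < n \<Longrightarrow> x j \<noteq> 0) \<Longrightarrow>
   ((\<lambda>t. F (x(i := x i * exp t))) has_field_derivative G x) (at 0)"
  by (simp add: euler_deriv_def)

lemma euler_deriv_unique:
  assumes "euler_deriv n i F G" "euler_deriv n i F' G'" "\<And>x. (\<And>j. j < n \<Longrightarrow> x j \<noteq> 0) \<Longrightarrow> F x = F' x"
    "\<And>j. j < n \<Longrightarrow> x j \<noteq> 0"
  shows "G x = G' x"
proof -
  have "(\<lambda>t. F (x(i := x i * exp t))) = (\<lambda>t. F' (x(i := x i * exp t)))"
    using assms(4) by (intro ext assms(3)) auto
  moreover have "((\<lambda>t. F (x(i := x i * exp t))) has_field_derivative G x) (at 0)"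
    using assms(4) by (intro euler_derivD[OF assms(1)]) auto
  ultimately have "((\<lambda>t. F' (x(i := x i * exp t))) has_field_derivative G x) (at 0)"
    by (simp only:)
  moreover have "((\<lambda>t. F' (x(i := x i * exp t))) has_field_derivative G' x) (at 0)"
    using assms(4) by (intro euler_derivD[OF assms(2)]) auto
  ultimately show ?thesis by (rule DERIV_unique)
qed

lemma euler_deriv_mult:
  assumes "euler_deriv n i F F'" "euler_deriv n i G G'"
  shows "euler_deriv n i (\<lambda>x. F x * G x) (\<lambda>x. F' x * G x + F x * G' x)"
  unfolding euler_deriv_def
proof (intro allI impI)
  fix x :: "nat \<Rightarrow> complex" assume x: "\<forall>j<n. x j \<noteq> 0"
  from DERIV_mult[OF euler_derivD[OF assms(1), of x] euler_derivD[OF assms(2), of x]] x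
  show "((\<lambda>t. F (x(i := x i * exp t)) * G (x(i := x i * exp t))) has_field_derivative F' x * G x + F x * G' x) (at 0)"
    by (simp add: algebra_simps)
qed

lemma euler_deriv_cmult:
  "euler_deriv n i F F' \<Longrightarrow> euler_deriv n i (\<lambda>x. c * F x) (\<lambda>x. c * F' x)"
  unfolding euler_deriv_def using DERIV_cmult by blast

lemma euler_deriv_add:
  "euler_deriv n i F F' \<Longrightarrow> euler_deriv n i G G' \<Longrightarrow> euler_deriv n i (\<lambda>x. F x + G x) (\<lambda>x. F' x + G' x)"
  unfolding euler_deriv_def using DERIV_add by blast

lemma euler_deriv_sum:
  assumes "\<And>a. a \<in> A \<Longrightarrow> euler_deriv n i (F a) (F' a)"
  shows "euler_deriv n i (\<lambda>x. \<Sum>a\<in>A. F a x) (\<lambda>x. \<Sum>a\<in>A. F' a x)"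
  using assms unfolding euler_deriv_def by (intro allI impI DERIV_sum) auto

lemma euler_deriv_prod:
  assumes "\<And>a. a \<in> A \<Longrightarrow> euler_deriv n i (F a) (F' a)"
  shows "euler_deriv n i (\<lambda>x. \<Prod>a\<in>A. F a x) (\<lambda>x. \<Sum>a\<in>A. F' a x * (\<Prod>b\<in>A-{a}. F b x))"
  unfolding euler_deriv_def
proof (intro allI impI)
  fix x :: "nat \<Rightarrow> complex" assume x: "\<forall>j<n. x j \<noteq> 0"
  show "((\<lambda>t. \<Prod>a\<in>A. F a (x(i := x i * exp t))) has_field_derivative
       (\<Sum>a\<in>A. F' a x * (\<Prod>b\<in>A-{a}. F b x))) (at 0)"
    using has_field_derivative_prod[of A "\<lambda>a t. F a (x(i := x i * exp t))" "\<lambda>a. F' a x" 0]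
      euler_derivD[OF assms, of _ x] x by simp
qed

lemma euler_deriv_power: "i < n \<Longrightarrow> euler_deriv n i (\<lambda>x. x i ^ r) (\<lambda>x. of_nat r * x i ^ r)"
  unfolding euler_deriv_def
  by (auto simp: power_mult_distrib exp_of_nat_mult[symmetric] intro!: derivative_eq_intros)

lemma euler_deriv_lmon: 
  assumes "i < n"
  shows "euler_deriv n i (lmon n v) (\<lambda>x. of_int (v i) * lmon n v x)"
proof -
  have "lmon n v (x(i := x i * exp t)) = lmon n v x * exp (of_int (v i) * t)" for x t
    unfolding lmon_def using assms
    by (subst (1 2) prod.remove[of _ i]) (auto simp: power_int_mult_distrib exp_power_int mult_ac intro!: prod.cong)
  thus ?thesis
    unfolding euler_deriv_def by (auto intro!: derivative_eq_intros)
qed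

text \<open>The k-fold application of x_i d/dx_i to the alternant: in the term of \<sigma> the
  variable x_i carries the exponent \<open>w (inv_into UNIV \<sigma> i)\<close>.\<close>

definition alternant_power :: "nat \<Rightarrow> nat \<Rightarrow> (nat \<Rightarrow> int) \<Rightarrow> nat \<Rightarrow> (nat \<Rightarrow> complex) \<Rightarrow> complex" where
  "alternant_power n k w i x =
     (\<Sum>\<sigma> | \<sigma> permutes {..<n}. of_int (sign \<sigma>) * of_int (w (inv_into UNIV \<sigma> i)) ^ k * lmon n w (x \<circ> \<sigma>))"

lemma alternant_power_0: "alternant_power n 0 w i = alternant n w"
  by (simp add: alternant_power_def alternant_def fun_eq_iff)

lemma euler_deriv_alternant_power:
  assumes "i < n"
  shows "euler_deriv n i (alternant_power n k w i) (alternant_power n (Suc k) w i)"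
  unfolding alternant_power_def
proof (rule euler_deriv_sum)
  fix \<sigma> assume "\<sigma> \<in> {\<sigma>. \<sigma> permutes {..<n}}"
  hence s: "\<sigma> permutes {..<n}" by simp
  have "euler_deriv n i (\<lambda>x. of_int (sign \<sigma>) * of_int (w (inv_into UNIV \<sigma> i)) ^ k * lmon n (w \<circ> inv_into UNIV \<sigma>) x)
     (\<lambda>x. of_int (sign \<sigma>) * of_int (w (inv_into UNIV \<sigma> i)) ^ k * (of_int ((w \<circ> inv_into UNIV \<sigma>) i) * lmon n (w \<circ> inv_into UNIV \<sigma>) x))"
    by (intro euler_deriv_cmult euler_deriv_lmon assms)
  thus "euler_deriv n i (\<lambda>x. of_int (sign \<sigma>) * of_int (w (inv_into UNIV \<sigma> i)) ^ k * lmon n w (x \<circ> \<sigma>))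
     (\<lambda>x. of_int (sign \<sigma>) * of_int (w (inv_into UNIV \<sigma> i)) ^ Suc k * lmon n w (x \<circ> \<sigma>))"
    by (simp add: lmon_permute_inv[OF s] mult_ac)
qed

text \<open>In every term the exponents of x_0, ..., x_{n-1} are a rearrangement of w, so alternants
  are eigenfunctions of the sum over i of (x_i d/dx_i)^k.\<close>

lemma sum_alternant_power:
  "(\<Sum>i<n. alternant_power n k w i x) = (\<Sum>i<n. of_int (w i) ^ k) * alternant n w x"
proof -
  have "(\<Sum>i<n. of_int (w (inv_into UNIV \<sigma> i)) ^ k) = (\<Sum>i<n. of_int (w i) ^ k :: complex)"
    if "\<sigma> permutes {..<n}" for \<sigma>
    using sum.reindex_bij_betw[OF permutes_imp_bij[OF permutes_inv[OF that]], of "\<lambda>i. of_int (w i) ^ k :: complex"] .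
  note reindex = this
  have "(\<Sum>i<n. alternant_power n k w i x) =
     (\<Sum>\<sigma> | \<sigma> permutes {..<n}. \<Sum>i<n. of_int (w (inv_into UNIV \<sigma> i)) ^ k * (of_int (sign \<sigma>) * lmon n w (x \<circ> \<sigma>)))"
    unfolding alternant_power_def by (subst sum.swap) (simp add: mult_ac)
  also have "\<dots> = (\<Sum>\<sigma> | \<sigma> permutes {..<n}. (\<Sum>i<n. of_int (w i) ^ k) * (of_int (sign \<sigma>) * lmon n w (x \<circ> \<sigma>)))"
    by (intro sum.cong refl) (simp only: sum_distrib_right[symmetric] reindex mem_Collect_eq)
  finally show ?thesis by (simp only: alternant_def sum_distrib_left)
qed

text \<open>\<open>hsym1\<close> and \<open>hsym2\<close> are the first and second logarithmic
  derivatives of h_k in x_i. They come from x_i dp_r/dx_i = r x_i^r and dh_k/dp_r = h_{k-r} / r,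
  with the sums cut at R.\<close>

definition hsym1 :: "nat \<Rightarrow> nat \<Rightarrow> int \<Rightarrow> nat \<Rightarrow> (nat \<Rightarrow> complex) \<Rightarrow> complex" where
  "hsym1 n R k i x = (\<Sum>r=1..R. x i ^ r * hsym (psum n x) (k - int r))"

definition hsym2 :: "nat \<Rightarrow> nat \<Rightarrow> int \<Rightarrow> nat \<Rightarrow> (nat \<Rightarrow> complex) \<Rightarrow> complex" where
  "hsym2 n R k i x = (\<Sum>r=1..R. of_nat r * x i ^ r * hsym (psum n x) (k - int r) +
     x i ^ r * hsym1 n R (k - int r) i x)"

lemma euler_deriv_hsym:
  assumes "i < n" "k \<le> int R"
  shows "euler_deriv n i (\<lambda>x. hsym (psum n x) k) (hsym1 n R k i)"
  unfolding euler_deriv_def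
proof (intro allI impI)
  fix x :: "nat \<Rightarrow> complex"
  have "((\<lambda>t. psum n (x(i := x i * exp t)) r) has_field_derivative of_nat r * x i ^ r) (at 0)" for r
  proof -
    have "psum n (x(i := x i * exp t)) r = x i ^ r * exp (of_nat r * t) + (\<Sum>j\<in>{..<n}-{i}. x j ^ r)" for t
      unfolding psum_def using assms(1)
      by (subst sum.remove[of _ i]) (auto simp: power_mult_distrib exp_of_nat_mult)
    thus ?thesis by (auto intro!: derivative_eq_intros)
  qed
  from hsym_has_field_derivative[OF this assms(2)]
  show "((\<lambda>t. hsym (psum n (x(i := x i * exp t))) k) has_field_derivative hsym1 n R k i x) (at 0)"
    by (simp add: hsym1_def)
qed

lemma euler_deriv_hsym1:
  assumes "i < n" "k \<le> int R"
  shows "euler_deriv n i (hsym1 n R k i) (hsym2 n R k i)"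
  unfolding hsym1_def hsym2_def
  by (intro euler_deriv_sum euler_deriv_mult euler_deriv_power euler_deriv_hsym[unfolded hsym1_def] assms)
     (use assms in auto)

text \<open>The cross terms of the second-order operator in the eigenvalues coincide with the
  exchange terms of \<open>casimir_eq\<close>. This is the link between the operator on matrices and
  the operator on spectra.\<close>

lemma sum_hsym1_mult:
  "(\<Sum>i<n. hsym1 n R k i x * hsym1 n R l i x) =
     (\<Sum>r=1..R. \<Sum>s=1..R. psum n x (r + s) * (hsym (psum n x) (k - int r) * hsym (psum n x) (l - int s)))"
proof -
  have "(\<Sum>i<n. hsym1 n R k i x * hsym1 n R l i x) =
     (\<Sum>i<n. \<Sum>r=1..R. \<Sum>s=1..R. x i ^ (r + s) * (hsym (psum n x) (k - int r) * hsym (psum n x) (l - int s)))"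
    unfolding hsym1_def sum_product by (intro sum.cong refl) (simp add: power_add mult_ac)
  also have "\<dots> = (\<Sum>r=1..R. \<Sum>i<n. \<Sum>s=1..R. x i ^ (r + s) * (hsym (psum n x) (k - int r) * hsym (psum n x) (l - int s)))"
    by (rule sum.swap)
  also have "\<dots> = (\<Sum>r=1..R. \<Sum>s=1..R. \<Sum>i<n. x i ^ (r + s) * (hsym (psum n x) (k - int r) * hsym (psum n x) (l - int s)))"
    by (intro sum.cong refl sum.swap)
  finally show ?thesis by (simp add: psum_def sum_distrib_right)
qed

lemma jdet_single_row:
  assumes "n > 0"
  shows "jdet n p (\<lambda>i. staircase n i + (if i = 0 then k else 0)) = hsym p k"
proof -
  let ?A = "Matrix.mat n n (\<lambda>(i, j). hsym p (staircase n i + (if i = 0 then k else 0) - staircase n j))"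
  have "Determinant.det ?A = prod_list (diag_mat ?A)"
    by (rule det_upper_triangular[of _ n]) (auto simp: upper_triangular_def staircase_def)
  also have "diag_mat ?A = map (\<lambda>i. if i = 0 then hsym p k else 1) [0..<n]"
    by (auto simp: diag_mat_def)
  also have "[0..<n] = 0 # map Suc [0..<n - 1]"
    using assms by (cases n) (auto simp: map_Suc_upt upt_conv_Cons simp del: upt_Suc)
  finally show ?thesis by (simp add: jdet_def map_replicate_const comp_def)
qed

text \<open>The mixed terms are not computed directly. By Jacobi-Trudi, Vandermonde times h_k is the
  alternant with exponents delta + (k, 0, ..., 0), an eigenfunction of the sum of the (x_i
  d/dx_i)^2. Subtracting the eigenvalue of the Vandermonde leaves (n - 1 + k)^2 - (n - 1)^2.\<close>

lemma alternant_times_hsym_second_order: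
  assumes "k \<le> int R" and x: "\<And>j. j < n \<Longrightarrow> x j \<noteq> 0" and n: "n > 0"
  shows "(\<Sum>i<n. 2 * alternant_power n 1 (staircase n) i x * hsym1 n R k i x +
            alternant n (staircase n) x * hsym2 n R k i x) =
         (of_int k ^ 2 + 2 * (of_nat n - 1) * of_int k) * alternant n (staircase n) x * hsym (psum n x) k"
proof (cases "k < 0")
  case True
  hence "hsym1 n R k i x = 0" "hsym2 n R k i x = 0" for i
    by (auto simp: hsym1_def hsym2_def intro!: sum.neutral)
  thus ?thesis using True by simp
next
  case False
  define \<delta> where "\<delta> = staircase n"
  define g where "g = (\<lambda>i. \<delta> i + (if i = 0 then k else 0))"
  define h where "h = (\<lambda>x. hsym (psum n x) k)"
  have prod_eq: "alternant n \<delta> x * h x = alternant n g x" for x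
    using jacobi_trudi[of n g x] jdet_single_row[of n "psum n x" k] False
    using n by (auto simp: g_def \<delta>_def h_def staircase_eq)
  let ?A0 = "alternant_power n 0 \<delta>" and ?A1 = "alternant_power n 1 \<delta>" and ?A2 = "alternant_power n 2 \<delta>"
  \<comment> \<open>The factorization \<open>prod_eq\<close> holds at every point, so both sides may
    be differentiated and the derivatives compared; \<open>eq2\<close> differentiates the result
    once more.\<close>
  have eq1: "alternant_power n 1 g i x = ?A1 i x * h x + ?A0 i x * hsym1 n R k i x"
    if i: "i < n" and x: "\<And>j. j < n \<Longrightarrow> x j \<noteq> 0" for i x
  proof (rule euler_deriv_unique[OF _ _ _ x])
    show "euler_deriv n i (alternant_power n 0 g i) (alternant_power n 1 g i)"
      using euler_deriv_alternant_power[OF i, of 0 g] by simp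
    show "euler_deriv n i (\<lambda>x. ?A0 i x * h x) (\<lambda>x. ?A1 i x * h x + ?A0 i x * hsym1 n R k i x)"
      using euler_deriv_alternant_power[OF i, of 0 \<delta>] unfolding h_def
      by (intro euler_deriv_mult euler_deriv_hsym i assms(1)) simp
  qed (auto simp: alternant_power_0 prod_eq)
  have eq2: "alternant_power n 2 g i x = ?A2 i x * h x + 2 * ?A1 i x * hsym1 n R k i x + ?A0 i x * hsym2 n R k i x"
    if i: "i < n" for i
  proof -
    have "alternant_power n 2 g i x = (?A2 i x * h x + ?A1 i x * hsym1 n R k i x) +
       (?A1 i x * hsym1 n R k i x + ?A0 i x * hsym2 n R k i x)"
    proof (rule euler_deriv_unique[OF _ _ _ x])
      show "euler_deriv n i (alternant_power n 1 g i) (alternant_power n 2 g i)"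
        using euler_deriv_alternant_power[OF i, of 1 g] by (simp add: numeral_2_eq_2)
      show "euler_deriv n i (\<lambda>x. ?A1 i x * h x + ?A0 i x * hsym1 n R k i x)
         (\<lambda>x. (?A2 i x * h x + ?A1 i x * hsym1 n R k i x) +
              (?A1 i x * hsym1 n R k i x + ?A0 i x * hsym2 n R k i x))"
        using euler_deriv_alternant_power[OF i, of 0 \<delta>] euler_deriv_alternant_power[OF i, of 1 \<delta>] unfolding h_def
        by (intro euler_deriv_add euler_deriv_mult euler_deriv_hsym euler_deriv_hsym1 i assms(1))
           (simp_all add: numeral_2_eq_2)
    qed (rule eq1[OF i])
    thus ?thesis by simp
  qed
  have "(\<Sum>i<n. of_int (g i) ^ 2) * alternant n g x =
     (\<Sum>i<n. ?A2 i x) * h x + (\<Sum>i<n. 2 * ?A1 i x * hsym1 n R k i x + alternant n \<delta> x * hsym2 n R k i x)"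
    unfolding sum_alternant_power[symmetric]
    by (simp add: eq2 sum.distrib sum_distrib_right alternant_power_0)
  also have "(\<Sum>i<n. ?A2 i x) = (\<Sum>i<n. of_int (\<delta> i) ^ 2) * alternant n \<delta> x"
    by (rule sum_alternant_power)
  also have "(\<Sum>i<n. of_int (g i) ^ 2 :: complex) =
     (\<Sum>i<n. of_int (\<delta> i) ^ 2 + (if i = 0 then of_int k ^ 2 + 2 * (of_nat n - 1) * of_int k else 0))"
    by (intro sum.cong) (auto simp: g_def \<delta>_def staircase_def algebra_simps power2_eq_square)
  also have "\<dots> = (\<Sum>i<n. of_int (\<delta> i) ^ 2) + (of_int k ^ 2 + 2 * (of_nat n - 1) * of_int k)"
    using n by (simp add: sum.distrib)
  finally show ?thesis
    unfolding prod_eq[symmetric] by (simp add: \<delta>_def h_def algebra_simps)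
qed

definition hprod1 :: "nat \<Rightarrow> nat \<Rightarrow> (nat \<Rightarrow> int) \<Rightarrow> nat \<Rightarrow> (nat \<Rightarrow> complex) \<Rightarrow> complex" where
  "hprod1 n R \<beta> i x = (\<Sum>a<n. hsym1 n R (\<beta> a) i x * (\<Prod>b\<in>{..<n}-{a}. hsym (psum n x) (\<beta> b)))"

definition hprod2 :: "nat \<Rightarrow> nat \<Rightarrow> (nat \<Rightarrow> int) \<Rightarrow> nat \<Rightarrow> (nat \<Rightarrow> complex) \<Rightarrow> complex" where
  "hprod2 n R \<beta> i x = (\<Sum>a<n. hsym2 n R (\<beta> a) i x * (\<Prod>b\<in>{..<n}-{a}. hsym (psum n x) (\<beta> b)) +
     hsym1 n R (\<beta> a) i x * (\<Sum>b\<in>{..<n}-{a}. hsym1 n R (\<beta> b) i x *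
       (\<Prod>c\<in>{..<n}-{a}-{b}. hsym (psum n x) (\<beta> c))))"

lemma euler_deriv_hprod:
  assumes "i < n" "\<And>a. a < n \<Longrightarrow> \<beta> a \<le> int R"
  shows "euler_deriv n i (\<lambda>x. hprod n (psum n x) \<beta>) (hprod1 n R \<beta> i)"
  unfolding hprod_def hprod1_def
  by (intro euler_deriv_prod euler_deriv_hsym assms) (use assms in auto)

lemma euler_deriv_hprod1:
  assumes "i < n" "\<And>a. a < n \<Longrightarrow> \<beta> a \<le> int R"
  shows "euler_deriv n i (hprod1 n R \<beta> i) (hprod2 n R \<beta> i)"
  unfolding hprod1_def hprod2_def
  by (intro euler_deriv_sum euler_deriv_mult euler_deriv_prod euler_deriv_hsym euler_deriv_hsym1 assms)
     (use assms in auto)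

lemma psum_0 [simp]: "psum n x 0 = of_nat n"
  by (simp add: psum_def)

text \<open>The radial part of the Casimir operator. The left side is the Leibniz expansion of the
  sum of the (x_i d/dx_i)^2 applied to Vandermonde times \<open>hprod\<close>; conjugation by the
  Vandermonde turns this operator into the Casimir operator plus a constant and a multiple of the
  degree.\<close>

lemma alternant_times_hprod_second_order:
  assumes R: "\<And>a. a < n \<Longrightarrow> \<beta> a \<le> int R" and x: "\<And>j. j < n \<Longrightarrow> x j \<noteq> 0" and n: "n > 0"
  shows "(\<Sum>i<n. alternant_power n 2 (staircase n) i x * hprod n (psum n x) \<beta> +
            2 * alternant_power n 1 (staircase n) i x * hprod1 n R \<beta> i x +
            alternant n (staircase n) x * hprod2 n R \<beta> i x) =
         alternant n (staircase n) x * (casimir n R (psum n x) \<beta> +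
           ((\<Sum>i<n. of_int (staircase n i) ^ 2) + (of_nat n - 1) * (\<Sum>a<n. of_int (\<beta> a))) *
             hprod n (psum n x) \<beta>)"
proof -
  define p where "p = psum n x"
  define A where "A = alternant n (staircase n) x"
  define A1 where "A1 = (\<lambda>i. alternant_power n 1 (staircase n) i x)"
  define Q where "Q = (\<lambda>a. \<Prod>b\<in>{..<n}-{a}. hsym p (\<beta> b))"
  define Q2 where "Q2 = (\<lambda>a b. \<Prod>c\<in>{..<n}-{a}-{b}. hsym p (\<beta> c))"
  define h1 where "h1 = (\<lambda>a i. hsym1 n R (\<beta> a) i x)"
  define h2 where "h2 = (\<lambda>a i. hsym2 n R (\<beta> a) i x)"
  have e1: "hprod1 n R \<beta> i x = (\<Sum>a<n. h1 a i * Q a)" for i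
    by (simp add: hprod1_def h1_def Q_def p_def)
  have e2: "hprod2 n R \<beta> i x = (\<Sum>a<n. h2 a i * Q a + h1 a i * (\<Sum>b\<in>{..<n}-{a}. h1 b i * Q2 a b))" for i
    by (simp add: hprod2_def h1_def h2_def Q_def Q2_def p_def)
  have "(\<Sum>i<n. 2 * A1 i * hprod1 n R \<beta> i x + A * hprod2 n R \<beta> i x) =
      (\<Sum>i<n. \<Sum>a<n. (2 * A1 i * h1 a i + A * h2 a i) * Q a +
         (\<Sum>b\<in>{..<n}-{a}. A * (h1 a i * h1 b i * Q2 a b)))"
    unfolding e1 e2
  proof (rule sum.cong)
    fix i
    have "2 * A1 i * (\<Sum>a<n. h1 a i * Q a) + A * (\<Sum>a<n. h2 a i * Q a + h1 a i * (\<Sum>b\<in>{..<n}-{a}. h1 b i * Q2 a b)) =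
       (\<Sum>a<n. 2 * A1 i * (h1 a i * Q a) + A * (h2 a i * Q a + h1 a i * (\<Sum>b\<in>{..<n}-{a}. h1 b i * Q2 a b)))"
      unfolding sum_distrib_left[of "2 * A1 i"] sum_distrib_left[of A] by (rule sum.distrib[symmetric])
    also have "\<dots> = (\<Sum>a<n. (2 * A1 i * h1 a i + A * h2 a i) * Q a +
         (\<Sum>b\<in>{..<n}-{a}. A * (h1 a i * h1 b i * Q2 a b)))"
      by (intro sum.cong refl) (simp add: sum_distrib_left distrib_left distrib_right mult.assoc)
    finally show "2 * A1 i * (\<Sum>a<n. h1 a i * Q a) + A * (\<Sum>a<n. h2 a i * Q a + h1 a i * (\<Sum>b\<in>{..<n}-{a}. h1 b i * Q2 a b)) =
       (\<Sum>a<n. (2 * A1 i * h1 a i + A * h2 a i) * Q a +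
         (\<Sum>b\<in>{..<n}-{a}. A * (h1 a i * h1 b i * Q2 a b)))" .
  qed simp
  also have "\<dots> = (\<Sum>a<n. \<Sum>i<n. (2 * A1 i * h1 a i + A * h2 a i) * Q a +
         (\<Sum>b\<in>{..<n}-{a}. A * (h1 a i * h1 b i * Q2 a b)))"
    by (rule sum.swap)
  also have "\<dots> = (\<Sum>a<n. (\<Sum>i<n. 2 * A1 i * h1 a i + A * h2 a i) * Q a +
         A * (\<Sum>b\<in>{..<n}-{a}. (\<Sum>i<n. h1 a i * h1 b i) * Q2 a b))"
  proof (rule sum.cong)
    fix a
    have "(\<Sum>i<n. \<Sum>b\<in>{..<n}-{a}. A * (h1 a i * h1 b i * Q2 a b)) =
        (\<Sum>b\<in>{..<n}-{a}. \<Sum>i<n. A * (h1 a i * h1 b i * Q2 a b))" by (rule sum.swap)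
    thus "(\<Sum>i<n. (2 * A1 i * h1 a i + A * h2 a i) * Q a +
         (\<Sum>b\<in>{..<n}-{a}. A * (h1 a i * h1 b i * Q2 a b))) =
       (\<Sum>i<n. 2 * A1 i * h1 a i + A * h2 a i) * Q a +
         A * (\<Sum>b\<in>{..<n}-{a}. (\<Sum>i<n. h1 a i * h1 b i) * Q2 a b)"
      by (simp only: sum.distrib[of "\<lambda>i. (2 * A1 i * h1 a i + A * h2 a i) * Q a"]
          sum_distrib_right sum_distrib_left)
  qed simp
  also have "\<dots> = (\<Sum>a<n. (of_int (\<beta> a) ^ 2 + 2 * (of_nat n - 1) * of_int (\<beta> a)) * A * hprod n p \<beta> +
         A * (\<Sum>b\<in>{..<n}-{a}. (\<Sum>i<n. h1 a i * h1 b i) * Q2 a b))"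
  proof (rule sum.cong)
    fix a assume "a \<in> {..<n}"
    hence a: "a < n" by simp
    have "(\<Sum>i<n. 2 * A1 i * h1 a i + A * h2 a i) =
        (of_int (\<beta> a) ^ 2 + 2 * (of_nat n - 1) * of_int (\<beta> a)) * A * hsym p (\<beta> a)"
      unfolding A1_def A_def h1_def h2_def p_def
      by (rule alternant_times_hsym_second_order[OF R[OF a] x n])
    moreover have "hprod n p \<beta> = hsym p (\<beta> a) * Q a"
      unfolding Q_def by (rule hprod_remove[OF a])
    ultimately show "(\<Sum>i<n. 2 * A1 i * h1 a i + A * h2 a i) * Q a +
         A * (\<Sum>b\<in>{..<n}-{a}. (\<Sum>i<n. h1 a i * h1 b i) * Q2 a b) =
        (of_int (\<beta> a) ^ 2 + 2 * (of_nat n - 1) * of_int (\<beta> a)) * A * hprod n p \<beta> +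
         A * (\<Sum>b\<in>{..<n}-{a}. (\<Sum>i<n. h1 a i * h1 b i) * Q2 a b)"
      by (simp only: mult.assoc)
  qed simp
  also have "\<dots> = A * ((\<Sum>a<n. of_int (\<beta> a) ^ 2 + 2 * (of_nat n - 1) * of_int (\<beta> a)) * hprod n p \<beta> +
     (\<Sum>a<n. \<Sum>b\<in>{..<n}-{a}. (\<Sum>i<n. h1 a i * h1 b i) * Q2 a b))"
  proof -
    have "(\<Sum>a<n. (of_int (\<beta> a) ^ 2 + 2 * (of_nat n - 1) * of_int (\<beta> a)) * A * hprod n p \<beta>) =
        A * ((\<Sum>a<n. of_int (\<beta> a) ^ 2 + 2 * (of_nat n - 1) * of_int (\<beta> a)) * hprod n p \<beta>)"
      by (simp only: sum_distrib_left sum_distrib_right) (intro sum.cong refl, simp add: mult_ac)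
    thus ?thesis
      by (simp only: sum.distrib[of "\<lambda>a. (of_int (\<beta> a) ^ 2 + 2 * (of_nat n - 1) * of_int (\<beta> a)) * A * hprod n p \<beta>"]
          distrib_left sum_distrib_left[of A "\<lambda>a. (\<Sum>b\<in>{..<n}-{a}. (\<Sum>i<n. h1 a i * h1 b i) * Q2 a b)"])
  qed
  \<comment> \<open>\<open>casimir_eq\<close> read backwards: the exchange sums are the Casimir
    operator without its scalar part.\<close>
  also have "(\<Sum>a<n. \<Sum>b\<in>{..<n}-{a}. (\<Sum>i<n. h1 a i * h1 b i) * Q2 a b) =
     casimir n R p \<beta> - (\<Sum>a<n. of_int (\<beta> a) ^ 2 + (p 0 - 1) * of_int (\<beta> a)) * hprod n p \<beta>"
    unfolding h1_def sum_hsym1_mult Q2_def p_def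
    by (subst casimir_eq[of n \<beta> R]) (use R in auto)
  finally have main: "(\<Sum>i<n. 2 * A1 i * hprod1 n R \<beta> i x + A * hprod2 n R \<beta> i x) =
     A * ((\<Sum>a<n. of_int (\<beta> a) ^ 2 + 2 * (of_nat n - 1) * of_int (\<beta> a)) * hprod n p \<beta> +
     (casimir n R p \<beta> - (\<Sum>a<n. of_int (\<beta> a) ^ 2 + (p 0 - 1) * of_int (\<beta> a)) * hprod n p \<beta>))" .
  have lin: "(\<Sum>a<n. of_int (\<beta> a) ^ 2 + c * of_int (\<beta> a)) =
      (\<Sum>a<n. of_int (\<beta> a) ^ 2) + c * (\<Sum>a<n. of_int (\<beta> a))" for c :: complex
    by (simp only: sum.distrib sum_distrib_left)
  have p0: "p 0 = of_nat n" by (simp add: p_def)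
  have A2: "(\<Sum>i<n. alternant_power n 2 (staircase n) i x) = (\<Sum>i<n. of_int (staircase n i) ^ 2) * A"
    unfolding A_def by (rule sum_alternant_power)
  have "(\<Sum>i<n. alternant_power n 2 (staircase n) i x * hprod n p \<beta> +
            2 * A1 i * hprod1 n R \<beta> i x + A * hprod2 n R \<beta> i x) =
      (\<Sum>i<n. alternant_power n 2 (staircase n) i x) * hprod n p \<beta> +
      (\<Sum>i<n. 2 * A1 i * hprod1 n R \<beta> i x + A * hprod2 n R \<beta> i x)"
    by (simp add: sum.distrib sum_distrib_right)
  also have "\<dots> = A * (casimir n R p \<beta> +
           ((\<Sum>i<n. of_int (staircase n i) ^ 2) + (of_nat n - 1) * (\<Sum>a<n. of_int (\<beta> a))) * hprod n p \<beta>)"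
    unfolding main A2 lin p0 by (simp add: algebra_simps)
  finally show ?thesis unfolding A_def A1_def p_def .
qed

text \<open>For g = lambda + delta this is the usual eigenvalue, the sum of lambda_i (lambda_i + n +
  1 - 2 i) for i from 1 to n.\<close>

definition casimir_ev :: "nat \<Rightarrow> (nat \<Rightarrow> int) \<Rightarrow> int" where
  "casimir_ev n g = (\<Sum>i<n. g i ^ 2) - (\<Sum>i<n. staircase n i ^ 2) -
     (int n - 1) * ((\<Sum>i<n. g i) - (\<Sum>i<n. staircase n i))"

lemma laurent_hprod: "laurent n (\<lambda>x. hprod n (psum n x) \<beta>)"
  unfolding hprod_def by (intro laurent_prod laurent_hsym)

lemma laurent_casimir: "laurent n (\<lambda>x. casimir n R (psum n x) \<beta>)"
  unfolding casimir_def
  by (intro laurent_sum laurent_add laurent_mult laurent_hprod laurent_psum)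

lemma jdet_eq_sum_hprod:
  "jdet n p g = (\<Sum>\<sigma> | \<sigma> permutes {..<n}. of_int (sign \<sigma>) * hprod n p (\<lambda>i. g i - staircase n (\<sigma> i)))"
  by (simp add: jdet_eq_sum hprod_def)

lemma sum_staircase_permute:
  "\<sigma> permutes {..<n} \<Longrightarrow> (\<Sum>i<n. f (staircase n (\<sigma> i))) = (\<Sum>i<n. f (staircase n i) :: 'a :: comm_monoid_add)"
  using sum.reindex_bij_betw[OF permutes_imp_bij, of \<sigma> "{..<n}" "\<lambda>i. f (staircase n i)"] by simp

text \<open>Single products are mixed by the exchange terms, but their alternating sum times the
  Vandermonde is an alternant, an eigenfunction of the sum of the (x_i d/dx_i)^2. Applying the
  radial formula to each term and cancelling the Vandermonde leaves the eigenvalue.\<close>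

lemma casimir_jdet:
  assumes g: "\<And>i. i < n \<Longrightarrow> 0 \<le> g i" "\<And>i. i < n \<Longrightarrow> g i \<le> int R" and n: "n > 0" and x: "x \<in> torus n"
  shows "(\<Sum>\<sigma> | \<sigma> permutes {..<n}. of_int (sign \<sigma>) * casimir n R (psum n x) (\<lambda>i. g i - staircase n (\<sigma> i))) =
         of_int (casimir_ev n g) * jdet n (psum n x) g"
proof (rule laurent_cancel_alternant[OF _ _ _ x])
  show "laurent n (\<lambda>x. \<Sum>\<sigma> | \<sigma> permutes {..<n}. of_int (sign \<sigma>) * casimir n R (psum n x) (\<lambda>i. g i - staircase n (\<sigma> i)))"
    by (intro laurent_sum laurent_mult laurent_const laurent_casimir)
  show "laurent n (\<lambda>x. of_int (casimir_ev n g) * jdet n (psum n x) g)"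
    by (intro laurent_mult laurent_const laurent_jdet)
  fix x assume "x \<in> torus n"
  hence x: "\<And>j. j < n \<Longrightarrow> x j \<noteq> 0" by (auto dest: torus_nonzero)
  define b where "b = (\<lambda>\<sigma> i. g i - staircase n (\<sigma> i))"
  let ?S = "{\<sigma>. \<sigma> permutes {..<n}}"
  let ?A0 = "alternant_power n 0 (staircase n)" and ?A1 = "alternant_power n 1 (staircase n)"
    and ?A2 = "alternant_power n 2 (staircase n)"
  let ?P = "\<lambda>\<sigma> x. hprod n (psum n x) (b \<sigma>)"
  have b: "b \<sigma> a \<le> int R" if "\<sigma> \<in> ?S" "a < n" for \<sigma> a
    using g(2)[OF that(2)] permutes_in_image[of \<sigma> "{..<n}" a] that by (simp add: b_def staircase_def)
  have jt: "alternant n g x = jdet n (psum n x) g * alternant n (staircase n) x" for x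
    by (rule jacobi_trudi) (use g in auto)
  have prod_eq: "alternant n g x = (\<Sum>\<sigma>\<in>?S. of_int (sign \<sigma>) * (?A0 i x * ?P \<sigma> x))" for x i
    unfolding jt jdet_eq_sum_hprod b_def alternant_power_0
    by (simp add: sum_distrib_left sum_distrib_right mult_ac)
  have d1: "euler_deriv n i (\<lambda>x. ?A0 i x * ?P \<sigma> x) (\<lambda>x. ?A1 i x * ?P \<sigma> x + ?A0 i x * hprod1 n R (b \<sigma>) i x)"
    if "i < n" "\<sigma> \<in> ?S" for i \<sigma>
    using euler_deriv_alternant_power[OF that(1), of 0 "staircase n"]
    by (intro euler_deriv_mult euler_deriv_hprod that b) simp
  have d2: "euler_deriv n i (\<lambda>x. ?A1 i x * ?P \<sigma> x + ?A0 i x * hprod1 n R (b \<sigma>) i x)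
      (\<lambda>x. (?A2 i x * ?P \<sigma> x + ?A1 i x * hprod1 n R (b \<sigma>) i x) +
           (?A1 i x * hprod1 n R (b \<sigma>) i x + ?A0 i x * hprod2 n R (b \<sigma>) i x))"
    if "i < n" "\<sigma> \<in> ?S" for i \<sigma>
    using euler_deriv_alternant_power[OF that(1), of 0 "staircase n"]
      euler_deriv_alternant_power[OF that(1), of 1 "staircase n"]
    by (intro euler_deriv_add euler_deriv_mult euler_deriv_hprod euler_deriv_hprod1 that b)
       (simp_all add: numeral_2_eq_2)
  have eq1: "alternant_power n 1 g i x =
      (\<Sum>\<sigma>\<in>?S. of_int (sign \<sigma>) * (?A1 i x * ?P \<sigma> x + ?A0 i x * hprod1 n R (b \<sigma>) i x))"
    if i: "i < n" and x: "\<And>j. j < n \<Longrightarrow> x j \<noteq> 0" for i x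
  proof (rule euler_deriv_unique[OF _ _ _ x])
    show "euler_deriv n i (alternant_power n 0 g i) (alternant_power n 1 g i)"
      using euler_deriv_alternant_power[OF i, of 0 g] by simp
    show "euler_deriv n i (\<lambda>x. \<Sum>\<sigma>\<in>?S. of_int (sign \<sigma>) * (?A0 i x * ?P \<sigma> x))
        (\<lambda>x. \<Sum>\<sigma>\<in>?S. of_int (sign \<sigma>) * (?A1 i x * ?P \<sigma> x + ?A0 i x * hprod1 n R (b \<sigma>) i x))"
      by (intro euler_deriv_sum euler_deriv_cmult d1 i) auto
  qed (simp add: alternant_power_0[of n g] prod_eq[of _ i])
  have eq2: "alternant_power n 2 g i x =
      (\<Sum>\<sigma>\<in>?S. of_int (sign \<sigma>) * ((?A2 i x * ?P \<sigma> x + ?A1 i x * hprod1 n R (b \<sigma>) i x) +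
           (?A1 i x * hprod1 n R (b \<sigma>) i x + ?A0 i x * hprod2 n R (b \<sigma>) i x)))" if i: "i < n" for i
  proof (rule euler_deriv_unique[OF _ _ _ x])
    show "euler_deriv n i (alternant_power n 1 g i) (alternant_power n 2 g i)"
      using euler_deriv_alternant_power[OF i, of 1 g] by (simp add: numeral_2_eq_2)
    show "euler_deriv n i (\<lambda>x. \<Sum>\<sigma>\<in>?S. of_int (sign \<sigma>) * (?A1 i x * ?P \<sigma> x + ?A0 i x * hprod1 n R (b \<sigma>) i x))
      (\<lambda>x. \<Sum>\<sigma>\<in>?S. of_int (sign \<sigma>) * ((?A2 i x * ?P \<sigma> x + ?A1 i x * hprod1 n R (b \<sigma>) i x) +
           (?A1 i x * hprod1 n R (b \<sigma>) i x + ?A0 i x * hprod2 n R (b \<sigma>) i x)))"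
      by (intro euler_deriv_sum euler_deriv_cmult d2 i) auto
  qed (rule eq1[OF i])
  let ?A = "alternant n (staircase n) x" and ?p = "psum n x"
  \<comment> \<open>The degree of each product is the sum of g minus the sum of the staircase,
    independently of the permutation, so one constant D serves all terms.\<close>
  define D :: complex where "D = (\<Sum>i<n. of_int (staircase n i) ^ 2) +
     (of_nat n - 1) * ((\<Sum>i<n. of_int (g i)) - (\<Sum>i<n. of_int (staircase n i)))"
  have "(\<Sum>i<n. of_int (g i) ^ 2) * alternant n g x = (\<Sum>i<n. alternant_power n 2 g i x)"
    by (rule sum_alternant_power[symmetric])
  also have "\<dots> = (\<Sum>i<n. \<Sum>\<sigma>\<in>?S. of_int (sign \<sigma>) * (?A2 i x * hprod n ?p (b \<sigma>) +
            2 * ?A1 i x * hprod1 n R (b \<sigma>) i x + ?A * hprod2 n R (b \<sigma>) i x))"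
  proof (rule sum.cong)
    fix i assume "i \<in> {..<n}"
    hence i: "i < n" by simp
    show "alternant_power n 2 g i x = (\<Sum>\<sigma>\<in>?S. of_int (sign \<sigma>) * (?A2 i x * hprod n ?p (b \<sigma>) +
            2 * ?A1 i x * hprod1 n R (b \<sigma>) i x + ?A * hprod2 n R (b \<sigma>) i x))"
      unfolding eq2[OF i] alternant_power_0 by (intro sum.cong refl arg_cong2[where f = "(*)"]) simp
  qed simp
  also have "\<dots> = (\<Sum>\<sigma>\<in>?S. \<Sum>i<n. of_int (sign \<sigma>) * (?A2 i x * hprod n ?p (b \<sigma>) +
            2 * ?A1 i x * hprod1 n R (b \<sigma>) i x + ?A * hprod2 n R (b \<sigma>) i x))"
    by (rule sum.swap)
  also have "\<dots> = (\<Sum>\<sigma>\<in>?S. of_int (sign \<sigma>) * (\<Sum>i<n. ?A2 i x * hprod n ?p (b \<sigma>) +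
            2 * ?A1 i x * hprod1 n R (b \<sigma>) i x + ?A * hprod2 n R (b \<sigma>) i x))"
    by (simp only: sum_distrib_left)
  also have "\<dots> = (\<Sum>\<sigma>\<in>?S. of_int (sign \<sigma>) * (?A * (casimir n R ?p (b \<sigma>) + D * hprod n ?p (b \<sigma>))))"
  proof (rule sum.cong)
    fix \<sigma> assume s: "\<sigma> \<in> ?S"
    have second: "(\<Sum>i<n. ?A2 i x * hprod n ?p (b \<sigma>) +
            2 * ?A1 i x * hprod1 n R (b \<sigma>) i x + ?A * hprod2 n R (b \<sigma>) i x) =
        ?A * (casimir n R ?p (b \<sigma>) + ((\<Sum>i<n. of_int (staircase n i) ^ 2) +
           (of_nat n - 1) * (\<Sum>a<n. of_int (b \<sigma> a))) * hprod n ?p (b \<sigma>))"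
      by (rule alternant_times_hprod_second_order) (use b[OF s] x n in auto)
    have "(\<Sum>a<n. of_int (b \<sigma> a) :: complex) = (\<Sum>i<n. of_int (g i)) - (\<Sum>i<n. of_int (staircase n i))"
      using sum_staircase_permute[of \<sigma> n "of_int :: int \<Rightarrow> complex"] s
      by (simp add: b_def sum_subtractf)
    thus "of_int (sign \<sigma>) * (\<Sum>i<n. ?A2 i x * hprod n ?p (b \<sigma>) +
            2 * ?A1 i x * hprod1 n R (b \<sigma>) i x + ?A * hprod2 n R (b \<sigma>) i x) =
       of_int (sign \<sigma>) * (?A * (casimir n R ?p (b \<sigma>) + D * hprod n ?p (b \<sigma>)))"
      by (simp only: second D_def)
  qed simp
  also have "\<dots> = ?A * (\<Sum>\<sigma>\<in>?S. of_int (sign \<sigma>) * casimir n R ?p (b \<sigma>)) + D * (?A * jdet n ?p g)"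
  proof -
    have "of_int (sign \<sigma>) * (?A * (casimir n R ?p (b \<sigma>) + D * hprod n ?p (b \<sigma>))) =
       ?A * (of_int (sign \<sigma>) * casimir n R ?p (b \<sigma>)) + D * (?A * (of_int (sign \<sigma>) * hprod n ?p (b \<sigma>)))" for \<sigma>
      by (simp add: algebra_simps)
    thus ?thesis unfolding jdet_eq_sum_hprod b_def by (simp only: sum.distrib sum_distrib_left)
  qed
  finally have "?A * (\<Sum>\<sigma>\<in>?S. of_int (sign \<sigma>) * casimir n R ?p (b \<sigma>)) =
      ((\<Sum>i<n. of_int (g i) ^ 2) - D) * (jdet n ?p g * ?A)"
    unfolding jt by (simp add: algebra_simps)
  also have "(\<Sum>i<n. of_int (g i) ^ 2) - D = of_int (casimir_ev n g)"
    by (simp add: casimir_ev_def D_def)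
  finally show "(\<Sum>\<sigma>\<in>?S. of_int (sign \<sigma>) * casimir n R ?p (\<lambda>i. g i - staircase n (\<sigma> i))) * ?A =
      of_int (casimir_ev n g) * jdet n ?p g * ?A"
    by (simp add: b_def mult_ac)
qed

text \<open>Put l = g - delta - K. Given the degree condition, the difference of the two sides is
  |l|^2 + 2 l.delta. The sequence l decreases weakly and sums to 0, so the second term is
  nonnegative, while the first is positive unless l = 0.\<close>

lemma casimir_ev_pos:
  assumes dec: "\<And>i j. i < j \<Longrightarrow> j < n \<Longrightarrow> g j < g i"
    and sum: "(\<Sum>i<n. g i) = (\<Sum>i<n. staircase n i) + int n * K"
    and ne: "\<exists>i<n. g i \<noteq> staircase n i + K"
  shows "casimir_ev n g \<noteq> K * ((\<Sum>i<n. g i) - (\<Sum>i<n. staircase n i))"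
proof -
  define l where "l = (\<lambda>i. g i - staircase n i - K)"
  have l0: "(\<Sum>i<n. l i) = 0" using sum by (simp add: l_def sum_subtractf)
  have mono: "l j \<le> l i" if "i \<le> j" "j < n" for i j
    using that
  proof (induction j rule: dec_induct)
    case (step j)
    have "l (Suc j) \<le> l j" using dec[of j "Suc j"] step by (simp add: l_def staircase_def)
    with step show ?case by simp
  qed simp
  \<comment> \<open>Chebyshev's sum inequality for two decreasing sequences, one of sum 0. It is
    applied to -l, which is increasing, against the decreasing staircase.\<close>
  have cheb: "(\<Sum>i<n. l i * staircase n i) \<ge> 0"
  proof -
    have "(\<Sum>k=0..<n. l k) * (\<Sum>k=0..<n. staircase n k) \<le> int n * (\<Sum>k=0..<n. l k * staircase n k)"
      using Chebyshev_sum_upper[of n "\<lambda>k. - l k" "staircase n"] mono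
      by (auto simp: staircase_def sum_negf)
    thus ?thesis using l0 by (cases "n = 0") (auto simp: atLeast0LessThan zero_le_mult_iff)
  qed
  obtain i where i: "i < n" "l i \<noteq> 0" using ne by (auto simp: l_def)
  have pos: "(\<Sum>i<n. l i ^ 2) > 0"
    by (rule sum_pos2[of _ i]) (use i in auto)
  have "(\<Sum>i<n. g i ^ 2) = (\<Sum>i<n. l i ^ 2 + 2 * (l i * staircase n i) + staircase n i ^ 2 +
      2 * K * g i - K ^ 2)"
    by (intro sum.cong) (auto simp: l_def power2_eq_square algebra_simps)
  hence "(\<Sum>i<n. g i ^ 2) = (\<Sum>i<n. l i ^ 2) + 2 * (\<Sum>i<n. l i * staircase n i) + (\<Sum>i<n. staircase n i ^ 2) +
      2 * K * (\<Sum>i<n. g i) - int n * K ^ 2"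
    by (simp add: sum.distrib sum_subtractf sum_distrib_left)
  moreover have "2 * (\<Sum>i<n. staircase n i) = int n * (int n - 1)"
    by (induction n) (auto simp: staircase_def algebra_simps sum_subtractf)
  hence "2 * K * (\<Sum>i<n. staircase n i) = K * (int n * (int n - 1))"
    by (metis mult.assoc mult.left_commute)
  ultimately have "casimir_ev n g - K * ((\<Sum>i<n. g i) - (\<Sum>i<n. staircase n i)) =
      (\<Sum>i<n. l i ^ 2) + 2 * (\<Sum>i<n. l i * staircase n i)"
    unfolding casimir_ev_def sum by (simp add: algebra_simps power2_eq_square)
  thus ?thesis using pos cheb by auto
qed

section \<open>Power traces, eigenvalues and the unitary group\<close>

no_notation Matrix.vec_index (infixl \<open>$\<close> 100)

text \<open>The Schur function of the rectangle with n rows of length K is the K-th power of the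
  product of the variables: shift the Vandermonde alternant and cancel it.\<close>

lemma jdet_staircase_shift:
  assumes "x \<in> torus n"
  shows "jdet n (psum n x) (\<lambda>i. staircase n i + int K) = (\<Prod>i<n. x i) ^ K"
proof (rule laurent_cancel_alternant[OF _ _ _ assms])
  show "laurent n (\<lambda>x. jdet n (psum n x) (\<lambda>i. staircase n i + int K))"
    by (rule laurent_jdet)
  show "laurent n (\<lambda>x. (\<Prod>i<n. x i) ^ K)"
    by (intro laurent_power laurent_prod laurent_var) auto
  fix x assume x: "x \<in> torus n"
  have "alternant n (\<lambda>i. staircase n i + int K) x =
      jdet n (psum n x) (\<lambda>i. staircase n i + int K) * alternant n (staircase n) x"
    by (rule jacobi_trudi) (auto simp: staircase_def)
  moreover have "alternant n (\<lambda>i. staircase n i + int K) x =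
      (\<Prod>i<n. x i powi int K) * alternant n (staircase n) x"
    using torus_nonzero[OF x] by (rule alternant_shift)
  ultimately show "jdet n (psum n x) (\<lambda>i. staircase n i + int K) * alternant n (staircase n) x =
      (\<Prod>i<n. x i) ^ K * alternant n (staircase n) x"
    by (simp only: prod_power_distrib power_int_of_nat)
qed

definition ptr :: "complex^'n^'n \<Rightarrow> nat \<Rightarrow> complex" where
  "ptr M r = Determinants.trace (matrix_power M r)"

lemma matrix_power_0 [simp]: "matrix_power M 0 = Finite_Cartesian_Product.mat 1"
  and matrix_power_Suc: "matrix_power M (Suc k) = M ** matrix_power M k"
  by (simp_all add: matrix_power_def)

lemma matrix_power_add: "matrix_power M (a + b) = matrix_power M a ** matrix_power M b"
  by (induction a) (simp_all add: matrix_power_Suc matrix_mul_assoc)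

lemma matrix_power_1 [simp]: "matrix_power M (Suc 0) = M"
  by (simp add: matrix_power_Suc)

lemma ptr_0 [simp]: "ptr (M :: complex^'n^'n) 0 = of_nat (CARD('n))"
  by (simp add: ptr_def trace_def Finite_Cartesian_Product.mat_def)

section \<open>Passage to matrices indexed by numbers, and spectra\<close>

definition enum_index :: "nat \<Rightarrow> 'n :: finite" where
  "enum_index = (SOME e. bij_betw e {..<CARD('n)} UNIV)"

lemma bij_enum_index: "bij_betw (enum_index :: nat \<Rightarrow> 'n :: finite) {..<CARD('n)} UNIV"
proof -
  have "\<exists>e. bij_betw e {..<CARD('n)} (UNIV :: 'n set)"
    using ex_bij_betw_nat_finite[of "UNIV :: 'n set"] by (simp add: atLeast0LessThan)
  thus ?thesis unfolding enum_index_def by (rule someI_ex)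
qed

lemma sum_enum_index: "(\<Sum>i<CARD('n). f (enum_index i :: 'n :: finite)) = (\<Sum>i\<in>UNIV. f i)"
  by (rule sum.reindex_bij_betw[OF bij_enum_index])

lemma enum_index_eq_iff:
  "i < CARD('n) \<Longrightarrow> j < CARD('n) \<Longrightarrow> (enum_index i :: 'n :: finite) = enum_index j \<longleftrightarrow> i = j"
  using bij_enum_index[where 'n = 'n] by (auto simp: bij_betw_def inj_on_def)

text \<open>A copy of the matrix with numerical indices, to which triangularization applies. The
  enumeration is arbitrary: products, the identity and the trace are carried over for any
  choice.\<close>

definition jmat :: "complex^'n^'n \<Rightarrow> complex Matrix.mat" where
  "jmat M = Matrix.mat CARD('n) CARD('n) (\<lambda>(i, j). M $ enum_index i $ enum_index j)"

definition jtrace :: "complex Matrix.mat \<Rightarrow> complex" where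
  "jtrace A = (\<Sum>i<dim_row A. A $$ (i, i))"

lemma jmat_carrier [simp]: "jmat (M :: complex^'n^'n) \<in> carrier_mat CARD('n) CARD('n)"
  and jmat_dim [simp]: "dim_row (jmat (M :: complex^'n^'n)) = CARD('n)" "dim_col (jmat (M :: complex^'n^'n)) = CARD('n)"
  by (simp_all add: jmat_def)

lemma jmat_mult: "jmat (A ** B) = jmat A * jmat (B :: complex^'n^'n)"
  by (rule eq_matI)
     (auto simp: jmat_def matrix_matrix_mult_def scalar_prod_def atLeast0LessThan
        sum_enum_index[where f = "\<lambda>k. A $ _ $ k * B $ k $ _"])

lemma jmat_one: "jmat (Finite_Cartesian_Product.mat 1 :: complex^'n^'n) = 1\<^sub>m CARD('n)"
  by (rule eq_matI) (auto simp: jmat_def Finite_Cartesian_Product.mat_def enum_index_eq_iff)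

lemma matrix_power_Suc_right: "matrix_power M (Suc k) = matrix_power M k ** M"
  using matrix_power_add[of M k 1] by simp

lemma jmat_power: "jmat (matrix_power M k) = jmat (M :: complex^'n^'n) ^\<^sub>m k"
  by (induction k) (simp_all add: jmat_one matrix_power_Suc_right jmat_mult)

lemma jtrace_jmat: "jtrace (jmat M) = Determinants.trace (M :: complex^'n^'n)"
  by (simp add: jtrace_def jmat_def trace_def sum_enum_index[where f = "\<lambda>k. M $ k $ k"])

lemma jtrace_mult_commute:
  assumes "A \<in> carrier_mat n n" "B \<in> carrier_mat n n"
  shows "jtrace (A * B) = jtrace (B * A)"
proof -
  have *: "jtrace (A * B) = (\<Sum>i<n. \<Sum>j<n. A $$ (i, j) * B $$ (j, i))"
    if "A \<in> carrier_mat n n" "B \<in> carrier_mat n n" for A B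
    using that by (auto simp: jtrace_def scalar_prod_def atLeast0LessThan intro!: sum.cong)
  show ?thesis unfolding *[OF assms] *[OF assms(2,1)]
    by (subst sum.swap) (simp add: mult.commute)
qed

lemma jtrace_similar:
  assumes "similar_mat_wit A B P Q"
  shows "jtrace A = jtrace B"
proof -
  define n where "n = dim_row A"
  note w = similar_mat_witD[OF n_def assms]
  have "jtrace A = jtrace (P * B * Q)" using w(3) by simp
  also have "\<dots> = jtrace (Q * (P * B))"
    using w by (intro jtrace_mult_commute[of _ n]) auto
  also have "Q * (P * B) = Q * P * B" using w by (intro assoc_mult_mat[symmetric]) auto
  also have "\<dots> = B" using w by simp
  finally show ?thesis .
qed

lemma upper_triangular_mult:
  assumes "A \<in> carrier_mat n n" "B \<in> carrier_mat n n" "upper_triangular A" "upper_triangular (B :: complex Matrix.mat)"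
  shows "upper_triangular (A * B)" "i < n \<Longrightarrow> (A * B) $$ (i, i) = A $$ (i, i) * B $$ (i, i)"
proof -
  have *: "(A * B) $$ (i, j) = (\<Sum>k<n. A $$ (i, k) * B $$ (k, j))" if "i < n" "j < n" for i j
    using assms(1,2) that by (auto simp: scalar_prod_def atLeast0LessThan)
  have zero: "A $$ (i, k) * B $$ (k, j) = 0" if "i < n" "k < n" "j < n" "k < i \<or> j < k" for i j k
    using upper_triangularD[OF assms(3), of k i] upper_triangularD[OF assms(4), of j k] assms(1,2) that by auto
  show "upper_triangular (A * B)"
  proof
    fix i j assume "j < i" "i < dim_row (A * B)"
    hence ij: "j < i" "i < n" using assms by auto
    hence "(A * B) $$ (i, j) = (\<Sum>k<n. A $$ (i, k) * B $$ (k, j))" by (intro *) auto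
    also have "\<dots> = 0" using ij by (intro sum.neutral ballI zero) auto
    finally show "(A * B) $$ (i, j) = 0" .
  qed
  assume i: "i < n"
  have "(\<Sum>k<n. A $$ (i, k) * B $$ (k, i)) = (\<Sum>k\<in>{i}. A $$ (i, k) * B $$ (k, i))"
    using i by (intro sum.mono_neutral_right ballI zero) auto
  thus "(A * B) $$ (i, i) = A $$ (i, i) * B $$ (i, i)" using *[OF i i] by simp
qed

lemma upper_triangular_power:
  assumes B: "B \<in> carrier_mat n n" "upper_triangular (B :: complex Matrix.mat)"
  shows "upper_triangular (B ^\<^sub>m k) \<and> (\<forall>i<n. (B ^\<^sub>m k) $$ (i, i) = B $$ (i, i) ^ k)"
proof (induction k)
  case (Suc k)
  have "B ^\<^sub>m k \<in> carrier_mat n n" using B by simp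
  with upper_triangular_mult[of "B ^\<^sub>m k" n B] Suc B show ?case by simp
qed (use B in auto)

text \<open>The eigenvalues with multiplicity are the diagonal of a triangular matrix similar to the
  given one. Taking powers raises the diagonal entries to powers, and similarity preserves traces
  and the determinant.\<close>

lemma spectrum_exists:
  fixes M :: "complex^'n^'n"
  obtains x where "\<And>r. ptr M r = psum CARD('n) x r" "Determinant.det (jmat M) = (\<Prod>i<CARD('n). x i)"
    "\<And>i. i < CARD('n) \<Longrightarrow> eigenvalue (jmat M) (x i)"
proof -
  let ?n = "CARD('n)" and ?A = "jmat M"
  have A: "?A \<in> carrier_mat ?n ?n" by simp
  obtain es where es: "char_poly ?A = (\<Prod>e\<leftarrow>es. [:- e, 1:])" "length es = ?n"
    using char_poly_factorized[OF A] by blast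
  obtain B P Q where BPQ: "schur_decomposition ?A es = (B, P, Q)" by (cases "schur_decomposition ?A es") auto
  from schur_decomposition[OF A es(1) BPQ]
  have sim: "similar_mat_wit ?A B P Q" and B: "upper_triangular B" and diag: "diag_mat B = es" by auto
  have Bc: "B \<in> carrier_mat ?n ?n" using sim by (auto simp: similar_mat_wit_def Let_def)
  show ?thesis
  proof (rule that[of "\<lambda>i. B $$ (i, i)"])
    fix r
    have "ptr M r = jtrace (?A ^\<^sub>m r)" by (simp add: ptr_def jmat_power[symmetric] jtrace_jmat)
    also have "\<dots> = jtrace (B ^\<^sub>m r)" by (rule jtrace_similar[OF similar_mat_wit_pow[OF sim]])
    also have "\<dots> = psum ?n (\<lambda>i. B $$ (i, i)) r"
      using upper_triangular_power[OF Bc B, of r] Bc by (simp add: jtrace_def psum_def)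
    finally show "ptr M r = psum ?n (\<lambda>i. B $$ (i, i)) r" .
  next
    have "Determinant.det ?A = Determinant.det B"
      using sim by (intro det_similar, unfold similar_mat_def) blast
    also have "\<dots> = prod_list (diag_mat B)" by (rule det_upper_triangular[OF B Bc])
    also have "\<dots> = (\<Prod>i<?n. B $$ (i, i))"
      using Bc by (simp add: diag_mat_def prod.list_conv_set_nth atLeast0LessThan)
    finally show "Determinant.det ?A = (\<Prod>i<?n. B $$ (i, i))" .
  next
    fix i assume "i < ?n"
    hence "B $$ (i, i) \<in> set es" using Bc by (auto simp: diag[symmetric] diag_mat_def)
    hence "poly (char_poly ?A) (B $$ (i, i)) = 0"
      unfolding es(1) by (auto simp: poly_prod_list prod_list_zero_iff)
    thus "eigenvalue ?A (B $$ (i, i))" using eigenvalue_root_char_poly[OF A] by simp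
  qed
qed

section \<open>The unitary group and its spectra\<close>

definition madj :: "complex^'n^'n \<Rightarrow> complex^'n^'n" where
  "madj M = Finite_Cartesian_Product.transpose (matrix_cnj M)"

lemma madj_nth [simp]: "madj M $ i $ j = cnj (M $ j $ i)"
  by (simp add: madj_def Finite_Cartesian_Product.transpose_def matrix_cnj_def map_matrix_def)

lemma unitary_group_iff:
  "M \<in> unitary_group \<longleftrightarrow> madj M ** M = Finite_Cartesian_Product.mat 1 \<and> M ** madj M = Finite_Cartesian_Product.mat 1"
  by (simp add: unitary_group_def madj_def)

lemma madj_mult: "madj (A ** B) = madj B ** madj A"
  by (simp add: Finite_Cartesian_Product.vec_eq_iff matrix_matrix_mult_def mult.commute)

lemma unitary_group_mult:
  assumes "A \<in> unitary_group" "B \<in> unitary_group"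
  shows "A ** B \<in> unitary_group"
proof -
  have "madj (A ** B) ** (A ** B) = madj B ** (madj A ** A) ** B"
    by (simp add: madj_mult matrix_mul_assoc)
  moreover have "(A ** B) ** madj (A ** B) = A ** (B ** madj B) ** madj A"
    by (simp add: madj_mult matrix_mul_assoc)
  ultimately show ?thesis using assms by (simp add: unitary_group_iff)
qed

lemma unitary_columns:
  assumes "M \<in> unitary_group"
  shows "(\<Sum>i\<in>UNIV. cnj (M $ i $ j) * M $ i $ k) = (if j = k then 1 else 0)"
proof -
  have "(madj M ** M) $ j $ k = (if j = k then 1 else 0)"
    using assms by (simp add: unitary_group_iff Finite_Cartesian_Product.mat_def)
  thus ?thesis by (simp add: matrix_matrix_mult_def)
qed

lemma sum_rotate:
  "(\<Sum>i\<in>A. \<Sum>j\<in>B. \<Sum>k\<in>C. f i j k) = (\<Sum>j\<in>B. \<Sum>k\<in>C. \<Sum>i\<in>A. f i j k :: 'a :: comm_monoid_add)"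
proof -
  have "(\<Sum>i\<in>A. \<Sum>j\<in>B. \<Sum>k\<in>C. f i j k) = (\<Sum>j\<in>B. \<Sum>i\<in>A. \<Sum>k\<in>C. f i j k)"
    by (rule sum.swap)
  also have "\<dots> = (\<Sum>j\<in>B. \<Sum>k\<in>C. \<Sum>i\<in>A. f i j k)"
    by (intro sum.cong refl sum.swap)
  finally show ?thesis .
qed

text \<open>With S the squared norm of an eigenvector u, orthonormality of the columns makes the
  squared norm of M u equal to S, while the eigenvalue equation makes it |z|^2 S.\<close>

lemma eigenvalue_unitary:
  fixes M :: "complex^'n^'n"
  assumes M: "M \<in> unitary_group" and ev: "eigenvalue (jmat M) z"
  shows "cmod z = 1"
proof -
  let ?n = "CARD('n)"
  from ev obtain v where v: "v \<in> carrier_vec ?n" "v \<noteq> 0\<^sub>v ?n" "jmat M *\<^sub>v v = z \<cdot>\<^sub>v v"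
    unfolding eigenvalue_def eigenvector_def by auto
  define u where "u = (\<lambda>i. vec_index v i)"
  define m where "m = (\<lambda>i j. M $ enum_index i $ enum_index j)"
  have Mu: "(\<Sum>j<?n. m i j * u j) = z * u i" if "i < ?n" for i
  proof -
    have "(\<Sum>j<?n. m i j * u j) = vec_index (jmat M *\<^sub>v v) i"
      using that v(1) by (simp add: jmat_def scalar_prod_def atLeast0LessThan m_def u_def)
    also have "\<dots> = z * u i" unfolding v(3) using that v(1) by (simp add: u_def)
    finally show ?thesis .
  qed
  have orth: "(\<Sum>i<?n. cnj (m i j) * m i k) = (if j = k then 1 else 0)" if "j < ?n" "k < ?n" for j k
    using unitary_columns[OF M, of "enum_index j" "enum_index k"] that
    by (simp add: m_def enum_index_eq_iff
       sum_enum_index[where f = "\<lambda>i. cnj (M $ i $ enum_index j) * M $ i $ enum_index k"])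
  define S where "S = (\<Sum>i<?n. cnj (u i) * u i)"
  have "cnj z * z * S = (\<Sum>i<?n. cnj (z * u i) * (z * u i))"
    by (simp add: S_def sum_distrib_left mult_ac)
  also have "\<dots> = (\<Sum>i<?n. cnj (\<Sum>j<?n. m i j * u j) * (\<Sum>k<?n. m i k * u k))"
    by (intro sum.cong refl) (simp only: Mu lessThan_iff)
  also have "\<dots> = (\<Sum>i<?n. \<Sum>j<?n. \<Sum>k<?n. cnj (u j) * u k * (cnj (m i j) * m i k))"
    unfolding cnj_sum sum_product by (simp add: mult_ac)
  also have "\<dots> = (\<Sum>j<?n. \<Sum>k<?n. \<Sum>i<?n. cnj (u j) * u k * (cnj (m i j) * m i k))"
    by (rule sum_rotate)
  also have "\<dots> = (\<Sum>j<?n. \<Sum>k<?n. cnj (u j) * u k * (if j = k then 1 else 0))"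
    by (intro sum.cong refl) (simp add: sum_distrib_left[symmetric] orth)
  also have "\<dots> = S" by (simp add: S_def if_distrib[of "\<lambda>t. _ * t"] cong: if_cong)
  finally have eq: "cnj z * z * S = S" .
  have "S = of_real (\<Sum>i<?n. (cmod (u i))\<^sup>2)"
    unfolding S_def of_real_sum by (intro sum.cong refl) (metis complex_norm_square mult.commute)
  moreover have "\<exists>i<?n. u i \<noteq> 0"
  proof (rule ccontr)
    assume "\<not> ?thesis"
    hence "v = 0\<^sub>v ?n" using v(1) by (intro eq_vecI) (auto simp: u_def)
    with v(2) show False by simp
  qed
  then obtain i where "i < ?n" "u i \<noteq> 0" by blast
  hence "(\<Sum>i<?n. (cmod (u i))\<^sup>2) > 0"
    by (intro sum_pos2[of _ i]) auto
  ultimately have "S \<noteq> 0" by (metis less_irrefl of_real_eq_0_iff)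
  with eq have "z * cnj z = 1" by (simp add: mult.commute)
  hence "complex_of_real ((cmod z)\<^sup>2) = of_real 1"
    unfolding complex_norm_square by simp
  hence "(cmod z)\<^sup>2 = 1" by (simp only: of_real_eq_iff)
  thus ?thesis using norm_ge_zero[of z] by (auto simp: power2_eq_1_iff)
qed

lemma unitary_spectrum:
  fixes M :: "complex^'n^'n"
  assumes "M \<in> unitary_group"
  obtains x where "x \<in> torus CARD('n)" "ptr M = psum CARD('n) x" "Determinant.det (jmat M) = (\<Prod>i<CARD('n). x i)"
proof -
  obtain x where x: "\<And>r. ptr M r = psum CARD('n) x r" "Determinant.det (jmat M) = (\<Prod>i<CARD('n). x i)"
    "\<And>i. i < CARD('n) \<Longrightarrow> eigenvalue (jmat M) (x i)"
    by (rule spectrum_exists[of M]) blast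
  show ?thesis
    by (rule that[of x]) (use x eigenvalue_unitary[OF assms] in \<open>auto simp: torus_def\<close>)
qed

lemma continuous_on_entry: "continuous_on A (\<lambda>M :: complex^'n^'n. M $ i $ j)"
  by (intro continuous_intros)

text \<open>The group is cut out by polynomial equations in the entries and their conjugates, and
  unit columns bound every entry by 1. Compactness makes all continuous integrands bounded, hence
  integrable.\<close>

lemma compact_unitary_group: "compact (unitary_group :: (complex^'n^'n) set)"
proof -
  have c1: "closed {M :: complex^'n^'n. madj M ** M = Finite_Cartesian_Product.mat 1}"
    unfolding Finite_Cartesian_Product.vec_eq_iff matrix_matrix_mult_def
    by (simp, intro closed_Collect_all closed_Collect_eq continuous_intros)
  have c2: "closed {M :: complex^'n^'n. M ** madj M = Finite_Cartesian_Product.mat 1}"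
    unfolding Finite_Cartesian_Product.vec_eq_iff matrix_matrix_mult_def
    by (simp, intro closed_Collect_all closed_Collect_eq continuous_intros)
  have U: "(unitary_group :: (complex^'n^'n) set) = 
      {M. madj M ** M = Finite_Cartesian_Product.mat 1} \<inter> {M. M ** madj M = Finite_Cartesian_Product.mat 1}"
    by (auto simp: unitary_group_iff)
  have closed: "closed (unitary_group :: (complex^'n^'n) set)"
    unfolding U by (rule closed_Int[OF c1 c2])
  have entry: "norm (M $ i $ j) \<le> 1" if "M \<in> unitary_group" for M :: "complex^'n^'n" and i j
  proof -
    have "complex_of_real (\<Sum>i\<in>UNIV. (norm (M $ i $ j))\<^sup>2) = (\<Sum>i\<in>UNIV. cnj (M $ i $ j) * M $ i $ j)"
      unfolding of_real_sum by (intro sum.cong refl) (metis complex_norm_square mult.commute)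
    also have "\<dots> = complex_of_real 1" using unitary_columns[OF that, of j j] by simp
    finally have sum1: "(\<Sum>i\<in>UNIV. (norm (M $ i $ j))\<^sup>2) = 1" unfolding of_real_eq_iff .
    have "(norm (M $ i $ j))\<^sup>2 \<le> (\<Sum>i\<in>UNIV. (norm (M $ i $ j))\<^sup>2)"
      by (rule member_le_sum) auto
    with sum1 have "(norm (M $ i $ j))\<^sup>2 \<le> 1\<^sup>2" by simp
    thus ?thesis by (rule power2_le_imp_le) simp
  qed
  have "norm M \<le> (\<Sum>i\<in>(UNIV :: 'n set). \<Sum>j\<in>(UNIV :: 'n set). 1)" if "M \<in> unitary_group" for M :: "complex^'n^'n"
  proof -
    have "norm M \<le> (\<Sum>i\<in>UNIV. norm (M $ i))"
      unfolding norm_vec_def[of M] by (rule L2_set_le_sum) auto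
    also have "\<dots> \<le> (\<Sum>i\<in>UNIV. \<Sum>j\<in>UNIV. norm (M $ i $ j))"
      by (intro sum_mono) (simp add: norm_vec_def[of "M $ _"] L2_set_le_sum)
    also have "\<dots> \<le> (\<Sum>i\<in>(UNIV :: 'n set). \<Sum>j\<in>(UNIV :: 'n set). 1)"
      by (intro sum_mono entry that)
    finally show ?thesis .
  qed
  hence "bounded (unitary_group :: (complex^'n^'n) set)" unfolding bounded_iff by blast
  with closed show ?thesis by (simp add: compact_eq_bounded_closed)
qed

section \<open>Continuity of traces, symmetric functions and the determinant\<close>

lemma continuous_on_matrix_power_entry:
  "continuous_on A (\<lambda>M :: complex^'n^'n. matrix_power M r $ i $ j)"
proof (induction r arbitrary: i j)
  case (Suc r)
  have "continuous_on A (\<lambda>M :: complex^'n^'n. \<Sum>k\<in>UNIV. M $ i $ k * matrix_power M r $ k $ j)"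
    by (intro continuous_on_sum continuous_on_mult Suc continuous_on_entry)
  thus ?case by (simp add: matrix_power_Suc matrix_matrix_mult_def)
qed simp

lemma continuous_on_ptr: "continuous_on A (\<lambda>M :: complex^'n^'n. ptr M r)"
  unfolding ptr_def trace_def by (intro continuous_on_sum continuous_on_matrix_power_entry)

lemma continuous_on_hsym_ptr: "continuous_on A (\<lambda>M :: complex^'n^'n. hsym (ptr M) k)"
proof (cases "k < 0")
  case False
  have "continuous_on A (\<lambda>M :: complex^'n^'n. hsym (ptr M) (int m))" for m
  proof (induction m rule: less_induct)
    case (less m)
    show ?case
    proof (cases "m = 0")
      case False
      have "continuous_on A (\<lambda>M :: complex^'n^'n. (1 / of_nat m) * (\<Sum>r=1..m. ptr M r * hsym (ptr M) (int m - int r)))"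
      proof (intro continuous_on_mult continuous_on_const continuous_on_sum continuous_on_ptr)
        fix r assume "r \<in> {1..m}"
        hence "int m - int r = int (m - r)" "m - r < m" by auto
        with less.IH show "continuous_on A (\<lambda>M :: complex^'n^'n. hsym (ptr M) (int m - int r))" by metis
      qed
      moreover have "(1 / of_nat m) * (\<Sum>r=1..m. ptr M r * hsym (ptr M) (int m - int r)) = hsym (ptr M) (int m)"
        for M :: "complex^'n^'n"
        using hsym_newton[of "int m" m "ptr M"] False by (simp add: field_simps)
      ultimately show ?thesis by simp
    qed simp
  qed
  from this[of "nat k"] False show ?thesis by simp
qed simp

lemma continuous_on_hprod_ptr: "continuous_on A (\<lambda>M :: complex^'n^'n. hprod n (ptr M) \<beta>)"
  unfolding hprod_def by (intro continuous_on_prod continuous_on_hsym_ptr)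

lemma continuous_on_jdet_ptr: "continuous_on A (\<lambda>M :: complex^'n^'n. jdet n (ptr M) g)"
  unfolding jdet_eq_sum_hprod by (intro continuous_on_sum continuous_on_mult continuous_on_const continuous_on_hprod_ptr)

lemma continuous_on_det_jmat: "continuous_on A (\<lambda>M :: complex^'n^'n. Determinant.det (jmat M))"
proof -
  have "Determinant.det (jmat M) = (\<Sum>p | p permutes {0..<CARD('n)}. of_int (sign p) *
      (\<Prod>i=0..<CARD('n). M $ enum_index i $ enum_index (p i)))" for M :: "complex^'n^'n"
    by (subst det_def'[of _ "CARD('n)"], simp)
       (auto simp: jmat_def permutes_in_image intro!: sum.cong prod.cong)
  thus ?thesis
    by (simp, intro continuous_on_sum continuous_on_mult continuous_on_const continuous_on_prod continuous_on_entry)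
qed

lemma det_jmat_mult: "Determinant.det (jmat (A ** B)) = Determinant.det (jmat A) * Determinant.det (jmat (B :: complex^'n^'n))"
  unfolding jmat_mult by (rule det_mult[of _ "CARD('n)"]) auto

section \<open>Integration by parts for Haar measure\<close>

lemma haar_prob_space: "normalized_haar H \<Longrightarrow> prob_space H"
  and haar_space: "normalized_haar H \<Longrightarrow> space H = unitary_group"
  and haar_sets: "normalized_haar H \<Longrightarrow> sets H = sets (restrict_space borel unitary_group)"
  by (simp_all add: normalized_haar_def)

lemma haar_borel_measurable:
  fixes H :: "(complex^'n^'n) measure" and f :: "complex^'n^'n \<Rightarrow> complex"
  assumes H: "normalized_haar H" and f: "continuous_on unitary_group f"
  shows "f \<in> borel_measurable H"
  using borel_measurable_continuous_on_restrict[OF f] measurable_cong_sets[OF haar_sets[OF H] refl] by blast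

lemma haar_integrable:
  fixes H :: "(complex^'n^'n) measure" and f :: "complex^'n^'n \<Rightarrow> complex"
  assumes H: "normalized_haar H" and f: "continuous_on unitary_group f"
  shows "integrable H f"
proof -
  interpret prob_space H by (rule haar_prob_space[OF H])
  have "bounded (f ` unitary_group)"
    by (intro compact_imp_bounded compact_continuous_image f compact_unitary_group)
  then obtain B where B: "\<And>M. M \<in> unitary_group \<Longrightarrow> norm (f M) \<le> B"
    unfolding bounded_iff by blast
  show ?thesis
    by (rule integrable_const_bound[of _ B])
       (auto intro!: AE_I2 B haar_borel_measurable H f simp: haar_space[OF H])
qed

lemma continuous_on_matrix_mult_left: "continuous_on A (\<lambda>M :: complex^'n^'n. V ** M)"
  unfolding matrix_matrix_mult_def by (intro continuous_intros)

lemma haar_translate: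
  fixes H :: "(complex^'n^'n) measure" and f :: "complex^'n^'n \<Rightarrow> complex"
  assumes H: "normalized_haar H" and f: "continuous_on unitary_group f" and V: "V \<in> unitary_group"
  shows "(\<integral>M. f (V ** M) \<partial>H) = (\<integral>M. f M \<partial>H)"
proof -
  have "(\<lambda>M. V ** M) \<in> measurable (restrict_space borel unitary_group) (restrict_space borel unitary_group)"
    using unitary_group_mult[OF V]
    by (intro measurable_restrict_space2 borel_measurable_continuous_on_restrict continuous_on_matrix_mult_left)
       (auto simp: space_restrict_space)
  hence "(\<lambda>M. V ** M) \<in> measurable H H"
    using measurable_cong_sets[OF haar_sets[OF H] haar_sets[OF H]] by blast
  from integral_distr[OF this haar_borel_measurable[OF H f]]
  have "(\<integral>M. f M \<partial>distr H H (\<lambda>M. V ** M)) = (\<integral>M. f (V ** M) \<partial>H)" .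
  moreover have "distr H H (\<lambda>M. V ** M) = H" using H V by (auto simp: normalized_haar_def)
  ultimately show ?thesis by simp
qed

section \<open>Circles of unitary matrices generated by projectors\<close>

definition smat :: "complex \<Rightarrow> complex^'n^'n \<Rightarrow> complex^'n^'n" where
  "smat c A = (\<chi> i j. c * A $ i $ j)"

lemma smat_nth [simp]: "smat c A $ i $ j = c * A $ i $ j"
  by (simp add: smat_def)

lemma smat_mult_left: "smat c A ** B = smat c (A ** B)"
  by (simp add: Finite_Cartesian_Product.vec_eq_iff matrix_matrix_mult_def sum_distrib_left mult_ac)

lemma smat_mult_right: "A ** smat c B = smat c (A ** B)"
  by (simp add: Finite_Cartesian_Product.vec_eq_iff matrix_matrix_mult_def sum_distrib_left mult_ac)

lemma matrix_add_mult: "(A + B) ** C = A ** C + B ** (C :: complex^'n^'n)"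
  by (simp add: Finite_Cartesian_Product.vec_eq_iff matrix_matrix_mult_def sum.distrib distrib_right)

lemma matrix_mult_add: "A ** (B + C) = A ** B + A ** (C :: complex^'n^'n)"
  by (simp add: Finite_Cartesian_Product.vec_eq_iff matrix_matrix_mult_def sum.distrib distrib_left)

text \<open>For an orthogonal projector P and w = e^{i theta} this is exp(i theta P), a circle in
  the unitary group. The form 1 + (w - 1) P is affine in w, so matrix entries along the circle are
  polynomials in w.\<close>

definition pencil :: "complex^'n^'n \<Rightarrow> complex \<Rightarrow> complex^'n^'n" where
  "pencil P w = Finite_Cartesian_Product.mat 1 + smat (w - 1) P"

text \<open>Orthogonal projectors onto lines: for an idempotent, trace 1 means rank one.\<close>

definition unit_projector :: "complex^'n^'n \<Rightarrow> bool" where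
  "unit_projector P \<longleftrightarrow> madj P = P \<and> P ** P = P \<and> Determinants.trace P = 1"

lemma pencil_1 [simp]: "pencil P 1 = Finite_Cartesian_Product.mat 1"
  by (simp add: pencil_def Finite_Cartesian_Product.vec_eq_iff)

lemma pencil_mult:
  assumes "P ** P = P"
  shows "pencil P a ** pencil P b = pencil P (a * b)"
proof -
  have "pencil P a ** pencil P b = Finite_Cartesian_Product.mat 1 + smat (a - 1) P +
      smat (b - 1) (P + smat (a - 1) P)"
    by (simp add: pencil_def matrix_mult_add matrix_add_mult smat_mult_left smat_mult_right assms)
  also have "\<dots> = pencil P (a * b)"
    by (simp add: pencil_def Finite_Cartesian_Product.vec_eq_iff algebra_simps)
  finally show ?thesis .
qed

lemma madj_pencil: "madj P = P \<Longrightarrow> madj (pencil P w) = pencil P (cnj w)"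
proof -
  assume "madj P = P"
  hence "cnj (P $ j $ i) = P $ i $ j" for i j by (metis madj_nth)
  thus ?thesis by (simp add: pencil_def Finite_Cartesian_Product.vec_eq_iff Finite_Cartesian_Product.mat_def)
qed

lemma pencil_unitary:
  assumes P: "unit_projector P" and w: "cmod w = 1"
  shows "pencil P w \<in> unitary_group"
proof -
  have "w * cnj w = 1" "cnj w * w = 1"
    using complex_norm_square[of w] w by (auto simp: mult.commute)
  with P show ?thesis
    by (simp add: unitary_group_iff unit_projector_def madj_pencil pencil_mult)
qed

lemma pencil_power: "P ** P = P \<Longrightarrow> matrix_power (pencil P w) k = pencil P (w ^ k)"
  by (induction k) (simp_all add: matrix_power_Suc pencil_mult)

lemma trace_pencil: "Determinants.trace (pencil P w) = of_nat CARD('n) + (w - 1) * Determinants.trace (P :: complex^'n^'n)"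
  by (simp add: trace_def pencil_def Finite_Cartesian_Product.mat_def sum.distrib sum_distrib_left)

text \<open>The power traces agree with the power sums of (w, 1, ..., 1). The product of the
  eigenvalues is itself a function of the power sums, by \<open>jdet_staircase_shift\<close> with K
  = 1, so the two products agree.\<close>

lemma det_pencil:
  fixes P :: "complex^'n^'n"
  assumes P: "unit_projector P" and w: "cmod w = 1"
  shows "Determinant.det (jmat (pencil P w)) = w"
proof -
  let ?n = "CARD('n)"
  obtain x where x: "x \<in> torus ?n" "ptr (pencil P w) = psum ?n x"
    "Determinant.det (jmat (pencil P w)) = (\<Prod>i<?n. x i)"
    by (rule unitary_spectrum[OF pencil_unitary[OF P w]])
  define y where "y = (\<lambda>i :: nat. if i = 0 then w else 1)"
  have y: "y \<in> torus ?n" using w by (simp add: torus_def y_def)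
  have n: "{..<?n} = insert 0 {1..<?n}" by (auto simp: Suc_le_eq)
  have "psum ?n x r = psum ?n y r" for r
  proof -
    have "psum ?n y r = w ^ r + (\<Sum>i\<in>{1..<?n}. 1)"
      unfolding psum_def n by (subst sum.insert) (auto simp: y_def intro!: sum.cong)
    also have "(\<Sum>i\<in>{1..<?n}. 1 :: complex) = of_nat ?n - 1"
      by (simp add: of_nat_diff Suc_le_eq)
    finally have "psum ?n y r = of_nat ?n + (w ^ r - 1)" by simp
    also have "\<dots> = ptr (pencil P w) r"
      using P by (simp add: ptr_def unit_projector_def pencil_power trace_pencil)
    finally show ?thesis using x(2) by simp
  qed
  hence eq: "psum ?n x = psum ?n y" by blast
  have "(\<Prod>i<?n. x i) = (\<Prod>i<?n. y i)"
    using jdet_staircase_shift[OF x(1), of 1] jdet_staircase_shift[OF y, of 1] eq by simp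
  also have "\<dots> = w" unfolding n by (subst prod.insert) (auto simp: y_def)
  finally show ?thesis using x(3) by simp
qed

section \<open>Polynomials along the circle and integration by parts\<close>

text \<open>Polynomial in w, with a degree bound uniform in M and continuous coefficients: this is
  what allows integration over M coefficient by coefficient.\<close>

definition circle_poly :: "(complex \<Rightarrow> complex^'n^'n \<Rightarrow> complex) \<Rightarrow> bool" where
  "circle_poly G \<longleftrightarrow> (\<exists>q d. (\<forall>M. degree (q M) \<le> d) \<and>
     (\<forall>j. continuous_on unitary_group (\<lambda>M. poly.coeff (q M) j)) \<and> (\<forall>w M. G w M = poly (q M) w))"

lemma circle_polyI:
  assumes "\<And>M. degree (q M) \<le> d" "\<And>j. continuous_on unitary_group (\<lambda>M. poly.coeff (q M) j)"
    "\<And>w M. G w M = poly (q M) w"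
  shows "circle_poly G"
  unfolding circle_poly_def using assms by blast

lemma circle_poly_const:
  assumes "continuous_on unitary_group f"
  shows "circle_poly (\<lambda>w. f)"
proof (rule circle_polyI[of "\<lambda>M. [:f M:]" 0])
  show "continuous_on unitary_group (\<lambda>M. poly.coeff [:f M:] j)" for j
    using assms by (cases j) auto
qed auto

lemma circle_poly_linear:
  assumes "continuous_on unitary_group f" "continuous_on unitary_group g"
  shows "circle_poly (\<lambda>w M. f M + w * g M)"
proof (rule circle_polyI[of "\<lambda>M. [:f M, g M:]" 1])
  show "continuous_on unitary_group (\<lambda>M. poly.coeff [:f M, g M:] j)" for j
    using assms by (cases j; cases "j - 1") (auto simp: coeff_pCons split: nat.splits)
qed auto

lemma circle_poly_add:
  assumes "circle_poly F" "circle_poly G"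
  shows "circle_poly (\<lambda>w M. F w M + G w M)"
proof -
  obtain p d where p: "\<And>M. degree (p M) \<le> d" "\<And>j. continuous_on unitary_group (\<lambda>M. poly.coeff (p M) j)"
    "\<And>w M. F w M = poly (p M) w" using assms(1) unfolding circle_poly_def by blast
  obtain q e where q: "\<And>M. degree (q M) \<le> e" "\<And>j. continuous_on unitary_group (\<lambda>M. poly.coeff (q M) j)"
    "\<And>w M. G w M = poly (q M) w" using assms(2) unfolding circle_poly_def by blast
  show ?thesis
  proof (rule circle_polyI[of "\<lambda>M. p M + q M" "max d e"])
    show "degree (p M + q M) \<le> max d e" for M
      using p(1)[of M] q(1)[of M] by (intro degree_add_le) auto
    show "continuous_on unitary_group (\<lambda>M. poly.coeff (p M + q M) j)" for j
      unfolding coeff_add by (intro continuous_on_add p q)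
  qed (simp add: p q)
qed

lemma circle_poly_mult:
  assumes "circle_poly F" "circle_poly G"
  shows "circle_poly (\<lambda>w M. F w M * G w M)"
proof -
  obtain p d where p: "\<And>M. degree (p M) \<le> d" "\<And>j. continuous_on unitary_group (\<lambda>M. poly.coeff (p M) j)"
    "\<And>w M. F w M = poly (p M) w" using assms(1) unfolding circle_poly_def by blast
  obtain q e where q: "\<And>M. degree (q M) \<le> e" "\<And>j. continuous_on unitary_group (\<lambda>M. poly.coeff (q M) j)"
    "\<And>w M. G w M = poly (q M) w" using assms(2) unfolding circle_poly_def by blast
  show ?thesis
  proof (rule circle_polyI[of "\<lambda>M. p M * q M" "d + e"])
    show "degree (p M * q M) \<le> d + e" for M
      using degree_mult_le[of "p M" "q M"] p(1)[of M] q(1)[of M] by linarith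
    show "continuous_on unitary_group (\<lambda>M. poly.coeff (p M * q M) j)" for j
      unfolding coeff_mult by (intro continuous_on_sum continuous_on_mult p q)
  qed (simp add: p q)
qed

lemma circle_poly_sum:
  "(\<And>a. a \<in> A \<Longrightarrow> circle_poly (F a)) \<Longrightarrow> circle_poly (\<lambda>w M. \<Sum>a\<in>A. F a w M)"
  by (induction A rule: infinite_finite_induct) (auto intro: circle_poly_add circle_poly_const)

lemma circle_poly_prod:
  "(\<And>a. a \<in> A \<Longrightarrow> circle_poly (F a)) \<Longrightarrow> circle_poly (\<lambda>w M. \<Prod>a\<in>A. F a w M)"
  by (induction A rule: infinite_finite_induct) (auto intro: circle_poly_mult circle_poly_const)

lemma pencil_mult_nth:
  "(pencil P w ** M) $ i $ j = (M $ i $ j - (P ** M) $ i $ j) + w * (P ** (M :: complex^'n^'n)) $ i $ j"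
  unfolding pencil_def matrix_add_mult smat_mult_left matrix_mul_lid by (simp add: left_diff_distrib)

lemma circle_poly_pencil_nth: "circle_poly (\<lambda>w M. (pencil P w ** M) $ i $ j)"
  unfolding pencil_mult_nth
  by (intro circle_poly_linear continuous_on_diff continuous_on_entry
        continuous_on_compose2[OF continuous_on_entry continuous_on_matrix_mult_left]) auto

lemma circle_poly_power_nth: "circle_poly (\<lambda>w M. matrix_power (pencil P w ** M) r $ i $ j)"
proof (induction r arbitrary: i j)
  case (Suc r)
  have "circle_poly (\<lambda>w M. \<Sum>k\<in>UNIV. (pencil P w ** M) $ i $ k * matrix_power (pencil P w ** M) r $ k $ j)"
    by (intro circle_poly_sum circle_poly_mult circle_poly_pencil_nth Suc)
  thus ?case by (simp add: matrix_power_Suc matrix_matrix_mult_def[of "pencil P _ ** _"])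
qed (simp add: circle_poly_const)

lemma circle_poly_ptr: "circle_poly (\<lambda>w M. ptr (pencil P w ** M) r)"
  unfolding ptr_def trace_def by (intro circle_poly_sum circle_poly_power_nth)

lemma circle_poly_hsym:
  fixes P :: "complex^'n^'n"
  shows "circle_poly (\<lambda>w M. hsym (ptr (pencil P w ** M)) k)"
proof (cases "k < 0")
  case False
  have "circle_poly (\<lambda>w M. hsym (ptr (pencil P w ** M)) (int m))" for m
  proof (induction m rule: less_induct)
    case (less m)
    show ?case
    proof (cases "m = 0")
      case False
      have "circle_poly (\<lambda>w M. (1 / of_nat m) * (\<Sum>r=1..m. ptr (pencil P w ** M) r *
          hsym (ptr (pencil P w ** M)) (int m - int r)))"
      proof (intro circle_poly_mult circle_poly_const continuous_on_const circle_poly_sum circle_poly_ptr)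
        fix r assume "r \<in> {1..m}"
        hence "int m - int r = int (m - r)" "m - r < m" by auto
        with less.IH show "circle_poly (\<lambda>w M. hsym (ptr (pencil P w ** M)) (int m - int r))" by metis
      qed
      moreover have "(1 / of_nat m) * (\<Sum>r=1..m. ptr M r * hsym (ptr M) (int m - int r)) = hsym (ptr M) (int m)"
        for M :: "complex^'n^'n"
        using hsym_newton[of "int m" m "ptr M"] False by (simp add: field_simps)
      ultimately show ?thesis by simp
    qed (simp add: circle_poly_const)
  qed
  from this[of "nat k"] False show ?thesis by simp
qed (simp add: circle_poly_const)

lemma circle_poly_hprod: "circle_poly (\<lambda>w M. hprod n (ptr (pencil P w ** M)) \<beta>)"
  unfolding hprod_def by (intro circle_poly_prod circle_poly_hsym)

text \<open>
  Invariance of the Haar measure under the circle \<open>pencil P w\<close> makes a Laurent polynomial in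
  \<open>w\<close> constant; comparing coefficients gives integration by parts in the direction \<open>P\<close>, without
  differentiating under the integral sign. On the unitary group, the conjugate of the
  determinant is its inverse.
\<close>

lemma haar_integration_by_parts:
  fixes H :: "(complex^'n^'n) measure"
  assumes H: "normalized_haar H" and P: "unit_projector P"
    and G: "circle_poly G" and g: "continuous_on unitary_group g"
    and Gg: "\<And>w M. G w M = g (pencil P w ** M)"
    and G': "\<And>M. ((\<lambda>w. G w M) has_field_derivative G' M) (at 1)"
  shows "(\<integral>M. cnj (Determinant.det (jmat M)) ^ k * (G' M - of_nat k * g M) \<partial>H) = 0"
proof -
  obtain q d where q: "\<And>M. degree (q M) \<le> d" "\<And>j. continuous_on unitary_group (\<lambda>M. poly.coeff (q M) j)"
    "\<And>w M. G w M = poly (q M) w" using G unfolding circle_poly_def by blast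
  define c where "c = (\<lambda>M :: complex^'n^'n. cnj (Determinant.det (jmat M)) ^ k)"
  have c: "continuous_on unitary_group c"
    unfolding c_def by (intro continuous_on_power continuous_on_cnj continuous_on_det_jmat)
  have cq: "integrable H (\<lambda>M. c M * poly.coeff (q M) j)" for j
    by (intro haar_integrable H continuous_on_mult c q)
  define I where "I = (\<integral>M. c M * g M \<partial>H)"
  define Ij where "Ij = (\<lambda>j. \<integral>M. c M * poly.coeff (q M) j \<partial>H)"
  define Q where "Q = (\<Sum>j\<le>d. Polynomial.monom (Ij j) j)"
  have poly_q: "poly (q M) w = (\<Sum>j\<le>d. poly.coeff (q M) j * w ^ j)" for M w
    unfolding poly_altdef using q(1)[of M] by (intro sum.mono_neutral_left) (auto simp: coeff_eq_0)
  \<comment> \<open>Translation by the circle element multiplies \<open>c\<close> by the k-th power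
    of the conjugate of w and turns g into its polynomial in w. Invariance then says that w^k I
    equals Q at w.\<close>
  have circle: "poly (Polynomial.monom I k - Q) w = 0" if w: "cmod w = 1" for w
  proof -
    have ww: "w * cnj w = 1" using complex_norm_square[of w] w by simp
    have "I = (\<integral>M. c (pencil P w ** M) * g (pencil P w ** M) \<partial>H)"
      unfolding I_def
      by (rule haar_translate[symmetric, OF H _ pencil_unitary[OF P w]]) (intro continuous_on_mult c g)
    also have "\<dots> = (\<integral>M. (\<Sum>j\<le>d. (cnj w ^ k * w ^ j) * (c M * poly.coeff (q M) j)) \<partial>H)"
    proof (rule Bochner_Integration.integral_cong[OF refl])
      fix M
      have "c (pencil P w ** M) = cnj w ^ k * c M"
        unfolding c_def det_jmat_mult det_pencil[OF P w] by (simp add: power_mult_distrib)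
      moreover have "g (pencil P w ** M) = (\<Sum>j\<le>d. poly.coeff (q M) j * w ^ j)"
        using Gg[of w M] q(3)[of w M] poly_q by simp
      ultimately show "c (pencil P w ** M) * g (pencil P w ** M) =
          (\<Sum>j\<le>d. (cnj w ^ k * w ^ j) * (c M * poly.coeff (q M) j))"
        by (simp add: sum_distrib_left mult_ac)
    qed
    also have "\<dots> = (\<Sum>j\<le>d. (cnj w ^ k * w ^ j) * Ij j)"
      unfolding Ij_def
      by (subst Bochner_Integration.integral_sum) (auto intro!: integrable_mult_right cq)
    also have "\<dots> = cnj w ^ k * poly Q w"
      by (simp add: Q_def poly_sum poly_monom sum_distrib_left mult_ac)
    finally have "w ^ k * I = (w * cnj w) ^ k * poly Q w" by (simp add: power_mult_distrib)
    thus ?thesis using ww by (simp add: poly_monom mult.commute)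
  qed
  have "Polynomial.monom I k - Q = 0"
  proof (rule ccontr)
    assume "Polynomial.monom I k - Q \<noteq> 0"
    note nz = this
    \<comment> \<open>One more than the degree: the m-th roots of unity lie on the circle and are
      too many roots for a nonzero polynomial.\<close>
    define m where "m = Suc (degree (Polynomial.monom I k - Q))"
    have "m > 0" by (simp add: m_def)
    have "{z :: complex. z ^ m = 1} \<subseteq> {w. poly (Polynomial.monom I k - Q) w = 0}"
    proof safe
      fix z :: complex assume "z ^ m = 1"
      hence "cmod z ^ m = 1 ^ m" by (metis norm_one norm_power power_one)
      hence "cmod z = 1" using \<open>m > 0\<close> by (intro power_eq_imp_eq_base[of "cmod z" m 1]) auto
      thus "poly (Polynomial.monom I k - Q) z = 0" by (rule circle)
    qed
    hence "m \<le> card {w. poly (Polynomial.monom I k - Q) w = 0}"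
      using card_mono[OF poly_roots_finite[OF nz]] card_roots_unity_eq[OF \<open>m > 0\<close>] by metis
    also have "\<dots> \<le> degree (Polynomial.monom I k - Q)"
      using card_poly_roots_bound[OF nz] by simp
    finally show False by (simp add: m_def)
  qed
  hence Q: "Q = Polynomial.monom I k" by simp
  \<comment> \<open>The derivative at w = 1 weights the j-th coefficient by j, so the integral is
    the derivative of Q at 1, and Q is the monomial I w^k.\<close>
  have "(\<integral>M. c M * G' M \<partial>H) = (\<integral>M. (\<Sum>j\<le>d. of_nat j * (c M * poly.coeff (q M) j)) \<partial>H)"
  proof (rule Bochner_Integration.integral_cong[OF refl])
    fix M
    have "((\<lambda>w. G w M) has_field_derivative poly (pderiv (q M)) 1) (at 1)"
      unfolding q(3) by (rule poly_DERIV)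
    hence "G' M = poly (pderiv (q M)) 1" using G'[of M] DERIV_unique by blast
    also have "q M = (\<Sum>j\<le>d. Polynomial.monom (poly.coeff (q M) j) j)"
      using poly_as_sum_of_monoms'[OF q(1)[of M]] by simp
    also have "poly (pderiv \<dots>) 1 = (\<Sum>j\<le>d. of_nat j * poly.coeff (q M) j)"
      by (simp add: pderiv_sum pderiv_monom poly_sum poly_monom)
    finally show "c M * G' M = (\<Sum>j\<le>d. of_nat j * (c M * poly.coeff (q M) j))"
      by (simp add: sum_distrib_left mult_ac)
  qed
  also have "\<dots> = (\<Sum>j\<le>d. of_nat j * Ij j)"
    unfolding Ij_def
    by (subst Bochner_Integration.integral_sum) (auto intro!: integrable_mult_right cq)
  also have "\<dots> = poly (pderiv Q) 1"
    by (simp add: Q_def pderiv_sum pderiv_monom poly_sum poly_monom)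
  also have "\<dots> = of_nat k * I" unfolding Q by (simp add: pderiv_monom poly_monom)
  finally have main: "(\<integral>M. c M * G' M \<partial>H) = of_nat k * I" .
  have intG': "integrable H (\<lambda>M. c M * G' M)"
  proof -
    have "G' M = (\<Sum>j\<le>d. of_nat j * poly.coeff (q M) j)" for M
    proof -
      have "((\<lambda>w. G w M) has_field_derivative poly (pderiv (q M)) 1) (at 1)"
        unfolding q(3) by (rule poly_DERIV)
      hence "G' M = poly (pderiv (q M)) 1" using G'[of M] DERIV_unique by blast
      also have "q M = (\<Sum>j\<le>d. Polynomial.monom (poly.coeff (q M) j) j)"
        using poly_as_sum_of_monoms'[OF q(1)[of M]] by simp
      also have "poly (pderiv \<dots>) 1 = (\<Sum>j\<le>d. of_nat j * poly.coeff (q M) j)"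
        by (simp add: pderiv_sum pderiv_monom poly_sum poly_monom)
      finally show ?thesis .
    qed
    thus ?thesis
      by (simp, intro haar_integrable H continuous_on_mult c continuous_on_sum continuous_on_const q)
  qed
  have "(\<integral>M. c M * (G' M - of_nat k * g M) \<partial>H) = (\<integral>M. c M * G' M - of_nat k * (c M * g M) \<partial>H)"
    by (simp add: algebra_simps)
  also have "\<dots> = (\<integral>M. c M * G' M \<partial>H) - (\<integral>M. of_nat k * (c M * g M) \<partial>H)"
    by (intro Bochner_Integration.integral_diff intG' integrable_mult_right haar_integrable H continuous_on_mult c g)
  also have "\<dots> = 0" unfolding main by (simp add: I_def)
  finally show ?thesis by (simp add: c_def)
qed

section \<open>The loop equation\<close>

text \<open>The derivative of the r-th power of M when M moves with velocity A M. Along the pencil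
  of P this is the velocity at w = 1, with A = P.\<close>

primrec dpow :: "complex^'n^'n \<Rightarrow> complex^'n^'n \<Rightarrow> nat \<Rightarrow> complex^'n^'n" where
  "dpow A M 0 = 0"
| "dpow A M (Suc r) = A ** matrix_power M (Suc r) + M ** dpow A M r"

definition dhprod :: "nat \<Rightarrow> complex^'n^'n \<Rightarrow> complex^'n^'n \<Rightarrow> (nat \<Rightarrow> int) \<Rightarrow> complex" where
  "dhprod R A M \<beta> = (\<Sum>a<CARD('n). \<Sum>s=1..R.
     Determinants.trace (A ** matrix_power M s) * hprod CARD('n) (ptr M) (lower \<beta> a s))"

lemma trace_smat: "Determinants.trace (smat c A) = c * Determinants.trace A"
  by (simp add: trace_def sum_distrib_left)

lemma smat_add_right: "smat c (A + B) = smat c A + smat c B"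
  by (simp add: Finite_Cartesian_Product.vec_eq_iff distrib_left)

text \<open>Each of the r terms of the product rule contributes the same trace, because A can be
  rotated to the front.\<close>

lemma trace_power_dpow:
  "Determinants.trace (matrix_power M s ** dpow A M r) =
     of_nat r * Determinants.trace (A ** matrix_power M (r + s))"
proof (induction r arbitrary: s)
  case 0
  have "matrix_power M s ** (0 :: complex^'a^'a) = 0"
    by (simp add: matrix_matrix_mult_def Finite_Cartesian_Product.vec_eq_iff)
  thus ?case by (simp add: trace_def)
next
  case (Suc r)
  have "Determinants.trace (matrix_power M s ** (A ** matrix_power M (Suc r))) =
      Determinants.trace (A ** matrix_power M (Suc r) ** matrix_power M s)"
    by (rule trace_mul_sym)
  also have "A ** matrix_power M (Suc r) ** matrix_power M s = A ** matrix_power M (Suc r + s)"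
    by (simp only: matrix_mul_assoc[symmetric] matrix_power_add)
  finally have 1: "Determinants.trace (matrix_power M s ** (A ** matrix_power M (Suc r))) =
      Determinants.trace (A ** matrix_power M (Suc r + s))" .
  have "matrix_power M s ** (M ** dpow A M r) = matrix_power M (Suc s) ** dpow A M r"
    by (simp only: matrix_mul_assoc matrix_power_Suc_right)
  hence 2: "Determinants.trace (matrix_power M s ** (M ** dpow A M r)) =
      of_nat r * Determinants.trace (A ** matrix_power M (r + Suc s))" using Suc by simp
  show ?case by (simp add: matrix_mult_add trace_add 1 2 algebra_simps)
qed

lemma trace_dpow: "Determinants.trace (dpow A M r) = of_nat r * Determinants.trace (A ** matrix_power M r)"
  using trace_power_dpow[of M 0 A r] by simp

lemma has_field_derivative_power_pencil:
  fixes P M :: "complex^'n^'n"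
  shows "((\<lambda>w. matrix_power (pencil P w ** M) r $ i $ j) has_field_derivative dpow P M r $ i $ j) (at 1)"
proof (induction r arbitrary: i j)
  case (Suc r)
  have lin: "((\<lambda>w. (pencil P w ** M) $ i $ k) has_field_derivative (P ** M) $ i $ k) (at 1)" for k
    unfolding pencil_mult_nth by (auto intro!: derivative_eq_intros)
  have "((\<lambda>w. \<Sum>k\<in>UNIV. (pencil P w ** M) $ i $ k * matrix_power (pencil P w ** M) r $ k $ j) has_field_derivative
      (\<Sum>k\<in>UNIV. (P ** M) $ i $ k * matrix_power (pencil P 1 ** M) r $ k $ j +
         dpow P M r $ k $ j * (pencil P 1 ** M) $ i $ k)) (at 1)"
    by (intro DERIV_sum DERIV_mult lin Suc)
  also have "(\<Sum>k\<in>UNIV. (P ** M) $ i $ k * matrix_power (pencil P 1 ** M) r $ k $ j +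
         dpow P M r $ k $ j * (pencil P 1 ** M) $ i $ k) =
      ((P ** M) ** matrix_power M r + M ** dpow P M r) $ i $ j"
    by (simp add: matrix_matrix_mult_def[of "P ** M"] matrix_matrix_mult_def[of M "dpow P M r"]
        sum.distrib mult.commute[of "dpow P M r $ _ $ _"])
  also have "(P ** M) ** matrix_power M r + M ** dpow P M r = dpow P M (Suc r)"
    by (simp add: matrix_power_Suc matrix_mul_assoc)
  finally show ?case
    by (simp only: matrix_power_Suc matrix_matrix_mult_def[of "pencil P _ ** _" "matrix_power _ _"] vec_lambda_beta)
qed simp

lemma has_field_derivative_ptr_pencil:
  fixes P M :: "complex^'n^'n"
  shows "((\<lambda>w. ptr (pencil P w ** M) r) has_field_derivative
     of_nat r * Determinants.trace (P ** matrix_power M r)) (at 1)"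
  unfolding ptr_def trace_dpow[symmetric]
  unfolding trace_def by (intro DERIV_sum has_field_derivative_power_pencil)

lemma has_field_derivative_hprod_pencil:
  fixes P M :: "complex^'n^'n"
  assumes R: "\<And>a. a < CARD('n) \<Longrightarrow> \<beta> a \<le> int R"
  shows "((\<lambda>w. hprod CARD('n) (ptr (pencil P w ** M)) \<beta>) has_field_derivative dhprod R P M \<beta>) (at 1)"
proof -
  let ?n = "CARD('n)"
  let ?t = "\<lambda>s. Determinants.trace (P ** matrix_power M s)"
  have "((\<lambda>w. \<Prod>a<?n. hsym (ptr (pencil P w ** M)) (\<beta> a)) has_field_derivative
     (\<Sum>a<?n. (\<Sum>s=1..R. ?t s * hsym (ptr (pencil P 1 ** M)) (\<beta> a - int s)) *
        (\<Prod>b\<in>{..<?n}-{a}. hsym (ptr (pencil P 1 ** M)) (\<beta> b)))) (at 1)"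
  proof (rule has_field_derivative_prod)
    fix a assume "a \<in> {..<?n}"
    thus "((\<lambda>w. hsym (ptr (pencil P w ** M)) (\<beta> a)) has_field_derivative
      (\<Sum>s=1..R. ?t s * hsym (ptr (pencil P 1 ** M)) (\<beta> a - int s))) (at 1)"
      using hsym_has_field_derivative[of "\<lambda>r w. ptr (pencil P w ** M) r" ?t 1 "\<beta> a" R]
        has_field_derivative_ptr_pencil[of P M] R[of a] by simp
  qed
  also have "(\<Sum>a<?n. (\<Sum>s=1..R. ?t s * hsym (ptr (pencil P 1 ** M)) (\<beta> a - int s)) *
        (\<Prod>b\<in>{..<?n}-{a}. hsym (ptr (pencil P 1 ** M)) (\<beta> b))) = dhprod R P M \<beta>"
    unfolding dhprod_def by (intro sum.cong refl) (simp add: hprod_lower sum_distrib_right mult.assoc)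
  finally show ?thesis by (simp only: hprod_def)
qed

text \<open>The integrand obtained by parts in direction A from an entry of the r-th power times
  \<open>hprod\<close>. For a unit projector the twist contributes the factor k; written as k times
  the trace of A it makes the whole expression complex linear in A, so that directions other than
  projectors become accessible.\<close>

definition ibp_term :: "nat \<Rightarrow> nat \<Rightarrow> nat \<Rightarrow> (nat \<Rightarrow> int) \<Rightarrow> 'n \<Rightarrow> 'n \<Rightarrow> complex^'n^'n \<Rightarrow> complex^'n^'n \<Rightarrow> complex" where
  "ibp_term k R r \<beta> i j A M = cnj (Determinant.det (jmat M)) ^ k *
     (dpow A M r $ i $ j * hprod CARD('n) (ptr M) \<beta> + matrix_power M r $ i $ j * dhprod R A M \<beta> -
        of_nat k * Determinants.trace A * (matrix_power M r $ i $ j * hprod CARD('n) (ptr M) \<beta>))"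

lemma haar_ibp_projector:
  fixes H :: "(complex^'n^'n) measure"
  assumes H: "normalized_haar H" and P: "unit_projector P"
    and R: "\<And>a. a < CARD('n) \<Longrightarrow> \<beta> a \<le> int R"
  shows "(\<integral>M. ibp_term k R r \<beta> i j P M \<partial>H) = 0"
proof -
  let ?g = "\<lambda>M. matrix_power M r $ i $ j * hprod CARD('n) (ptr M) \<beta>"
  have "(\<integral>M. cnj (Determinant.det (jmat M)) ^ k *
     ((dpow P M r $ i $ j * hprod CARD('n) (ptr M) \<beta> + dhprod R P M \<beta> * matrix_power M r $ i $ j) -
       of_nat k * ?g M) \<partial>H) = 0"
  proof (rule haar_integration_by_parts[OF H P])
    show "circle_poly (\<lambda>w M. ?g (pencil P w ** M))"
      by (intro circle_poly_mult circle_poly_power_nth circle_poly_hprod)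
    show "continuous_on unitary_group ?g"
      by (intro continuous_on_mult continuous_on_matrix_power_entry continuous_on_hprod_ptr)
    fix M :: "complex^'n^'n"
    from DERIV_mult[OF has_field_derivative_power_pencil[of P M r i j] has_field_derivative_hprod_pencil[of \<beta> R P M, OF R]]
    show "((\<lambda>w. ?g (pencil P w ** M)) has_field_derivative
       (dpow P M r $ i $ j * hprod CARD('n) (ptr M) \<beta> + dhprod R P M \<beta> * matrix_power M r $ i $ j)) (at 1)"
      by simp
  qed auto
  moreover have "Determinants.trace P = 1" using P by (simp add: unit_projector_def)
  ultimately show ?thesis by (simp add: ibp_term_def mult.commute[of "dhprod R P _ \<beta>"])
qed

lemma dpow_add: "dpow (A + B) M r = dpow A M r + dpow B M r"
  by (induction r) (simp_all add: matrix_add_mult matrix_mult_add)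

lemma dpow_smat: "dpow (smat c A) M r = smat c (dpow A M r)"
proof (induction r)
  case 0
  show ?case by (simp add: Finite_Cartesian_Product.vec_eq_iff)
qed (simp add: smat_mult_left smat_mult_right smat_add_right)

lemma dhprod_add: "dhprod R (A + B) M \<beta> = dhprod R A M \<beta> + dhprod R B M \<beta>"
  by (simp add: dhprod_def matrix_add_mult trace_add distrib_right sum.distrib)

lemma dhprod_smat: "dhprod R (smat c A) M \<beta> = c * dhprod R A M \<beta>"
  by (simp add: dhprod_def smat_mult_left trace_smat sum_distrib_left mult.assoc)

lemma ibp_term_add: "ibp_term k R r \<beta> i j (A + B) M = ibp_term k R r \<beta> i j A M + ibp_term k R r \<beta> i j B M"
  by (simp add: ibp_term_def dpow_add dhprod_add trace_add algebra_simps)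

lemma ibp_term_smat: "ibp_term k R r \<beta> i j (smat c A) M = c * ibp_term k R r \<beta> i j A M"
  by (simp add: ibp_term_def dpow_smat dhprod_smat trace_smat algebra_simps)

lemma continuous_on_dpow_nth: "continuous_on A (\<lambda>M :: complex^'n^'n. dpow V M r $ i $ j)"
proof (induction r arbitrary: i j)
  case (Suc r)
  have "continuous_on A (\<lambda>M :: complex^'n^'n. (\<Sum>k\<in>UNIV. V $ i $ k * matrix_power M (Suc r) $ k $ j) +
     (\<Sum>k\<in>UNIV. M $ i $ k * dpow V M r $ k $ j))"
    by (intro continuous_on_add continuous_on_sum continuous_on_mult continuous_on_const
          continuous_on_matrix_power_entry continuous_on_entry Suc)
  thus ?case by (simp add: matrix_matrix_mult_def[of V] matrix_matrix_mult_def[of _ "dpow V _ r"])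
qed simp

lemma continuous_on_trace_mult_power: "continuous_on A (\<lambda>M :: complex^'n^'n. Determinants.trace (V ** matrix_power M s))"
  unfolding trace_def matrix_matrix_mult_def
  by (simp, intro continuous_on_sum continuous_on_mult continuous_on_const continuous_on_matrix_power_entry)

lemma continuous_on_dhprod: "continuous_on A (\<lambda>M :: complex^'n^'n. dhprod R V M \<beta>)"
  unfolding dhprod_def
  by (intro continuous_on_sum continuous_on_mult continuous_on_trace_mult_power continuous_on_hprod_ptr)

lemma continuous_on_ibp_term: "continuous_on A (ibp_term k R r \<beta> i j (V :: complex^'n^'n))"
  unfolding ibp_term_def
  by (intro continuous_on_add continuous_on_diff continuous_on_mult continuous_on_const continuous_on_power continuous_on_cnj
      continuous_on_det_jmat continuous_on_dhprod continuous_on_dpow_nth continuous_on_matrix_power_entry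
      continuous_on_hprod_ptr)

lemma haar_ibp_add:
  fixes H :: "(complex^'n^'n) measure"
  assumes H: "normalized_haar H"
    and "(\<integral>M. ibp_term k R r \<beta> i j A M \<partial>H) = 0" "(\<integral>M. ibp_term k R r \<beta> i j B M \<partial>H) = 0"
  shows "(\<integral>M. ibp_term k R r \<beta> i j (A + B) M \<partial>H) = 0"
  unfolding ibp_term_add using assms
  by (subst Bochner_Integration.integral_add) (auto intro!: haar_integrable H continuous_on_ibp_term)

lemma haar_ibp_smat:
  assumes "(\<integral>M. ibp_term k R r \<beta> i j A M \<partial>H) = 0"
  shows "(\<integral>M. ibp_term k R r \<beta> i j (smat c A) M \<partial>H) = 0"
  unfolding ibp_term_smat using assms by simp

section \<open>From projectors to matrix units\<close>

definition line_projector :: "('n \<Rightarrow> complex) \<Rightarrow> complex^'n^'n" where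
  "line_projector v = (\<chi> a b. v a * cnj (v b) / (\<Sum>c\<in>UNIV. v c * cnj (v c)))"

lemma unit_projector_line:
  assumes "(\<Sum>c\<in>UNIV. v c * cnj (v c)) \<noteq> 0"
  shows "unit_projector (line_projector v)"
proof -
  define s where "s = (\<Sum>c\<in>UNIV. v c * cnj (v c))"
  have s: "s \<noteq> 0" "cnj s = s" using assms by (simp_all add: s_def mult.commute)
  have "(\<Sum>b\<in>UNIV. v a * cnj (v b) / s * (v b * cnj (v c) / s)) = v a * cnj (v c) / s" for a c
  proof -
    have "(\<Sum>b\<in>UNIV. v a * cnj (v b) / s * (v b * cnj (v c) / s)) =
        (\<Sum>b\<in>UNIV. (v a * cnj (v c) / (s * s)) * (v b * cnj (v b)))"
      by (intro sum.cong refl) simp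
    also have "\<dots> = (v a * cnj (v c) / (s * s)) * s"
      by (simp only: sum_distrib_left[symmetric] s_def)
    finally show ?thesis using s by simp
  qed
  note idem = this
  have L: "line_projector v $ a $ b = v a * cnj (v b) / s" for a b
    by (simp add: line_projector_def s_def)
  have "madj (line_projector v) = line_projector v"
    by (simp add: Finite_Cartesian_Product.vec_eq_iff L s mult.commute)
  moreover have "line_projector v ** line_projector v = line_projector v"
    by (simp only: Finite_Cartesian_Product.vec_eq_iff matrix_matrix_mult_def vec_lambda_beta L idem) simp
  moreover have "Determinants.trace (line_projector v) = s / s"
    by (simp only: trace_def L sum_divide_distrib[symmetric] s_def)
  ultimately show ?thesis using s by (simp add: unit_projector_def)
qed

definition munit :: "'n \<Rightarrow> 'n \<Rightarrow> complex^'n^'n" where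
  "munit i j = (\<chi> a b. if a = i \<and> b = j then 1 else 0)"

text \<open>Polarization over the fourth roots of unity.\<close>

lemma munit_polarization:
  fixes i j :: "'n :: finite"
  assumes "i \<noteq> j"
  defines "v \<equiv> (\<lambda>u a. if a = i then 1 else if a = j then u else 0)"
  shows "munit i j = smat (1/2) (line_projector (v 1)) + smat (\<i>/2) (line_projector (v \<i>)) +
           (smat (-1/2) (line_projector (v (-1))) + smat (-\<i>/2) (line_projector (v (-\<i>))))"
    and "u * cnj u = 1 \<Longrightarrow> (\<Sum>c\<in>UNIV. v u c * cnj (v u c)) = 2"
proof -
  have norm: "(\<Sum>c\<in>UNIV. v u c * cnj (v u c)) = 2" if "u * cnj u = 1" for u
  proof -
    have "(\<Sum>c\<in>UNIV. v u c * cnj (v u c)) = (\<Sum>c\<in>UNIV. (if c = i then 1 else 0) + (if c = j then 1 else 0))"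
      using that assms(1) by (intro sum.cong) (auto simp: v_def)
    thus ?thesis by (simp add: sum.distrib)
  qed
  thus "u * cnj u = 1 \<Longrightarrow> (\<Sum>c\<in>UNIV. v u c * cnj (v u c)) = 2" .
  have norms: "(\<Sum>c\<in>UNIV. v 1 c * cnj (v 1 c)) = 2" "(\<Sum>c\<in>UNIV. v \<i> c * cnj (v \<i> c)) = 2"
    "(\<Sum>c\<in>UNIV. v (-1) c * cnj (v (-1) c)) = 2" "(\<Sum>c\<in>UNIV. v (-\<i>) c * cnj (v (-\<i>) c)) = 2"
    by (rule norm; simp)+
  show "munit i j = smat (1/2) (line_projector (v 1)) + smat (\<i>/2) (line_projector (v \<i>)) +
           (smat (-1/2) (line_projector (v (-1))) + smat (-\<i>/2) (line_projector (v (-\<i>))))"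
    unfolding line_projector_def norms munit_def
    using assms(1) by (auto simp: Finite_Cartesian_Product.vec_eq_iff v_def)
qed

text \<open>Off-diagonal matrix units do not generate circles of unitary matrices, but they are
  complex combinations of four line projectors, and the integrated identity is linear in the
  direction.\<close>

lemma haar_ibp_munit:
  fixes H :: "(complex^'n^'n) measure"
  assumes H: "normalized_haar H" and R: "\<And>a. a < CARD('n) \<Longrightarrow> \<beta> a \<le> int R"
  shows "(\<integral>M. ibp_term k R r \<beta> i j (munit i' j') M \<partial>H) = 0"
proof (cases "i' = j'")
  case True
  have s: "(\<Sum>c\<in>UNIV. (if c = i' then 1 else 0) * cnj (if c = i' then 1 else 0)) = (1 :: complex)"
    by (simp add: if_distrib[of "\<lambda>t. t * _"] cong: if_cong)
  have "munit i' j' = line_projector (\<lambda>a. if a = i' then 1 else 0)"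
    unfolding line_projector_def s munit_def using True by (auto simp: Finite_Cartesian_Product.vec_eq_iff)
  moreover have "unit_projector (line_projector (\<lambda>a. if a = i' then 1 else 0))"
    by (rule unit_projector_line) (simp only: s, simp)
  ultimately show ?thesis using haar_ibp_projector[OF H _ R] by simp
next
  case False
  have P: "unit_projector (line_projector (\<lambda>a. if a = i' then 1 else if a = j' then u else 0))"
    if "u * cnj u = 1" for u
    by (rule unit_projector_line) (simp only: munit_polarization(2)[OF False that], simp)
  show ?thesis
    unfolding munit_polarization(1)[OF False]
    by (intro haar_ibp_add[OF H] haar_ibp_smat haar_ibp_projector[OF H P R]) simp_all
qed

lemma munit_mult_nth: "(X ** munit i j) $ a $ b = (if b = j then X $ a $ i else 0)"
  by (simp add: matrix_matrix_mult_def munit_def if_distrib[of "\<lambda>t. _ * t"] cong: if_cong)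

lemma trace_munit_mult: "Determinants.trace (munit i j ** X) = X $ j $ i"
proof -
  have "Determinants.trace (munit i j ** X) = Determinants.trace (X ** munit i j)" by (rule trace_mul_sym)
  thus ?thesis by (simp add: trace_def munit_mult_nth)
qed

text \<open>Every occurrence of a matrix unit cuts the word into two pieces. Summing the (i, j)
  entries over all i and j closes each piece to a trace, so a single power splits into products of
  two power traces.\<close>

lemma sum_power_dpow_munit:
  "(\<Sum>i\<in>UNIV. \<Sum>j\<in>UNIV. (matrix_power M s ** dpow (munit i j) M r) $ i $ j) =
     (\<Sum>c<r. ptr M (c + s) * ptr M (r - c))"
proof (induction r arbitrary: s)
  case 0
  have "(matrix_power M s ** (0 :: complex^'a^'a)) = 0"
    by (simp add: matrix_matrix_mult_def Finite_Cartesian_Product.vec_eq_iff)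
  thus ?case by simp
next
  case (Suc r)
  have 1: "(matrix_power M s ** (munit i j ** matrix_power M (Suc r))) $ i $ j =
      matrix_power M s $ i $ i * matrix_power M (Suc r) $ j $ j" for i j
  proof -
    have "(matrix_power M s ** (munit i j ** matrix_power M (Suc r))) $ i $ j =
        (\<Sum>k\<in>UNIV. (if k = j then matrix_power M s $ i $ i else 0) * matrix_power M (Suc r) $ k $ j)"
      unfolding matrix_mul_assoc
      by (subst matrix_matrix_mult_def) (simp add: munit_mult_nth)
    thus ?thesis by (simp add: if_distrib[of "\<lambda>t. t * _"] cong: if_cong)
  qed
  have 2: "matrix_power M s ** (M ** X) = matrix_power M (Suc s) ** X" for X
    by (simp only: matrix_mul_assoc matrix_power_Suc_right)
  have "(\<Sum>i\<in>UNIV. \<Sum>j\<in>UNIV. (matrix_power M s ** dpow (munit i j) M (Suc r)) $ i $ j) =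
     (\<Sum>i\<in>UNIV. \<Sum>j\<in>UNIV. matrix_power M s $ i $ i * matrix_power M (Suc r) $ j $ j) +
     (\<Sum>i\<in>UNIV. \<Sum>j\<in>UNIV. (matrix_power M (Suc s) ** dpow (munit i j) M r) $ i $ j)"
    by (simp only: dpow.simps matrix_mult_add vector_add_component sum.distrib 1 2)
  also have "\<dots> = ptr M s * ptr M (Suc r) + (\<Sum>c<r. ptr M (c + Suc s) * ptr M (r - c))"
    unfolding Suc ptr_def trace_def sum_product ..
  also have "\<dots> = (\<Sum>c<Suc r. ptr M (c + s) * ptr M (Suc r - c))"
    by (subst sum.lessThan_Suc_shift) simp
  finally show ?case .
qed

text \<open>Integration by parts for the (i, j) entry of the r-th power times \<open>hprod\<close>
  in the direction of the (i, j) matrix unit, summed over i and j. The derivative of the power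
  splits traces, the derivative of \<open>hprod\<close> merges r and s into r + s, and the
  determinant contributes the last term.\<close>

lemma haar_loop_equation:
  fixes H :: "(complex^'n^'n) measure"
  assumes H: "normalized_haar H" and R: "\<And>a. a < CARD('n) \<Longrightarrow> \<beta> a \<le> int R"
  shows "(\<integral>M. cnj (Determinant.det (jmat M)) ^ k *
     ((\<Sum>c<r. ptr M c * ptr M (r - c)) * hprod CARD('n) (ptr M) \<beta> +
      (\<Sum>a<CARD('n). \<Sum>s=1..R. ptr M (r + s) * hprod CARD('n) (ptr M) (lower \<beta> a s)) -
      of_nat k * ptr M r * hprod CARD('n) (ptr M) \<beta>) \<partial>H) = 0"
proof -
  let ?h = "\<lambda>M \<beta>. hprod CARD('n) (ptr M) \<beta>"
  have "(\<Sum>i\<in>UNIV. \<Sum>j\<in>UNIV. ibp_term k R r \<beta> i j (munit i j) M) =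
     cnj (Determinant.det (jmat M)) ^ k *
     ((\<Sum>c<r. ptr M c * ptr M (r - c)) * ?h M \<beta> +
      (\<Sum>a<CARD('n). \<Sum>s=1..R. ptr M (r + s) * ?h M (lower \<beta> a s)) -
      of_nat k * ptr M r * ?h M \<beta>)" for M :: "complex^'n^'n"
  proof -
    have d: "(\<Sum>i\<in>UNIV. \<Sum>j\<in>UNIV. dpow (munit i j) M r $ i $ j) = (\<Sum>c<r. ptr M c * ptr M (r - c))"
      using sum_power_dpow_munit[of M 0 r] by simp
    have p: "(\<Sum>i\<in>UNIV. \<Sum>j\<in>UNIV. matrix_power M r $ i $ j * matrix_power M s $ j $ i) = ptr M (r + s)" for s
      by (simp add: ptr_def trace_def matrix_power_add matrix_matrix_mult_def[of "matrix_power M r"])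
    have t: "(\<Sum>i\<in>UNIV. \<Sum>j\<in>UNIV. Determinants.trace (munit i j :: complex^'n^'n) * matrix_power M r $ i $ j) = ptr M r"
    proof -
      have "Determinants.trace (munit i j :: complex^'n^'n) = (if i = j then 1 else 0)" for i j :: 'n
        using trace_munit_mult[of i j "Finite_Cartesian_Product.mat 1"]
        by (simp only: matrix_mul_rid) (auto simp: Finite_Cartesian_Product.mat_def)
      thus ?thesis by (simp add: ptr_def trace_def if_distrib[of "\<lambda>t. t * _"] cong: if_cong)
    qed
    have e: "(\<Sum>i\<in>UNIV. \<Sum>j\<in>UNIV. matrix_power M r $ i $ j * dhprod R (munit i j) M \<beta>) =
       (\<Sum>a<CARD('n). \<Sum>s=1..R. ptr M (r + s) * ?h M (lower \<beta> a s))"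
    proof -
      have "(\<Sum>i\<in>UNIV. \<Sum>j\<in>UNIV. matrix_power M r $ i $ j * dhprod R (munit i j) M \<beta>) =
         (\<Sum>i\<in>UNIV. \<Sum>a<CARD('n). \<Sum>s=1..R. \<Sum>j\<in>UNIV.
            matrix_power M r $ i $ j * matrix_power M s $ j $ i * ?h M (lower \<beta> a s))"
        unfolding dhprod_def trace_munit_mult sum_distrib_left
        by (intro sum.cong refl, subst sum_rotate) (simp add: mult.assoc)
      also have "\<dots> = (\<Sum>a<CARD('n). \<Sum>s=1..R. \<Sum>i\<in>UNIV. \<Sum>j\<in>UNIV.
            matrix_power M r $ i $ j * matrix_power M s $ j $ i * ?h M (lower \<beta> a s))"
        by (rule sum_rotate)
      finally show ?thesis by (simp only: sum_distrib_right[symmetric] p)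
    qed
    have "(\<Sum>i\<in>UNIV. \<Sum>j\<in>UNIV. ibp_term k R r \<beta> i j (munit i j) M) =
       cnj (Determinant.det (jmat M)) ^ k *
       ((\<Sum>i\<in>UNIV. \<Sum>j\<in>UNIV. dpow (munit i j) M r $ i $ j) * ?h M \<beta> +
        (\<Sum>i\<in>UNIV. \<Sum>j\<in>UNIV. matrix_power M r $ i $ j * dhprod R (munit i j) M \<beta>) -
        of_nat k * (\<Sum>i\<in>UNIV. \<Sum>j\<in>UNIV. Determinants.trace (munit i j :: complex^'n^'n) * matrix_power M r $ i $ j) * ?h M \<beta>)"
      unfolding ibp_term_def sum_distrib_left[symmetric] sum.distrib sum_subtractf
      by (simp add: sum_distrib_left sum_distrib_right mult.assoc)
    thus ?thesis unfolding d e t .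
  qed
  hence "(\<integral>M. cnj (Determinant.det (jmat M)) ^ k *
     ((\<Sum>c<r. ptr M c * ptr M (r - c)) * ?h M \<beta> +
      (\<Sum>a<CARD('n). \<Sum>s=1..R. ptr M (r + s) * ?h M (lower \<beta> a s)) -
      of_nat k * ptr M r * ?h M \<beta>) \<partial>H) =
     (\<integral>M. (\<Sum>i\<in>UNIV. \<Sum>j\<in>UNIV. ibp_term k R r \<beta> i j (munit i j) M) \<partial>H)" by simp
  also have "\<dots> = (\<Sum>i\<in>UNIV. \<integral>M. (\<Sum>j\<in>UNIV. ibp_term k R r \<beta> i j (munit i j) M) \<partial>H)"
    by (intro Bochner_Integration.integral_sum haar_integrable H continuous_on_sum continuous_on_ibp_term)
  also have "\<dots> = (\<Sum>i\<in>UNIV. \<Sum>j\<in>UNIV. \<integral>M. ibp_term k R r \<beta> i j (munit i j) M \<partial>H)"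
    by (intro sum.cong refl Bochner_Integration.integral_sum haar_integrable H continuous_on_ibp_term)
  also have "\<dots> = 0" by (simp add: haar_ibp_munit[OF H R])
  finally show ?thesis .
qed

section \<open>Haar integrals of Schur functions\<close>

lemma sum_mult_hprod_lower:
  assumes "a < n" "\<beta> a \<le> int R"
  shows "(\<Sum>r=1..R. p r * hprod n p (lower \<beta> a r)) = of_int (\<beta> a) * hprod n p \<beta>"
proof -
  have "(\<Sum>r=1..R. p r * hprod n p (lower \<beta> a r)) =
     (\<Sum>r=1..R. p r * hsym p (\<beta> a - int r)) * (\<Prod>b\<in>{..<n} - {a}. hsym p (\<beta> b))"
    by (simp add: hprod_lower[OF assms(1)] sum_distrib_right mult.assoc)
  thus ?thesis
    by (simp only: hsym_newton[OF assms(2), symmetric] hprod_remove[OF assms(1), of p \<beta>] mult.assoc)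
qed

lemma lower_le: "(\<And>a. a < n \<Longrightarrow> \<beta> a \<le> int R) \<Longrightarrow> b < n \<Longrightarrow> lower \<beta> a r b \<le> int R"
  by (force simp: lower_def)

lemma continuous_on_casimir: "continuous_on A (\<lambda>M :: complex^'n^'n. casimir n R (ptr M) \<beta>)"
  unfolding casimir_def
  by (intro continuous_on_sum continuous_on_add continuous_on_mult continuous_on_ptr continuous_on_hprod_ptr)

lemma continuous_on_cnj_det_power:
  "continuous_on A (\<lambda>M :: complex^'n^'n. cnj (Determinant.det (jmat M)) ^ k)"
  by (intro continuous_on_power continuous_on_cnj continuous_on_det_jmat)

text \<open>Sum the loop equations for all indices lowered by r in one place. Splitting and merging
  terms add up to the Casimir operator; the twist terms add up, by Newton's identity in each factor,
  to k times the degree.\<close>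

lemma haar_integral_casimir:
  fixes H :: "(complex^'n^'n) measure"
  assumes H: "normalized_haar H" and R: "\<And>a. a < CARD('n) \<Longrightarrow> \<beta> a \<le> int R"
  shows "(\<integral>M. cnj (Determinant.det (jmat M)) ^ k * casimir CARD('n) R (ptr M) \<beta> \<partial>H) =
     of_nat k * (\<Sum>a<CARD('n). of_int (\<beta> a)) *
       (\<integral>M. cnj (Determinant.det (jmat M)) ^ k * hprod CARD('n) (ptr M) \<beta> \<partial>H)"
proof -
  let ?n = "CARD('n)"
  let ?c = "\<lambda>M :: complex^'n^'n. cnj (Determinant.det (jmat M)) ^ k"
  let ?X = "\<lambda>(M :: complex^'n^'n) a r. (\<Sum>c<r. ptr M c * ptr M (r - c)) * hprod ?n (ptr M) (lower \<beta> a r) +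
      (\<Sum>b<?n. \<Sum>s=1..R. ptr M (r + s) * hprod ?n (ptr M) (lower (lower \<beta> a r) b s))"
  let ?Y = "\<lambda>(M :: complex^'n^'n) a r. of_nat k * ptr M r * hprod ?n (ptr M) (lower \<beta> a r)"
  have term_0: "(\<integral>M. ?c M * (?X M a r - ?Y M a r) \<partial>H) = 0" for a r
    by (rule haar_loop_equation[OF H lower_le[OF R]])
  have cont: "continuous_on unitary_group (\<lambda>M. ?c M * (?X M a r - ?Y M a r))" for a r
    by (intro continuous_on_mult continuous_on_diff continuous_on_add continuous_on_sum continuous_on_cnj_det_power
        continuous_on_ptr continuous_on_hprod_ptr continuous_on_const)
  have "0 = (\<Sum>a<?n. \<Sum>r=1..R. (\<integral>M. ?c M * (?X M a r - ?Y M a r) \<partial>H))"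
    by (simp only: term_0 sum.neutral_const)
  also have "\<dots> = (\<Sum>a<?n. (\<integral>M. (\<Sum>r=1..R. ?c M * (?X M a r - ?Y M a r)) \<partial>H))"
    by (intro sum.cong refl Bochner_Integration.integral_sum[symmetric] haar_integrable H cont)
  also have "\<dots> = (\<integral>M. (\<Sum>a<?n. \<Sum>r=1..R. ?c M * (?X M a r - ?Y M a r)) \<partial>H)"
    by (intro Bochner_Integration.integral_sum[symmetric] haar_integrable H continuous_on_sum cont)
  also have "\<dots> = (\<integral>M. ?c M * casimir ?n R (ptr M) \<beta> -
      of_nat k * (\<Sum>a<?n. of_int (\<beta> a)) * (?c M * hprod ?n (ptr M) \<beta>) \<partial>H)"
  proof (rule Bochner_Integration.integral_cong[OF refl])
    fix M :: "complex^'n^'n"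
    have "(\<Sum>r=1..R. ?Y M a r) = of_nat k * (of_int (\<beta> a) * hprod ?n (ptr M) \<beta>)" if "a < ?n" for a
      using sum_mult_hprod_lower[of a ?n \<beta> R "ptr M"] that R[OF that]
      by (simp only: mult.assoc sum_distrib_left[symmetric])
    hence Y: "(\<Sum>a<?n. \<Sum>r=1..R. ?Y M a r) = of_nat k * (\<Sum>a<?n. of_int (\<beta> a)) * hprod ?n (ptr M) \<beta>"
      by (simp add: sum_distrib_left sum_distrib_right mult.assoc)
    have "(\<Sum>a<?n. \<Sum>r=1..R. ?c M * (?X M a r - ?Y M a r)) =
        ?c M * ((\<Sum>a<?n. \<Sum>r=1..R. ?X M a r) - (\<Sum>a<?n. \<Sum>r=1..R. ?Y M a r))"
      by (simp only: sum_distrib_left sum_subtractf right_diff_distrib)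
    thus "(\<Sum>a<?n. \<Sum>r=1..R. ?c M * (?X M a r - ?Y M a r)) =
        ?c M * casimir ?n R (ptr M) \<beta> - of_nat k * (\<Sum>a<?n. of_int (\<beta> a)) * (?c M * hprod ?n (ptr M) \<beta>)"
      unfolding Y casimir_def by (simp only: right_diff_distrib mult_ac)
  qed
  also have "\<dots> = (\<integral>M. ?c M * casimir ?n R (ptr M) \<beta> \<partial>H) -
      of_nat k * (\<Sum>a<?n. of_int (\<beta> a)) * (\<integral>M. ?c M * hprod ?n (ptr M) \<beta> \<partial>H)"
    by (subst Bochner_Integration.integral_diff)
       (auto intro!: integrable_mult_right haar_integrable H continuous_on_mult continuous_on_cnj_det_power
          continuous_on_casimir continuous_on_hprod_ptr)
  finally show ?thesis by simp
qed

text \<open>The loop equation with r = 0, which is the derivative in the direction of scalar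
  matrices: the integral can be nonzero only if the degree of the product equals that of the k-th
  power of the determinant.\<close>

lemma haar_integral_euler:
  fixes H :: "(complex^'n^'n) measure"
  assumes H: "normalized_haar H" and R: "\<And>a. a < CARD('n) \<Longrightarrow> \<beta> a \<le> int R"
  shows "((\<Sum>a<CARD('n). of_int (\<beta> a)) - of_nat k * of_nat CARD('n)) *
       (\<integral>M. cnj (Determinant.det (jmat M)) ^ k * hprod CARD('n) (ptr M) \<beta> \<partial>H) = 0"
proof -
  let ?n = "CARD('n)"
  let ?E = "(\<Sum>a<?n. of_int (\<beta> a)) - of_nat k * of_nat ?n :: complex"
  have "?E * (\<integral>M. cnj (Determinant.det (jmat M)) ^ k * hprod ?n (ptr M) \<beta> \<partial>H) =
     (\<integral>M. cnj (Determinant.det (jmat M)) ^ k *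
     ((\<Sum>c<0. ptr M c * ptr M (0 - c)) * hprod CARD('n) (ptr M) \<beta> +
      (\<Sum>a<CARD('n). \<Sum>s=1..R. ptr M (0 + s) * hprod CARD('n) (ptr M) (lower \<beta> a s)) -
      of_nat k * ptr M 0 * hprod CARD('n) (ptr M) \<beta>) \<partial>H)"
    unfolding integral_mult_right_zero[symmetric]
  proof (rule Bochner_Integration.integral_cong[OF refl])
    fix M :: "complex^'n^'n"
    have "(\<Sum>a<?n. \<Sum>s=1..R. ptr M (0 + s) * hprod ?n (ptr M) (lower \<beta> a s)) =
       (\<Sum>a<?n. of_int (\<beta> a)) * hprod ?n (ptr M) \<beta>"
      using sum_mult_hprod_lower[of _ ?n \<beta> R "ptr M"] R by (simp add: sum_distrib_right)
    thus "?E * (cnj (Determinant.det (jmat M)) ^ k * hprod ?n (ptr M) \<beta>) =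
      cnj (Determinant.det (jmat M)) ^ k *
     ((\<Sum>c<0. ptr M c * ptr M (0 - c)) * hprod CARD('n) (ptr M) \<beta> +
      (\<Sum>a<CARD('n). \<Sum>s=1..R. ptr M (0 + s) * hprod CARD('n) (ptr M) (lower \<beta> a s)) -
      of_nat k * ptr M 0 * hprod CARD('n) (ptr M) \<beta>)"
      by (simp only:) (simp add: algebra_simps)
  qed
  also have "\<dots> = 0" by (rule haar_loop_equation[OF H R])
  finally show ?thesis .
qed

lemma haar_integral_jdet_eq_sum:
  fixes H :: "(complex^'n^'n) measure"
  assumes H: "normalized_haar H"
  shows "(\<integral>M. cnj (Determinant.det (jmat M)) ^ k * jdet CARD('n) (ptr M) g \<partial>H) =
     (\<Sum>\<sigma> | \<sigma> permutes {..<CARD('n)}. of_int (sign \<sigma>) *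
        (\<integral>M. cnj (Determinant.det (jmat M)) ^ k * hprod CARD('n) (ptr M) (\<lambda>i. g i - staircase CARD('n) (\<sigma> i)) \<partial>H))"
proof -
  have "(\<integral>M. cnj (Determinant.det (jmat M)) ^ k * jdet CARD('n) (ptr M) g \<partial>H) =
     (\<integral>M. (\<Sum>\<sigma> | \<sigma> permutes {..<CARD('n)}. of_int (sign \<sigma>) *
        (cnj (Determinant.det (jmat M)) ^ k * hprod CARD('n) (ptr M) (\<lambda>i. g i - staircase CARD('n) (\<sigma> i)))) \<partial>H)"
    by (simp add: jdet_eq_sum_hprod sum_distrib_left mult.left_commute)
  also have "\<dots> = (\<Sum>\<sigma> | \<sigma> permutes {..<CARD('n)}. (\<integral>M. of_int (sign \<sigma>) *
        (cnj (Determinant.det (jmat M)) ^ k * hprod CARD('n) (ptr M) (\<lambda>i. g i - staircase CARD('n) (\<sigma> i))) \<partial>H))"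
    by (intro Bochner_Integration.integral_sum integrable_mult_right haar_integrable H
          continuous_on_mult continuous_on_cnj_det_power continuous_on_hprod_ptr)
  finally show ?thesis by simp
qed

text \<open>
  A Schur function other than a power of the determinant is an eigenfunction of the Casimir
  operator (twisted by the power of the determinant) with nonzero eigenvalue, while images of
  the Casimir operator integrate to zero.
\<close>

lemma haar_integral_jdet:
  fixes H :: "(complex^'n^'n) measure"
  assumes H: "normalized_haar H"
    and dec: "\<And>i j. i < j \<Longrightarrow> j < CARD('n) \<Longrightarrow> g j < g i" and nonneg: "\<And>i. i < CARD('n) \<Longrightarrow> 0 \<le> g i"
  shows "(\<integral>M. cnj (Determinant.det (jmat M)) ^ k * jdet CARD('n) (ptr M) g \<partial>H) =
     (if \<forall>i<CARD('n). g i = staircase CARD('n) i + int k then 1 else 0)"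
proof -
  let ?n = "CARD('n)"
  let ?c = "\<lambda>M :: complex^'n^'n. cnj (Determinant.det (jmat M)) ^ k"
  interpret prob_space H by (rule haar_prob_space[OF H])
  have n: "?n > 0" by simp
  define L where "L = (\<integral>M. ?c M * jdet ?n (ptr M) g \<partial>H)"
  show ?thesis
  proof (cases "\<forall>i<?n. g i = staircase ?n i + int k")
    case True
    \<comment> \<open>The Schur function is here the k-th power of the product of the eigenvalues, a
      number of modulus 1, so the integrand is identically 1.\<close>
    have "(\<integral>M. ?c M * jdet ?n (ptr M) g \<partial>H) = (\<integral>M. 1 \<partial>H)"
    proof (rule Bochner_Integration.integral_cong[OF refl])
      fix M assume "M \<in> space H"
      hence "M \<in> unitary_group" by (simp add: haar_space[OF H])
      then obtain x where x: "x \<in> torus ?n" "ptr M = psum ?n x" "Determinant.det (jmat M) = (\<Prod>i<?n. x i)"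
        by (rule unitary_spectrum)
      have "jdet ?n (ptr M) g = (\<Prod>i<?n. x i) ^ k"
        unfolding x(2) jdet_staircase_shift[OF x(1), symmetric] using True by (intro jdet_cong) auto
      moreover have "cmod (\<Prod>i<?n. x i) = 1" using x(1) by (simp add: torus_def prod_norm[symmetric])
      hence "cnj (\<Prod>i<?n. x i) * (\<Prod>i<?n. x i) = 1"
        using complex_norm_square[of "\<Prod>i<?n. x i"] by (simp add: mult.commute)
      ultimately show "?c M * jdet ?n (ptr M) g = 1"
        by (simp only: x(3) power_mult_distrib[symmetric] power_one)
    qed
    thus ?thesis using True prob_space by simp
  next
    case False
    \<comment> \<open>Any common bound for the entries works as cutoff; as the entries are
      nonnegative, their sum is one.\<close>
    define R where "R = nat (\<Sum>i<?n. g i)"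
    have gR: "g i \<le> int R" if "i < ?n" for i
    proof -
      have "g i \<le> (\<Sum>i<?n. g i)" using nonneg that by (intro member_le_sum) auto
      thus ?thesis by (simp add: R_def)
    qed
    let ?b = "\<lambda>\<sigma> i. g i - staircase ?n (\<sigma> i)"
    let ?P = "{\<sigma>. \<sigma> permutes {..<?n}}"
    have bR: "?b \<sigma> a \<le> int R" if "\<sigma> \<in> ?P" "a < ?n" for \<sigma> a
      using gR[OF that(2)] permutes_in_image[of \<sigma> "{..<?n}" a] that by (simp add: staircase_def)
    define E where "E = (\<Sum>i<?n. g i) - (\<Sum>i<?n. staircase ?n i)"
    have sumb: "(\<Sum>a<?n. of_int (?b \<sigma> a)) = (of_int E :: complex)" if "\<sigma> \<in> ?P" for \<sigma>
      using sum_staircase_permute[of \<sigma> ?n "of_int :: int \<Rightarrow> complex"] that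
      by (simp add: E_def sum_subtractf)
    have "(of_int E - of_nat k * of_nat ?n) * L =
        (\<Sum>\<sigma>\<in>?P. of_int (sign \<sigma>) * ((of_int E - of_nat k * of_nat ?n) * (\<integral>M. ?c M * hprod ?n (ptr M) (?b \<sigma>) \<partial>H)))"
      unfolding L_def haar_integral_jdet_eq_sum[OF H] by (simp add: sum_distrib_left mult.left_commute)
    also have "\<dots> = 0"
    proof (rule sum.neutral, rule ballI)
      fix \<sigma> assume s: "\<sigma> \<in> ?P"
      have "((\<Sum>a<?n. of_int (?b \<sigma> a)) - of_nat k * of_nat ?n) * (\<integral>M. ?c M * hprod ?n (ptr M) (?b \<sigma>) \<partial>H) = 0"
        by (rule haar_integral_euler[OF H bR[OF s]])
      thus "of_int (sign \<sigma>) * ((of_int E - of_nat k * of_nat ?n) * (\<integral>M. ?c M * hprod ?n (ptr M) (?b \<sigma>) \<partial>H)) = 0"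
        unfolding sumb[OF s] by simp
    qed
    finally have euler: "(of_int E - of_nat k * of_nat ?n) * L = 0" .
    have "of_int (casimir_ev ?n g) * L = (\<integral>M. ?c M * (of_int (casimir_ev ?n g) * jdet ?n (ptr M) g) \<partial>H)"
      by (simp add: L_def mult.left_commute)
    also have "\<dots> = (\<integral>M. (\<Sum>\<sigma>\<in>?P. of_int (sign \<sigma>) * (?c M * casimir ?n R (ptr M) (?b \<sigma>))) \<partial>H)"
    proof (rule Bochner_Integration.integral_cong[OF refl])
      fix M assume "M \<in> space H"
      hence "M \<in> unitary_group" by (simp add: haar_space[OF H])
      then obtain x where x: "x \<in> torus ?n" "ptr M = psum ?n x" "Determinant.det (jmat M) = (\<Prod>i<?n. x i)"
        by (rule unitary_spectrum)
      have "(\<Sum>\<sigma>\<in>?P. of_int (sign \<sigma>) * casimir ?n R (ptr M) (?b \<sigma>)) =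
          of_int (casimir_ev ?n g) * jdet ?n (ptr M) g"
        unfolding x(2) by (rule casimir_jdet) (use nonneg gR x in auto)
      from this[symmetric] show "?c M * (of_int (casimir_ev ?n g) * jdet ?n (ptr M) g) =
         (\<Sum>\<sigma>\<in>?P. of_int (sign \<sigma>) * (?c M * casimir ?n R (ptr M) (?b \<sigma>)))"
        by (simp only: sum_distrib_left mult.left_commute)
    qed
    also have "\<dots> = (\<Sum>\<sigma>\<in>?P. (\<integral>M. of_int (sign \<sigma>) * (?c M * casimir ?n R (ptr M) (?b \<sigma>)) \<partial>H))"
      by (intro Bochner_Integration.integral_sum integrable_mult_right haar_integrable H
          continuous_on_mult continuous_on_cnj_det_power continuous_on_casimir)
    also have "\<dots> = (\<Sum>\<sigma>\<in>?P. of_nat k * of_int E * (of_int (sign \<sigma>) * (\<integral>M. ?c M * hprod ?n (ptr M) (?b \<sigma>) \<partial>H)))"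
    proof (rule sum.cong)
      fix \<sigma> assume s: "\<sigma> \<in> ?P"
      have "(\<integral>M. ?c M * casimir ?n R (ptr M) (?b \<sigma>) \<partial>H) =
         of_nat k * (\<Sum>a<?n. of_int (?b \<sigma> a)) * (\<integral>M. ?c M * hprod ?n (ptr M) (?b \<sigma>) \<partial>H)"
        by (rule haar_integral_casimir[OF H bR[OF s]])
      thus "(\<integral>M. of_int (sign \<sigma>) * (?c M * casimir ?n R (ptr M) (?b \<sigma>)) \<partial>H) =
         of_nat k * of_int E * (of_int (sign \<sigma>) * (\<integral>M. ?c M * hprod ?n (ptr M) (?b \<sigma>) \<partial>H))"
        unfolding sumb[OF s] by simp
    qed simp
    also have "\<dots> = of_nat k * of_int E * L"
      unfolding L_def haar_integral_jdet_eq_sum[OF H] by (rule sum_distrib_left[symmetric])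
    finally have cas: "of_int (casimir_ev ?n g) * L = of_nat k * of_int E * L" .
    \<comment> \<open>A nonzero integral would force the degree E = k n by the Euler relation and
      \<open>casimir_ev\<close> = k E by the Casimir relation, which \<open>casimir_ev_pos\<close>
      excludes.\<close>
    have "L = 0"
    proof (rule ccontr)
      assume L: "L \<noteq> 0"
      have "(of_int E :: complex) = of_int (int k * int ?n)" using euler L by simp
      hence E: "E = int k * int ?n" by (simp only: of_int_eq_iff)
      have "(of_int (casimir_ev ?n g) :: complex) = of_int (int k * E)" using cas L by simp
      hence ev: "casimir_ev ?n g = int k * E" by (simp only: of_int_eq_iff)
      have "casimir_ev ?n g \<noteq> int k * E"
        unfolding E_def using False E
        by (intro casimir_ev_pos dec) (auto simp: E_def algebra_simps)
      with ev show False by simp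
    qed
    thus ?thesis using False by (auto simp: L_def)
  qed
qed

section \<open>Sorting exponents and coefficients of alternants\<close>

text \<open>The coefficient of the monomial with exponents w in the alternant with exponents
  g.\<close>

definition alt_coeff :: "nat \<Rightarrow> (nat \<Rightarrow> int) \<Rightarrow> (nat \<Rightarrow> int) \<Rightarrow> complex" where
  "alt_coeff n g w = (\<Sum>\<sigma> | \<sigma> permutes {..<n}. of_int (sign \<sigma>) * (if \<forall>i<n. g i = w (\<sigma> i) then 1 else 0))"

lemma alt_coeff_permute:
  assumes t: "\<tau> permutes {..<n}"
  shows "alt_coeff n (g \<circ> \<tau>) w = of_int (sign \<tau>) * alt_coeff n g w"
proof -
  have "(\<forall>i<n. (g \<circ> \<tau>) i = w ((\<sigma> \<circ> \<tau>) i)) \<longleftrightarrow> (\<forall>i<n. g i = w (\<sigma> i))" for \<sigma>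
  proof -
    have "(\<forall>i\<in>{..<n}. g (\<tau> i) = w (\<sigma> (\<tau> i))) \<longleftrightarrow> (\<forall>i\<in>\<tau> ` {..<n}. g i = w (\<sigma> i))" by blast
    thus ?thesis by (simp add: permutes_image[OF t] Ball_def)
  qed
  hence "alt_coeff n (g \<circ> \<tau>) w = (\<Sum>\<sigma> | \<sigma> permutes {..<n}. of_int (sign (\<sigma> \<circ> \<tau>)) * (if \<forall>i<n. g i = w (\<sigma> i) then 1 else 0))"
    unfolding alt_coeff_def by (subst sum_permutations_compose_right[OF t]) (simp only:)
  thus ?thesis
    unfolding alt_coeff_def sum_distrib_left
    by (simp add: sign_compose_lessThan[OF _ t] mult_ac)
qed

lemma alt_coeff_repeated:
  assumes "i < n" "j < n" "i \<noteq> j" "g i = g j"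
  shows "alt_coeff n g w = 0"
proof -
  obtain \<tau> where "\<tau> permutes {..<n}" "g \<circ> \<tau> = g" "sign \<tau> = -1"
    using repeated_entry_swap[OF assms] by blast
  with alt_coeff_permute[of \<tau> n g w] show ?thesis by simp
qed

text \<open>Strict growth gives i <= \<sigma> i for all i < n, and both sides have the same
  sum.\<close>

lemma increasing_permutation_id:
  fixes n :: nat
  assumes s: "\<sigma> permutes {..<n}" and inc: "\<And>i j. i < j \<Longrightarrow> j < n \<Longrightarrow> \<sigma> i < \<sigma> j"
  shows "\<sigma> = id"
proof -
  have ge: "i \<le> \<sigma> i" if "i < n" for i
    using that
  proof (induction i)
    case (Suc i)
    thus ?case using inc[of i "Suc i"] by simp
  qed simp
  have "(\<Sum>i<n. i) = (\<Sum>i<n. \<sigma> i)"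
    using sum.reindex_bij_betw[OF permutes_imp_bij[OF s], of "\<lambda>i. i"] by simp
  hence "i < n \<Longrightarrow> i = \<sigma> i" for i
    using sum_mono_inv[of "\<lambda>i. i" "{..<n}" \<sigma> i] ge by simp
  thus ?thesis using permutes_not_in[OF s] by (metis eq_id_iff lessThan_iff)
qed

lemma alt_coeff_decreasing:
  assumes g: "\<And>i j. i < j \<Longrightarrow> j < n \<Longrightarrow> g j < g i" and w: "\<And>i j. i < j \<Longrightarrow> j < n \<Longrightarrow> w j < w i"
  shows "alt_coeff n g w = (if \<forall>i<n. g i = w i then 1 else 0)"
proof -
  have only_id: "\<sigma> = id" if s: "\<sigma> permutes {..<n}" and eq: "\<forall>i<n. g i = w (\<sigma> i)" for \<sigma>
  proof (rule increasing_permutation_id[OF s])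
    fix i j assume ij: "i < j" "j < n"
    have lt: "\<sigma> i < n" "\<sigma> j < n" using permutes_in_image[OF s] ij by auto
    have "w (\<sigma> j) < w (\<sigma> i)" using g[OF ij] eq ij by auto
    thus "\<sigma> i < \<sigma> j" using w[of "\<sigma> j" "\<sigma> i"] lt by (cases "\<sigma> i" "\<sigma> j" rule: linorder_cases) auto
  qed
  have "alt_coeff n g w = (\<Sum>\<sigma>\<in>{id}. of_int (sign \<sigma>) * (if \<forall>i<n. g i = w (\<sigma> i) then 1 else 0))"
    unfolding alt_coeff_def
    by (rule sum.mono_neutral_right) (auto simp: permutes_id dest: only_id)
  thus ?thesis by simp
qed

lemma decreasing_rearrangement:
  fixes g :: "nat \<Rightarrow> int"
  assumes inj: "inj_on g {..<n}"
  obtains \<tau> where "\<tau> permutes {..<n}" "\<And>i j. i < j \<Longrightarrow> j < n \<Longrightarrow> (g \<circ> \<tau>) j < (g \<circ> \<tau>) i"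
proof -
  define l where "l = rev (sorted_list_of_set (g ` {..<n}))"
  have len: "length l = n" using card_image[OF inj] by (simp add: l_def)
  have dec: "l ! j < l ! i" if "i < j" "j < n" for i j
  proof -
    have "sorted_wrt (<) (sorted_list_of_set (g ` {..<n}))" by simp
    hence "sorted_wrt (\<lambda>x y. y < x) l" unfolding l_def sorted_wrt_rev .
    thus ?thesis using that len by (auto simp: sorted_wrt_iff_nth_less)
  qed
  have setl: "set l = g ` {..<n}" by (simp add: l_def)
  define \<tau> where "\<tau> = (\<lambda>i. if i < n then inv_into {..<n} g (l ! i) else i)"
  have mem: "l ! i \<in> g ` {..<n}" if "i < n" for i using that len setl nth_mem[of i l] by simp
  have gt: "g (\<tau> i) = l ! i" if "i < n" for i
    using that f_inv_into_f[OF mem[OF that]] by (simp add: \<tau>_def)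
  have t: "\<tau> permutes {..<n}"
  proof (rule bij_imp_permutes)
    have "inj_on \<tau> {..<n}"
    proof (rule inj_onI)
      fix i j assume "i \<in> {..<n}" "j \<in> {..<n}" "\<tau> i = \<tau> j"
      hence "l ! i = l ! j" using gt by (metis lessThan_iff)
      thus "i = j" using dec \<open>i \<in> _\<close> \<open>j \<in> _\<close> by (cases i j rule: linorder_cases) force+
    qed
    moreover have "\<tau> ` {..<n} \<subseteq> {..<n}" using inv_into_into[OF mem] by (auto simp: \<tau>_def)
    ultimately show "bij_betw \<tau> {..<n} {..<n}"
      by (simp add: bij_betw_def endo_inj_surj)
  qed (simp add: \<tau>_def)
  show ?thesis by (rule that[OF t]) (use gt dec in auto)
qed

text \<open>Both sides are antisymmetric in g, so they vanish when an entry repeats, and otherwise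
  sorting g into decreasing order reduces to the Schur function case.\<close>

lemma haar_integral_jdet_general:
  fixes H :: "(complex^'n^'n) measure"
  assumes H: "normalized_haar H" and nonneg: "\<And>i. i < CARD('n) \<Longrightarrow> 0 \<le> g i"
  shows "(\<integral>M. cnj (Determinant.det (jmat M)) ^ k * jdet CARD('n) (ptr M) g \<partial>H) =
     alt_coeff CARD('n) g (\<lambda>i. staircase CARD('n) i + int k)"
proof (cases "inj_on g {..<CARD('n)}")
  case False
  then obtain i j where "i < CARD('n)" "j < CARD('n)" "i \<noteq> j" "g i = g j" by (auto simp: inj_on_def)
  note rep = this
  show ?thesis by (simp add: jdet_repeated[OF rep] alt_coeff_repeated[OF rep])
next
  case True
  then obtain \<tau> where t: "\<tau> permutes {..<CARD('n)}"
    and dec: "\<And>i j. i < j \<Longrightarrow> j < CARD('n) \<Longrightarrow> (g \<circ> \<tau>) j < (g \<circ> \<tau>) i"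
    by (rule decreasing_rearrangement) blast
  have nonneg': "0 \<le> (g \<circ> \<tau>) i" if "i < CARD('n)" for i
    using nonneg permutes_in_image[OF t, of i] that by simp
  have "of_int (sign \<tau>) * (\<integral>M. cnj (Determinant.det (jmat M)) ^ k * jdet CARD('n) (ptr M) g \<partial>H) =
     (\<integral>M. cnj (Determinant.det (jmat M)) ^ k * jdet CARD('n) (ptr M) (g \<circ> \<tau>) \<partial>H)"
    by (simp add: jdet_permute[OF t] mult.left_commute)
  also have "\<dots> = alt_coeff CARD('n) (g \<circ> \<tau>) (\<lambda>i. staircase CARD('n) i + int k)"
    using haar_integral_jdet[of H "g \<circ> \<tau>" k] H dec nonneg'
      alt_coeff_decreasing[of "CARD('n)" "g \<circ> \<tau>" "\<lambda>i. staircase CARD('n) i + int k"]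
    by (simp add: staircase_def)
  also have "\<dots> = of_int (sign \<tau>) * alt_coeff CARD('n) g (\<lambda>i. staircase CARD('n) i + int k)"
    by (rule alt_coeff_permute[OF t])
  finally show ?thesis by (simp add: sign_def split: if_splits)
qed

lemma alt_coeff_shift: "alt_coeff n (\<lambda>i. g i + c) (\<lambda>i. w i + c) = alt_coeff n g w"
  by (simp add: alt_coeff_def)

text \<open>The average picks out a constant term exactly as soon as N exceeds every exponent that
  occurs; the bound B in the proof dominates all differences of an entry of g and an entry of
  w.\<close>

lemma grid_avg_alternant:
  "\<forall>\<^sub>F N in sequentially. grid_avg n N (\<lambda>x. alternant n g x * cnj (lmon n w x)) = alt_coeff n g w"
proof -
  define B where "B = (\<Sum>i<n. \<bar>g i\<bar>) + (\<Sum>i<n. \<bar>w i\<bar>)"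
  have "\<forall>\<^sub>F N in sequentially. N > nat B" by (rule eventually_gt_at_top)
  thus ?thesis
  proof eventually_elim
    case (elim N)
    have N: "N > 0" "B < int N" using elim by auto
    have "grid_avg n N (\<lambda>x. alternant n g x * cnj (lmon n w x)) =
      grid_avg n N (\<lambda>x. \<Sum>\<sigma> | \<sigma> permutes {..<n}. of_int (sign \<sigma>) * lmon n (\<lambda>i. g i + - w (\<sigma> i)) (x \<circ> \<sigma>))"
    proof (rule grid_avg_cong)
      fix x assume x: "x \<in> torus n"
      have "lmon n g (x \<circ> \<sigma>) * cnj (lmon n w x) = lmon n (\<lambda>i. g i + - w (\<sigma> i)) (x \<circ> \<sigma>)"
        if "\<sigma> permutes {..<n}" for \<sigma>
        using lmon_add[OF torus_permute[OF x that], of g "\<lambda>i. - w (\<sigma> i)"]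
          lmon_cnj[OF torus_permute[OF x that], of "w \<circ> \<sigma>"] lmon_permute[OF that, of w x] by simp
      thus "alternant n g x * cnj (lmon n w x) =
        (\<Sum>\<sigma> | \<sigma> permutes {..<n}. of_int (sign \<sigma>) * lmon n (\<lambda>i. g i + - w (\<sigma> i)) (x \<circ> \<sigma>))"
        unfolding alternant_def sum_distrib_right by (intro sum.cong) (simp_all add: mult.assoc)
    qed
    also have "\<dots> = (\<Sum>\<sigma> | \<sigma> permutes {..<n}. of_int (sign \<sigma>) * grid_avg n N (lmon n (\<lambda>i. g i + - w (\<sigma> i))))"
      unfolding grid_avg_sum grid_avg_cmult
      by (intro sum.cong refl arg_cong2[where f = "(*)"] grid_avg_permute) simp
    also have "\<dots> = alt_coeff n g w"
      unfolding alt_coeff_def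
    proof (intro sum.cong refl arg_cong2[where f = "(*)"])
      fix \<sigma> assume "\<sigma> \<in> {\<sigma>. \<sigma> permutes {..<n}}"
      hence s: "\<sigma> permutes {..<n}" by simp
      have "\<bar>g i + - w (\<sigma> i)\<bar> < int N" if "i < n" for i
      proof -
        have "\<bar>g i\<bar> \<le> (\<Sum>i<n. \<bar>g i\<bar>)" using that by (intro member_le_sum) auto
        moreover have "\<bar>w (\<sigma> i)\<bar> \<le> (\<Sum>i<n. \<bar>w i\<bar>)"
          using that permutes_in_image[OF s, of i] by (intro member_le_sum[of "\<sigma> i" _ "\<lambda>i. \<bar>w i\<bar>"]) auto
        ultimately show ?thesis using N by (simp add: B_def)
      qed
      from grid_avg_lmon[OF N(1), of n "\<lambda>i. g i + - w (\<sigma> i)", OF this]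
      show "grid_avg n N (lmon n (\<lambda>i. g i + - w (\<sigma> i))) = (if \<forall>i<n. g i = w (\<sigma> i) then 1 else 0)"
        by simp
    qed
    finally show ?case .
  qed
qed

section \<open>Constant terms and non-intersecting walks\<close>

lemma alternant_times_symmetric_sum:
  assumes "laurent n G"
    and "\<And>x \<sigma>. x \<in> torus n \<Longrightarrow> \<sigma> permutes {..<n} \<Longrightarrow> G (x \<circ> \<sigma>) = G x"
  obtains m :: nat and c v where "\<And>w x. x \<in> torus n \<Longrightarrow>
      alternant n w x * G x = (\<Sum>j<m. c j * alternant n (\<lambda>i. w i + v j i) x)"
proof (rule alternant_times_symmetric[of n G])
  fix ts assume ts: "\<And>w x. x \<in> torus n \<Longrightarrow>
      alternant n w x * G x = (\<Sum>(c, v)\<leftarrow>ts. c * alternant n (\<lambda>i. w i + v i) x)"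
  show ?thesis
    by (rule that[of "\<lambda>j. fst (ts ! j)" "\<lambda>j. snd (ts ! j)" "length ts"])
       (simp add: ts sum_list_sum_nth atLeast0LessThan case_prod_beta)
qed (use assms in auto)

text \<open>
  The Haar integral of a class function is the constant term of a Laurent polynomial in the
  eigenvalues. The constant term is computed as an average over a sufficiently fine finite
  subgroup of the torus.
\<close>

lemma haar_eq_grid_avg:
  fixes H :: "(complex^'n^'n) measure"
  assumes H: "normalized_haar H"
    and F: "laurent CARD('n) F" and G: "laurent CARD('n) G"
    and sym: "\<And>x \<sigma>. x \<in> torus CARD('n) \<Longrightarrow> \<sigma> permutes {..<CARD('n)} \<Longrightarrow> G (x \<circ> \<sigma>) = G x"
    and FG: "\<And>x. x \<in> torus CARD('n) \<Longrightarrow>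
      F x * alternant CARD('n) (staircase CARD('n)) x = alternant CARD('n) g x * G x"
    and Ft: "\<And>M x. M \<in> unitary_group \<Longrightarrow> x \<in> torus CARD('n) \<Longrightarrow> ptr M = psum CARD('n) x \<Longrightarrow> Ft M = F x"
  shows "\<forall>\<^sub>F N in sequentially. (\<integral>M. Ft M \<partial>H) =
    grid_avg CARD('n) N (\<lambda>x. alternant CARD('n) g x * G x * cnj (lmon CARD('n) (staircase CARD('n)) x))"
proof -
  let ?n = "CARD('n)"
  let ?\<delta> = "staircase CARD('n)"
  obtain m :: nat and c v where cv: "\<And>w x. x \<in> torus ?n \<Longrightarrow>
      alternant ?n w x * G x = (\<Sum>j<m. c j * alternant ?n (\<lambda>i. w i + v j i) x)"
    by (rule alternant_times_symmetric_sum[OF G sym]) blast+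
  \<comment> \<open>A shift that makes every exponent of the finite expansion nonnegative.\<close>
  define K where "K = nat (\<Sum>j<m. \<Sum>i<?n. \<bar>g i + v j i\<bar>)"
  define u where "u = (\<lambda>j i. g i + v j i + int K)"
  have nonneg: "0 \<le> u j i" if "j < m" "i < ?n" for j i
  proof -
    have "\<bar>g i + v j i\<bar> \<le> (\<Sum>i<?n. \<bar>g i + v j i\<bar>)"
      using that by (intro member_le_sum) auto
    also have "\<dots> \<le> (\<Sum>j<m. \<Sum>i<?n. \<bar>g i + v j i\<bar>)"
      using that by (intro member_le_sum[of j _ "\<lambda>j. \<Sum>i<?n. \<bar>g i + v j i\<bar>"]) (auto intro: sum_nonneg)
    finally have "\<bar>g i + v j i\<bar> \<le> (\<Sum>j<m. \<Sum>i<?n. \<bar>g i + v j i\<bar>)" .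
    moreover from this have "int K = (\<Sum>j<m. \<Sum>i<?n. \<bar>g i + v j i\<bar>)"
      unfolding K_def by (intro nat_0_le) (rule order_trans[OF abs_ge_zero])
    ultimately show ?thesis unfolding u_def by linarith
  qed
  \<comment> \<open>On the torus the conjugate of the product of the variables is its inverse, so
    shifting by K and multiplying by the K-th power of this conjugate changes nothing. This gives F
    the form whose Haar integral is known.\<close>
  have Fx: "F x = (\<Sum>j<m. c j * (cnj (\<Prod>i<?n. x i) ^ K * jdet ?n (psum ?n x) (u j)))"
    if x: "x \<in> torus ?n" for x
  proof (rule laurent_cancel_alternant[OF F _ _ x])
    show "laurent ?n (\<lambda>x. \<Sum>j<m. c j * (cnj (\<Prod>i<?n. x i) ^ K * jdet ?n (psum ?n x) (u j)))"
      by (intro laurent_sum laurent_mult laurent_const laurent_power laurent_cnj laurent_prod laurent_var laurent_jdet) auto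
    fix x assume x: "x \<in> torus ?n"
    have one: "cnj (\<Prod>i<?n. x i) * (\<Prod>i<?n. x i) = 1"
    proof -
      have "cmod (\<Prod>i<?n. x i) = 1" using x by (simp add: torus_def prod_norm[symmetric])
      thus ?thesis using complex_norm_square[of "\<Prod>i<?n. x i"] by (simp add: mult.commute)
    qed
    have "alternant ?n (\<lambda>i. g i + v j i) x =
       cnj (\<Prod>i<?n. x i) ^ K * jdet ?n (psum ?n x) (u j) * alternant ?n ?\<delta> x" if "j < m" for j
    proof -
      have "alternant ?n (u j) x = (\<Prod>i<?n. x i powi int K) * alternant ?n (\<lambda>i. g i + v j i) x"
        unfolding u_def using torus_nonzero[OF x] by (rule alternant_shift)
      hence a: "alternant ?n (u j) x = (\<Prod>i<?n. x i) ^ K * alternant ?n (\<lambda>i. g i + v j i) x"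
        by (simp only: prod_power_distrib power_int_of_nat)
      have b: "alternant ?n (u j) x = jdet ?n (psum ?n x) (u j) * alternant ?n ?\<delta> x"
        using nonneg[OF that] by (rule jacobi_trudi)
      have "alternant ?n (\<lambda>i. g i + v j i) x =
         (cnj (\<Prod>i<?n. x i) * (\<Prod>i<?n. x i)) ^ K * alternant ?n (\<lambda>i. g i + v j i) x"
        by (simp only: one power_one mult_1_left)
      also have "\<dots> = cnj (\<Prod>i<?n. x i) ^ K * alternant ?n (u j) x"
        unfolding a by (simp only: power_mult_distrib mult.assoc)
      finally show ?thesis unfolding b by (simp only: mult.assoc)
    qed
    hence "(\<Sum>j<m. c j * (cnj (\<Prod>i<?n. x i) ^ K * jdet ?n (psum ?n x) (u j))) * alternant ?n ?\<delta> x =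
        (\<Sum>j<m. c j * alternant ?n (\<lambda>i. g i + v j i) x)"
      unfolding sum_distrib_right by (intro sum.cong) (simp_all add: mult.assoc)
    thus "F x * alternant ?n ?\<delta> x =
      (\<Sum>j<m. c j * (cnj (\<Prod>i<?n. x i) ^ K * jdet ?n (psum ?n x) (u j))) * alternant ?n ?\<delta> x"
      using FG[OF x] cv[OF x, of g] by simp
  qed
  have "(\<integral>M. Ft M \<partial>H) = (\<integral>M. (\<Sum>j<m. c j * (cnj (Determinant.det (jmat M)) ^ K * jdet ?n (ptr M) (u j))) \<partial>H)"
  proof (rule Bochner_Integration.integral_cong[OF refl])
    fix M assume "M \<in> space H"
    hence M: "M \<in> unitary_group" by (simp add: haar_space[OF H])
    then obtain x where x: "x \<in> torus ?n" "ptr M = psum ?n x" "Determinant.det (jmat M) = (\<Prod>i<?n. x i)"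
      by (rule unitary_spectrum)
    show "Ft M = (\<Sum>j<m. c j * (cnj (Determinant.det (jmat M)) ^ K * jdet ?n (ptr M) (u j)))"
      unfolding Ft[OF M x(1,2)] Fx[OF x(1)] x(2,3) ..
  qed
  also have "\<dots> = (\<Sum>j<m. (\<integral>M. c j * (cnj (Determinant.det (jmat M)) ^ K * jdet ?n (ptr M) (u j)) \<partial>H))"
    by (intro Bochner_Integration.integral_sum integrable_mult_right haar_integrable H
          continuous_on_mult continuous_on_cnj_det_power continuous_on_jdet_ptr)
  also have "\<dots> = (\<Sum>j<m. c j * alt_coeff ?n (\<lambda>i. g i + v j i) ?\<delta>)"
  proof (rule sum.cong)
    fix j assume "j \<in> {..<m}"
    hence "(\<integral>M. cnj (Determinant.det (jmat M)) ^ K * jdet ?n (ptr M) (u j) \<partial>H) =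
       alt_coeff ?n (u j) (\<lambda>i. ?\<delta> i + int K)"
      using nonneg by (intro haar_integral_jdet_general H) auto
    thus "(\<integral>M. c j * (cnj (Determinant.det (jmat M)) ^ K * jdet ?n (ptr M) (u j)) \<partial>H) =
        c j * alt_coeff ?n (\<lambda>i. g i + v j i) ?\<delta>"
      by (simp add: u_def alt_coeff_shift)
  qed simp
  finally have int: "(\<integral>M. Ft M \<partial>H) = (\<Sum>j<m. c j * alt_coeff ?n (\<lambda>i. g i + v j i) ?\<delta>)" .
  have "\<forall>\<^sub>F N in sequentially. \<forall>j\<in>{..<m}.
     grid_avg ?n N (\<lambda>x. alternant ?n (\<lambda>i. g i + v j i) x * cnj (lmon ?n ?\<delta> x)) =
       alt_coeff ?n (\<lambda>i. g i + v j i) ?\<delta>"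
    by (intro eventually_ball_finite ballI grid_avg_alternant) auto
  thus ?thesis
  proof eventually_elim
    case (elim N)
    have "grid_avg ?n N (\<lambda>x. alternant ?n g x * G x * cnj (lmon ?n ?\<delta> x)) =
        grid_avg ?n N (\<lambda>x. \<Sum>j<m. c j * (alternant ?n (\<lambda>i. g i + v j i) x * cnj (lmon ?n ?\<delta> x)))"
      by (rule grid_avg_cong) (simp add: cv sum_distrib_right mult.assoc)
    also have "\<dots> = (\<Sum>j<m. c j * alt_coeff ?n (\<lambda>i. g i + v j i) ?\<delta>)"
      unfolding grid_avg_sum grid_avg_cmult using elim by (intro sum.cong) auto
    finally show ?case using int by simp
  qed
qed

text \<open>Against an antisymmetric function all terms of the second alternant contribute equally.
  This accounts for the 1/n! of the Weyl formula and allows a single monomial in place of a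
  conjugate alternant.\<close>

lemma grid_avg_antisymmetric:
  assumes A: "\<And>x \<sigma>. x \<in> torus n \<Longrightarrow> \<sigma> permutes {..<n} \<Longrightarrow> A (x \<circ> \<sigma>) = of_int (sign \<sigma>) * A x"
  shows "grid_avg n N (\<lambda>x. A x * cnj (alternant n w x)) = fact n * grid_avg n N (\<lambda>x. A x * cnj (lmon n w x))"
proof -
  have "grid_avg n N (\<lambda>x. A x * cnj (alternant n w x)) =
     grid_avg n N (\<lambda>x. \<Sum>\<sigma> | \<sigma> permutes {..<n}. A (x \<circ> \<sigma>) * cnj (lmon n w (x \<circ> \<sigma>)))"
    by (rule grid_avg_cong) (simp add: alternant_def sum_distrib_left A mult_ac)
  also have "\<dots> = (\<Sum>\<sigma> | \<sigma> permutes {..<n}. grid_avg n N (\<lambda>x. A x * cnj (lmon n w x)))"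
    unfolding grid_avg_sum
    by (intro sum.cong refl grid_avg_permute[of _ n N "\<lambda>x. A x * cnj (lmon n w x)"]) simp
  also have "\<dots> = fact n * grid_avg n N (\<lambda>x. A x * cnj (lmon n w x))"
    using card_permutations[of "{..<n}" n] by simp
  finally show ?thesis .
qed

definition hop :: "nat \<Rightarrow> (nat \<Rightarrow> complex) \<Rightarrow> complex" where
  "hop n x = psum n x 1 + cnj (psum n x 1)"

text \<open>The conjugate Schur function is absorbed into the conjugate Vandermonde: the monomial of
  delta is replaced by the full alternant at the cost of n!, the product is the alternant of w by
  Jacobi-Trudi, and the same n! returns to the monomial of w.\<close>

lemma haar_schur_pairing:
  fixes H :: "(complex^'n^'n) measure"
  assumes H: "normalized_haar H"
    and g: "\<And>i. i < CARD('n) \<Longrightarrow> 0 \<le> g i" and w: "\<And>i. i < CARD('n) \<Longrightarrow> 0 \<le> w i"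
  shows "\<forall>\<^sub>F N in sequentially.
     (\<integral>M. jdet CARD('n) (ptr M) g * cnj (jdet CARD('n) (ptr M) w) * (ptr M 1 + cnj (ptr M 1)) ^ k \<partial>H) =
     grid_avg CARD('n) N (\<lambda>x. alternant CARD('n) g x * hop CARD('n) x ^ k * cnj (lmon CARD('n) w x))"
proof -
  let ?n = "CARD('n)"
  define G where "G = (\<lambda>x. cnj (jdet ?n (psum ?n x) w) * hop ?n x ^ k)"
  have sym: "G (x \<circ> \<sigma>) = G x" if "\<sigma> permutes {..<?n}" for x \<sigma>
    using that by (simp add: G_def hop_def psum_permute)
  have G: "laurent ?n G"
    unfolding G_def hop_def
    by (intro laurent_mult laurent_cnj laurent_jdet laurent_power laurent_add laurent_psum)
  have "\<forall>\<^sub>F N in sequentially.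
     (\<integral>M. jdet ?n (ptr M) g * (cnj (jdet ?n (ptr M) w) * (ptr M 1 + cnj (ptr M 1)) ^ k) \<partial>H) =
     grid_avg ?n N (\<lambda>x. alternant ?n g x * G x * cnj (lmon ?n (staircase ?n) x))"
  proof (rule haar_eq_grid_avg[OF H _ G sym])
    show "laurent ?n (\<lambda>x. jdet ?n (psum ?n x) g * G x)"
      by (intro laurent_mult laurent_jdet G)
    show "jdet ?n (psum ?n x) g * G x * alternant ?n (staircase ?n) x = alternant ?n g x * G x" for x
      using jacobi_trudi[of ?n g x] g by simp
  qed (simp_all add: G_def hop_def)
  thus ?thesis
  proof eventually_elim
    case (elim N)
    have "fact ?n * grid_avg ?n N (\<lambda>x. alternant ?n g x * G x * cnj (lmon ?n (staircase ?n) x)) =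
        grid_avg ?n N (\<lambda>x. alternant ?n g x * G x * cnj (alternant ?n (staircase ?n) x))"
      by (rule grid_avg_antisymmetric[symmetric]) (simp add: alternant_permute_vars sym mult.assoc)
    also have "\<dots> = grid_avg ?n N (\<lambda>x. (alternant ?n g x * hop ?n x ^ k) * cnj (alternant ?n w x))"
      using jacobi_trudi[of ?n w] w by (intro grid_avg_cong) (simp add: G_def mult_ac)
    also have "\<dots> = fact ?n * grid_avg ?n N (\<lambda>x. (alternant ?n g x * hop ?n x ^ k) * cnj (lmon ?n w x))"
      by (rule grid_avg_antisymmetric) (simp add: alternant_permute_vars hop_def psum_permute mult.assoc)
    finally show ?case using elim by (simp add: mult.assoc)
  qed
qed

text \<open>Being symmetric, \<open>hop\<close> can be evaluated at the permuted point inside each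
  term, where it is the sum of all variables and their inverses and shifts one exponent of the
  monomial.\<close>

lemma alternant_times_hop:
  assumes x: "x \<in> torus n"
  shows "alternant n g x * hop n x =
    (\<Sum>p\<in>{..<n} \<times> {-1, 1}. alternant n (g(fst p := g (fst p) + snd p)) x)"
proof -
  let ?I = "{..<n} \<times> {-1, 1 :: int}"
  have hop: "hop n x = (\<Sum>p\<in>?I. x (fst p) powi snd p)" if "x \<in> torus n" for x
  proof -
    have "hop n x = (\<Sum>i<n. x i powi (-1) + x i powi 1)"
      unfolding hop_def psum_def cnj_sum sum.distrib[symmetric]
      by (intro sum.cong) (auto simp: torus_cnj[OF that] power_int_minus)
    also have "\<dots> = (\<Sum>i<n. \<Sum>d\<in>{-1, 1}. x i powi d)" by simp
    also have "\<dots> = (\<Sum>(i, d)\<in>?I. x i powi d)" by (rule sum.cartesian_product)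
    finally show ?thesis by (simp only: case_prod_unfold)
  qed
  have mon: "lmon n g y * y i powi d = lmon n (g(i := g i + d)) y" if "i < n" "y \<in> torus n" for i d y
  proof -
    have "lmon n (g(i := g i + d)) y = y i powi (g i + d) * (\<Prod>j\<in>{..<n}-{i}. y j powi g j)"
      unfolding lmon_def using that by (subst prod.remove[of _ i]) (auto intro!: prod.cong)
    also have "y i powi (g i + d) = y i powi g i * y i powi d"
      using torus_nonzero[OF that(2,1)] by (simp add: power_int_add)
    also have "y i powi g i * y i powi d * (\<Prod>j\<in>{..<n}-{i}. y j powi g j) = lmon n g y * y i powi d"
      unfolding lmon_def using that by (subst prod.remove[of "{..<n}" i]) (auto simp: mult_ac)
    finally show ?thesis by (rule sym)
  qed
  have "alternant n g x * hop n x =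
      (\<Sum>\<sigma> | \<sigma> permutes {..<n}. \<Sum>p\<in>?I. of_int (sign \<sigma>) * lmon n (g(fst p := g (fst p) + snd p)) (x \<circ> \<sigma>))"
    unfolding alternant_def sum_distrib_right
  proof (rule sum.cong)
    fix \<sigma> assume "\<sigma> \<in> {\<sigma>. \<sigma> permutes {..<n}}"
    hence s: "\<sigma> permutes {..<n}" and y: "x \<circ> \<sigma> \<in> torus n" using torus_permute[OF x] by auto
    have "hop n x = hop n (x \<circ> \<sigma>)" by (simp add: hop_def psum_permute[OF s])
    hence "of_int (sign \<sigma>) * lmon n g (x \<circ> \<sigma>) * hop n x =
       (\<Sum>p\<in>?I. of_int (sign \<sigma>) * lmon n g (x \<circ> \<sigma>) * (x \<circ> \<sigma>) (fst p) powi snd p)"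
      by (simp only: hop[OF y] sum_distrib_left)
    also have "\<dots> = (\<Sum>p\<in>?I. of_int (sign \<sigma>) * lmon n (g(fst p := g (fst p) + snd p)) (x \<circ> \<sigma>))"
      by (intro sum.cong refl) (simp only: mult.assoc mon[OF _ y] mem_Times_iff lessThan_iff)
    finally show "of_int (sign \<sigma>) * lmon n g (x \<circ> \<sigma>) * hop n x =
       (\<Sum>p\<in>?I. of_int (sign \<sigma>) * lmon n (g(fst p := g (fst p) + snd p)) (x \<circ> \<sigma>))" .
  qed simp
  also have "\<dots> = (\<Sum>p\<in>?I. alternant n (g(fst p := g (fst p) + snd p)) x)"
    unfolding alternant_def by (rule sum.swap)
  finally show ?thesis .
qed

section \<open>Counting walks by their first step\<close>

lemma walks_0: "walks 0 x y = (if x = y \<and> sorted_wrt (<) x then {[x]} else {})"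
  by (auto simp: walks_def length_Suc_conv)

lemma walks_Suc:
  assumes "sorted_wrt (<) x"
  shows "walks (Suc k) x y = (\<Union>(i, d)\<in>{..<length x} \<times> {-1, 1}. (#) x ` walks k (x[i := x ! i + d]) y)"
proof (intro equalityI subsetI)
  fix w assume "w \<in> walks (Suc k) x y"
  hence w: "length w = Suc (Suc k)" "w ! 0 = x" "w ! Suc k = y" "\<forall>l<Suc (Suc k). sorted_wrt (<) (w ! l)"
    "\<forall>l<Suc k. walk_step (w ! l) (w ! Suc l)"
    by (auto simp: walks_def less_Suc_eq_le)
  then obtain w' where w': "w = x # w'" "length w' = Suc k" by (cases w) auto
  from w(5) have "walk_step x (w' ! 0)" and rest: "\<forall>l<k. walk_step (w' ! l) (w' ! Suc l)"
    by (auto simp: w' All_less_Suc2)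
  then obtain i d where id: "i < length x" "d \<in> {-1, 1}" "w' ! 0 = x[i := x ! i + d]"
    unfolding walk_step_def by blast
  have "w' \<in> walks k (x[i := x ! i + d]) y"
    using w(3,4) rest id(3) w' by (auto simp: walks_def All_less_Suc2 less_Suc_eq_le[symmetric])
  thus "w \<in> (\<Union>(i, d)\<in>{..<length x} \<times> {-1, 1}. (#) x ` walks k (x[i := x ! i + d]) y)"
    by (intro UN_I[of "(i, d)"]) (use id w' in auto)
next
  fix w assume "w \<in> (\<Union>(i, d)\<in>{..<length x} \<times> {-1, 1}. (#) x ` walks k (x[i := x ! i + d]) y)"
  then obtain p where p: "p \<in> {..<length x} \<times> {-1, 1}"
    "w \<in> (case p of (i, d) \<Rightarrow> (#) x ` walks k (x[i := x ! i + d]) y)" by (rule UN_E)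
  obtain i d where "p = (i, d)" by (cases p)
  with p have "i < length x" "d \<in> {-1, 1}" "w \<in> (#) x ` walks k (x[i := x ! i + d]) y" by auto
  then obtain w' where id: "i < length x" "d \<in> {-1, 1}" "w = x # w'" "w' \<in> walks k (x[i := x ! i + d]) y"
    by (elim imageE)
  have "walk_step x (x[i := x ! i + d])" using id by (auto simp: walk_step_def)
  thus "w \<in> walks (Suc k) x y"
    using id(3,4) assms by (auto simp: walks_def All_less_Suc2 less_Suc_eq_le[symmetric])
qed

lemma walks_unsorted: "\<not> sorted_wrt (<) x \<Longrightarrow> walks k x y = {}"
  by (auto simp: walks_def)

lemma finite_walks: "finite (walks k x y)"
proof (induction k arbitrary: x)
  case (Suc k)
  show ?case
    using Suc by (cases "sorted_wrt (<) x") (auto simp: walks_Suc walks_unsorted)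
qed (simp add: walks_0)

text \<open>Different choices of walker and direction lead to different second configurations
  because the displacement is never 0, so the walks are counted without repetition.\<close>

lemma num_walks_Suc:
  assumes "sorted_wrt (<) x"
  shows "num_walks (Suc k) x y = (\<Sum>(i, d)\<in>{..<length x} \<times> {-1, 1}. num_walks k (x[i := x ! i + d]) y)"
proof -
  have inj: "(i, d) = (i', d')" if "i < length x" "i' < length x" "d \<in> {-1, 1}" "d' \<in> {-1, 1}"
    "x[i := x ! i + d] = x[i' := x ! i' + d']" for i i' and d d' :: int
  proof -
    have *: "x[i := x ! i + d] ! i = x[i' := x ! i' + d'] ! i" using that(5) by simp
    show ?thesis
    proof (cases "i = i'")
      case True
      thus ?thesis using * that by simp
    next
      case False
      thus ?thesis using * that(1-4) by (auto simp: nth_list_update)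
    qed
  qed
  have "card (\<Union>p\<in>{..<length x} \<times> {-1, 1}. (#) x ` walks k (x[fst p := x ! fst p + snd p]) y) =
     (\<Sum>p\<in>{..<length x} \<times> {-1, 1}. card ((#) x ` walks k (x[fst p := x ! fst p + snd p]) y))"
  proof (rule card_UN_disjoint)
    show "\<forall>p\<in>{..<length x} \<times> {-1, 1}. \<forall>q\<in>{..<length x} \<times> {-1, 1}. p \<noteq> q \<longrightarrow>
       (#) x ` walks k (x[fst p := x ! fst p + snd p]) y \<inter> (#) x ` walks k (x[fst q := x ! fst q + snd q]) y = {}"
    proof (intro ballI impI)
      fix p q assume pq: "p \<in> {..<length x} \<times> {-1, 1 :: int}" "q \<in> {..<length x} \<times> {-1, 1 :: int}" "p \<noteq> q"
      hence "x[fst p := x ! fst p + snd p] \<noteq> x[fst q := x ! fst q + snd q]"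
        using inj[of "fst p" "fst q" "snd p" "snd q"] by (auto simp: prod_eq_iff)
      thus "(#) x ` walks k (x[fst p := x ! fst p + snd p]) y \<inter> (#) x ` walks k (x[fst q := x ! fst q + snd q]) y = {}"
        by (auto simp: walks_def)
    qed
  qed (auto simp: finite_walks)
  thus ?thesis
    unfolding num_walks_def walks_Suc[OF assms] by (simp add: case_prod_beta card_image)
qed

text \<open>Distinct integers differ by at least 1, so a single unit step can close a gap but cannot
  jump over it: order is lost only through a collision, that is, a repeated exponent.\<close>

lemma step_unsorted_repeated:
  fixes x :: "int list"
  assumes x: "sorted_wrt (<) x" and i: "i < length x" and d: "d \<in> {-1, 1}"
    and unsorted: "\<not> sorted_wrt (<) (x[i := x ! i + d])"
  obtains a b where "a < length x" "b < length x" "a \<noteq> b" "x[i := x ! i + d] ! a = x[i := x ! i + d] ! b"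
proof -
  from unsorted obtain a b where ab: "a < b" "b < length x" "\<not> x[i := x ! i + d] ! a < x[i := x ! i + d] ! b"
    by (auto simp: sorted_wrt_iff_nth_less)
  have "x ! a < x ! b" using x ab by (auto simp: sorted_wrt_iff_nth_less)
  hence "x[i := x ! i + d] ! a = x[i := x ! i + d] ! b"
    using ab d i by (auto simp: nth_list_update split: if_splits)
  thus ?thesis using that[of a b] ab by auto
qed

lemma alt_coeff_increasing:
  assumes "\<And>i j. i < j \<Longrightarrow> j < n \<Longrightarrow> g i < g j" and "\<And>i j. i < j \<Longrightarrow> j < n \<Longrightarrow> w i < w j"
  shows "alt_coeff n g w = (if \<forall>i<n. g i = w i then 1 else 0)"
proof -
  have "alt_coeff n g w = alt_coeff n (\<lambda>i. - g i) (\<lambda>i. - w i)" by (simp add: alt_coeff_def)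
  also have "\<dots> = (if \<forall>i<n. - g i = - w i then 1 else 0)"
    by (rule alt_coeff_decreasing) (use assms in auto)
  finally show ?thesis by simp
qed

text \<open>Both sides obey the recursion over the first step, and forbidden configurations give 0
  on both. The statement for large N survives the induction because each configuration has only
  finitely many successors.\<close>

lemma grid_avg_walks:
  assumes y: "length y = n" "sorted_wrt (<) y"
  shows "length x = n \<Longrightarrow> sorted_wrt (<) x \<Longrightarrow> \<forall>\<^sub>F N in sequentially.
     grid_avg n N (\<lambda>X. alternant n ((!) x) X * hop n X ^ k * cnj (lmon n ((!) y) X)) = of_nat (num_walks k x y)"
proof (induction k arbitrary: x)
  case 0
  have "alt_coeff n ((!) x) ((!) y) = (if \<forall>i<n. x ! i = y ! i then 1 else 0)"
    using 0 y by (intro alt_coeff_increasing) (auto simp: sorted_wrt_iff_nth_less)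
  also have "(\<forall>i<n. x ! i = y ! i) \<longleftrightarrow> x = y" using 0 y by (auto simp: list_eq_iff_nth_eq)
  finally have "alt_coeff n ((!) x) ((!) y) = of_nat (num_walks 0 x y)"
    using 0 by (simp add: num_walks_def walks_0)
  thus ?case using grid_avg_alternant[of n "(!) x" "(!) y"] by simp
next
  case (Suc k)
  let ?I = "{..<n} \<times> {-1, 1 :: int}"
  let ?x = "\<lambda>p. x[fst p := x ! fst p + snd p]"
  have "\<forall>\<^sub>F N in sequentially. \<forall>p\<in>?I.
     grid_avg n N (\<lambda>X. alternant n ((!) (?x p)) X * hop n X ^ k * cnj (lmon n ((!) y) X)) = of_nat (num_walks k (?x p) y)"
  proof (intro eventually_ball_finite ballI)
    fix p assume p: "p \<in> ?I"
    show "\<forall>\<^sub>F N in sequentially.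
       grid_avg n N (\<lambda>X. alternant n ((!) (?x p)) X * hop n X ^ k * cnj (lmon n ((!) y) X)) = of_nat (num_walks k (?x p) y)"
    proof (cases "sorted_wrt (<) (?x p)")
      case True
      thus ?thesis using Suc.prems by (intro Suc.IH) auto
    next
      case False
      have "fst p < length x" "snd p \<in> {-1, 1}" using p Suc.prems by auto
      from step_unsorted_repeated[OF Suc.prems(2) this False]
      obtain a b where "a < n" "b < n" "a \<noteq> b" "?x p ! a = ?x p ! b" using Suc.prems(1) by metis
      hence "alternant n ((!) (?x p)) X = 0" for X by (rule alternant_repeated)
      thus ?thesis using False by (simp add: num_walks_def walks_unsorted)
    qed
  qed simp
  thus ?case
  proof eventually_elim
    case (elim N)
    have upd: "alternant n (((!) x)(fst p := x ! fst p + snd p)) X = alternant n ((!) (?x p)) X"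
      if "p \<in> ?I" for p X
      using that Suc.prems(1) by (intro alternant_cong) (auto simp: nth_list_update)
    have "grid_avg n N (\<lambda>X. alternant n ((!) x) X * hop n X ^ Suc k * cnj (lmon n ((!) y) X)) =
      grid_avg n N (\<lambda>X. \<Sum>p\<in>?I. alternant n ((!) (?x p)) X * hop n X ^ k * cnj (lmon n ((!) y) X))"
    proof (rule grid_avg_cong)
      fix X assume X: "X \<in> torus n"
      have "alternant n ((!) x) X * hop n X = (\<Sum>p\<in>?I. alternant n ((!) (?x p)) X)"
        unfolding alternant_times_hop[OF X] by (intro sum.cong refl upd)
      hence "alternant n ((!) x) X * hop n X ^ Suc k * cnj (lmon n ((!) y) X) =
         (\<Sum>p\<in>?I. alternant n ((!) (?x p)) X) * (hop n X ^ k * cnj (lmon n ((!) y) X))"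
        by (simp only: power_Suc mult.assoc[symmetric])
      thus "alternant n ((!) x) X * hop n X ^ Suc k * cnj (lmon n ((!) y) X) =
         (\<Sum>p\<in>?I. alternant n ((!) (?x p)) X * hop n X ^ k * cnj (lmon n ((!) y) X))"
        by (simp only: sum_distrib_right mult.assoc)
    qed
    also have "\<dots> = (\<Sum>p\<in>?I. of_nat (num_walks k (?x p) y))"
      unfolding grid_avg_sum using elim by (intro sum.cong) auto
    also have "\<dots> = of_nat (num_walks (Suc k) x y)"
      unfolding num_walks_Suc[OF Suc.prems(2)] Suc.prems(1) by (simp add: case_prod_beta)
    finally show ?case .
  qed
qed

text \<open>Permuting the exponents and the variables together produces the sign of the permutation
  twice. It is needed because positions are listed in increasing order and shifted partitions in
  decreasing order.\<close>

lemma grid_avg_permute_exponents: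
  assumes r: "\<rho> permutes {..<n}"
  shows "grid_avg n N (\<lambda>X. alternant n (g \<circ> \<rho>) X * hop n X ^ k * cnj (lmon n (w \<circ> \<rho>) X)) =
     grid_avg n N (\<lambda>X. alternant n g X * hop n X ^ k * cnj (lmon n w X))"
proof -
  have "alternant n (g \<circ> \<rho>) (X \<circ> \<rho>) * hop n (X \<circ> \<rho>) ^ k * cnj (lmon n (w \<circ> \<rho>) (X \<circ> \<rho>)) =
      alternant n g X * hop n X ^ k * cnj (lmon n w X)" for X
  proof -
    have "alternant n (g \<circ> \<rho>) (X \<circ> \<rho>) = (of_int (sign \<rho>) * of_int (sign \<rho>)) * alternant n g X"
      by (simp only: alternant_permute[OF r] alternant_permute_vars[OF r] mult.assoc)
    thus ?thesis by (simp add: lmon_permute[OF r] hop_def psum_permute[OF r])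
  qed
  thus ?thesis
    using grid_avg_permute[OF r, where N = N and f = "\<lambda>X. alternant n (g \<circ> \<rho>) X * hop n X ^ k * cnj (lmon n (w \<circ> \<rho>) X)"]
    by simp
qed

lemma haar_schur_walks:
  fixes H :: "(complex^'n^'n) measure"
  assumes H: "normalized_haar H"
    and x: "length x = CARD('n)" "sorted_wrt (<) x" and y: "length y = CARD('n)" "sorted_wrt (<) y"
    and gx: "\<And>i. i < CARD('n) \<Longrightarrow> g i = x ! (CARD('n) - Suc i)"
    and wy: "\<And>i. i < CARD('n) \<Longrightarrow> w i = y ! (CARD('n) - Suc i)"
    and g: "\<And>i. i < CARD('n) \<Longrightarrow> 0 \<le> g i" and w: "\<And>i. i < CARD('n) \<Longrightarrow> 0 \<le> w i"
  shows "(\<integral>M. jdet CARD('n) (ptr M) g * cnj (jdet CARD('n) (ptr M) w) * (ptr M 1 + cnj (ptr M 1)) ^ k \<partial>H) =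
    of_nat (num_walks k x y)"
proof -
  let ?n = "CARD('n)"
  \<comment> \<open>The order reversal, which turns the increasing positions of the walkers into
    decreasing exponents.\<close>
  define \<rho> where "\<rho> = (\<lambda>i. if i < ?n then ?n - Suc i else i)"
  have r: "\<rho> permutes {..<?n}"
  proof (rule bij_imp_permutes)
    show "bij_betw \<rho> {..<?n} {..<?n}"
      by (rule bij_betwI[of _ _ _ \<rho>]) (auto simp: \<rho>_def)
  qed (simp add: \<rho>_def)
  have pairing: "\<forall>\<^sub>F N in sequentially.
     (\<integral>M. jdet ?n (ptr M) g * cnj (jdet ?n (ptr M) w) * (ptr M 1 + cnj (ptr M 1)) ^ k \<partial>H) =
     grid_avg ?n N (\<lambda>x. alternant ?n g x * hop ?n x ^ k * cnj (lmon ?n w x))"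
    by (rule haar_schur_pairing) (use H g w in auto)
  have "\<forall>\<^sub>F N in sequentially.
    (\<integral>M. jdet ?n (ptr M) g * cnj (jdet ?n (ptr M) w) * (ptr M 1 + cnj (ptr M 1)) ^ k \<partial>H) = of_nat (num_walks k x y)"
    using pairing grid_avg_walks[OF y x, of k]
  proof eventually_elim
    case (elim N)
    have "alternant ?n g X = alternant ?n ((!) x \<circ> \<rho>) X" "lmon ?n w X = lmon ?n ((!) y \<circ> \<rho>) X" for X
      by (auto intro!: alternant_cong prod.cong simp: gx wy \<rho>_def lmon_def)
    thus ?case using elim by (simp only: grid_avg_permute_exponents[OF r])
  qed
  thus ?thesis by simp
qed

section \<open>Partitions and Schur functions of matrices\<close>

lemma partition_support:
  assumes "is_partition lam"
  shows "{i. lam i \<noteq> 0} = {..<num_parts lam}"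
proof -
  let ?S = "{i. lam i \<noteq> 0}"
  have fin: "finite ?S" and anti: "antimono lam" using assms by (auto simp: is_partition_def)
  have down: "j \<in> ?S" if "i \<in> ?S" "j \<le> i" for i j
    using antimonoD[OF anti that(2)] that(1) by auto
  have "?S \<subseteq> {..<card ?S}"
  proof
    fix i assume i: "i \<in> ?S"
    hence "{..i} \<subseteq> ?S" using down by auto
    hence "card {..i} \<le> card ?S" using fin by (intro card_mono)
    thus "i \<in> {..<card ?S}" by simp
  qed
  moreover have "card ?S = card {..<card ?S}" by simp
  ultimately show ?thesis
    unfolding num_parts_def by (intro card_subset_eq) auto
qed

lemma partition_eq_0:
  assumes "is_partition lam" "num_parts lam \<le> i"
  shows "lam i = 0"
proof (rule ccontr)
  assume "lam i \<noteq> 0"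
  hence "i \<in> {..<num_parts lam}" unfolding partition_support[OF assms(1), symmetric] by simp
  with assms(2) show False by simp
qed

text \<open>A zero part appended at index m adds a row that is zero to the left of the diagonal and
  1 on it, so the determinant keeps its value. All partitions with at most n parts thus get
  determinants of one common size.\<close>

lemma schur_eq_det:
  fixes t :: "nat \<Rightarrow> 'a :: {comm_ring_1, real_algebra_1}"
  assumes lam: "is_partition lam" and n: "num_parts lam \<le> n"
  shows "schur lam t = Determinant.det (Matrix.mat n n (\<lambda>(i, j). elem_schur t (int (lam i) - int i + int j)))"
  using n
proof (induction n rule: dec_induct)
  case base
  show ?case by (simp add: schur_def)
next
  case (step m)
  let ?A = "Matrix.mat (Suc m) (Suc m) (\<lambda>(i, j). elem_schur t (int (lam i) - int i + int j))"
  let ?B = "Matrix.mat m m (\<lambda>(i, j). elem_schur t (int (lam i) - int i + int j))"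
  have lam0: "lam m = 0" using partition_eq_0[OF lam step(1)] .
  have "Determinant.det ?A = (\<Sum>j<Suc m. ?A $$ (m, j) * cofactor ?A m j)"
    by (rule laplace_expansion_row) auto
  also have "\<dots> = cofactor ?A m m"
    by (simp add: lam0)
  also have "\<dots> = Determinant.det (mat_delete ?A m m)"
    by (simp add: cofactor_def)
  also have "mat_delete ?A m m = ?B"
    by (rule eq_matI) (auto simp: mat_delete_def)
  finally show ?case using step by simp
qed

definition shifted :: "nat \<Rightarrow> (nat \<Rightarrow> nat) \<Rightarrow> nat \<Rightarrow> int" where
  "shifted n lam i = int (lam i) + staircase n i"

lemma shifted_nonneg: "i < n \<Longrightarrow> 0 \<le> shifted n lam i"
  by (simp add: shifted_def staircase_def)

lemma schur_matrix_eq_jdet: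
  fixes M :: "complex^'n^'n"
  assumes "is_partition lam" "num_parts lam \<le> CARD('n)"
  shows "schur_matrix lam M = jdet CARD('n) (ptr M) (shifted CARD('n) lam)"
  unfolding schur_matrix_def schur_eq_det[OF assms] jdet_def hsym_def ptr_def[symmetric]
  by (intro arg_cong[where f = Determinant.det] cong_mat) (auto simp: shifted_def staircase_def algebra_simps)

lemma matrix_power_cnj: "matrix_power (matrix_cnj M) r $ i $ j = cnj (matrix_power M r $ i $ j)"
proof (induction r arbitrary: i j)
  case (Suc r)
  thus ?case
    by (simp add: matrix_power_Suc matrix_matrix_mult_def[of "matrix_cnj M"] matrix_matrix_mult_def[of M])
       (simp add: matrix_cnj_def map_matrix_def)
qed (simp add: Finite_Cartesian_Product.mat_def)

lemma ptr_cnj: "ptr (matrix_cnj M) r = cnj (ptr M r)"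
  by (simp add: ptr_def trace_def matrix_power_cnj)

lemma jdet_cnj: "jdet n (\<lambda>r. cnj (p r)) g = cnj (jdet n p g)"
  by (simp add: jdet_eq_sum hsym_cnj)

lemma schur_matrix_cnj:
  fixes M :: "complex^'n^'n"
  assumes "is_partition lam" "num_parts lam \<le> CARD('n)"
  shows "schur_matrix lam (matrix_cnj M) = cnj (schur_matrix lam M)"
  unfolding schur_matrix_eq_jdet[OF assms] jdet_cnj[symmetric] ptr_cnj ..

lemma trace_plus_cnj: "Determinants.trace (M + matrix_cnj M) = ptr M 1 + cnj (ptr M 1)"
  using ptr_cnj[of M 1] by (simp add: ptr_def trace_add)

lemma continuous_on_hop_ptr: "continuous_on A (\<lambda>M :: complex^'n^'n. ptr M 1 + cnj (ptr M 1))"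
  by (intro continuous_on_add continuous_on_cnj continuous_on_ptr)

lemma schur_integral_eq:
  fixes H :: "(complex^'n^'n) measure"
  assumes "is_partition lam" "num_parts lam \<le> CARD('n)" "is_partition mu" "num_parts mu \<le> CARD('n)"
  shows "schur_integral H lam mu z =
    (\<integral>M. jdet CARD('n) (ptr M) (shifted CARD('n) lam) * cnj (jdet CARD('n) (ptr M) (shifted CARD('n) mu)) *
       exp (z * (ptr M 1 + cnj (ptr M 1))) \<partial>H)"
proof -
  have "schur_matrix mu (matrix_cnj M) = cnj (jdet CARD('n) (ptr M) (shifted CARD('n) mu))"
    for M :: "complex^'n^'n"
    unfolding schur_matrix_cnj[OF assms(3,4)] by (simp only: schur_matrix_eq_jdet[OF assms(3,4)])
  moreover have "schur_matrix lam M = jdet CARD('n) (ptr M) (shifted CARD('n) lam)" for M :: "complex^'n^'n"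
    by (rule schur_matrix_eq_jdet[OF assms(1,2)])
  ultimately show ?thesis by (simp only: schur_integral_def trace_plus_cnj)
qed

text \<open>Termwise integration of the exponential series: f and q are bounded on the compact
  group, so the terms are dominated by a convergent numerical exponential series.\<close>

lemma haar_sums_exp:
  fixes H :: "(complex^'n^'n) measure" and f q :: "complex^'n^'n \<Rightarrow> complex"
  assumes H: "normalized_haar H" and f: "continuous_on unitary_group f" and q: "continuous_on unitary_group q"
  shows "(\<lambda>k. z ^ k / fact k * (\<integral>M. f M * q M ^ k \<partial>H)) sums (\<integral>M. f M * exp (z * q M) \<partial>H)"
proof -
  interpret prob_space H by (rule haar_prob_space[OF H])
  have "bounded (f ` unitary_group)" "bounded (q ` unitary_group)"
    by (intro compact_imp_bounded compact_continuous_image f q compact_unitary_group)+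
  then obtain B C where B: "\<And>M. M \<in> unitary_group \<Longrightarrow> norm (f M) \<le> B" and
    C: "\<And>M. M \<in> unitary_group \<Longrightarrow> norm (q M) \<le> C"
    unfolding bounded_iff by blast
  define F where "F = (\<lambda>k M. z ^ k / fact k * (f M * q M ^ k))"
  have contF: "continuous_on unitary_group (F k)" for k
    unfolding F_def
    by (intro continuous_on_mult f continuous_on_power continuous_on_const q)
  have int: "integrable H (F k)" for k by (intro haar_integrable H contF)
  have bound: "norm (F k M) \<le> B * ((norm z * C) ^ k / fact k)" if "M \<in> unitary_group" for k M
  proof -
    have "norm (F k M) = norm (f M) * ((norm z * norm (q M)) ^ k / fact k)"
      by (simp add: F_def norm_mult norm_divide norm_power power_mult_distrib)
    also have "\<dots> \<le> B * ((norm z * C) ^ k / fact k)"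
      using B[OF that] C[OF that] order_trans[OF norm_ge_zero B[OF that]]
      by (intro mult_mono divide_right_mono power_mono) (auto intro: mult_left_mono order_trans)
    finally show ?thesis .
  qed
  have summ: "summable (\<lambda>k. B * ((norm z * C) ^ k / fact k))"
    using summable_exp[of "norm z * C"] by (intro summable_mult) (simp add: divide_inverse mult.commute)
  have sumsF: "(\<lambda>k. F k M) sums (f M * exp (z * q M))" for M
  proof -
    have "(\<lambda>k. (z * q M) ^ k /\<^sub>R fact k) sums exp (z * q M)" by (rule exp_converges)
    hence "(\<lambda>k. f M * ((z * q M) ^ k /\<^sub>R fact k)) sums (f M * exp (z * q M))" by (rule sums_mult)
    thus ?thesis by (simp add: F_def scaleR_conv_of_real divide_inverse power_mult_distrib mult_ac)
  qed
  have "(\<lambda>k. \<integral>M. F k M \<partial>H) sums (\<integral>M. suminf (\<lambda>k. F k M) \<partial>H)"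
  proof (rule sums_integral[OF int])
    show "AE M in H. summable (\<lambda>k. norm (F k M))"
    proof (rule AE_I2)
      fix M assume "M \<in> space H"
      hence "M \<in> unitary_group" by (simp add: haar_space[OF H])
      thus "summable (\<lambda>k. norm (F k M))"
        using bound by (intro summable_comparison_test'[OF summ, of 0]) auto
    qed
    show "summable (\<lambda>k. \<integral>M. norm (F k M) \<partial>H)"
    proof (rule summable_comparison_test'[OF summ, of 0])
      fix k
      have "(\<integral>M. norm (F k M) \<partial>H) \<le> (\<integral>M. B * ((norm z * C) ^ k / fact k) \<partial>H)"
        using bound by (intro integral_mono integrable_norm int) (auto simp: haar_space[OF H])
      thus "norm (\<integral>M. norm (F k M) \<partial>H) \<le> B * ((norm z * C) ^ k / fact k)"
        by (simp add: prob_space)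
    qed
  qed
  moreover have "suminf (\<lambda>k. F k M) = f M * exp (z * q M)" for M using sumsF sums_unique by metis
  moreover have "(\<integral>M. F k M \<partial>H) = z ^ k / fact k * (\<integral>M. f M * q M ^ k \<partial>H)" for k
    by (simp add: F_def)
  ultimately show ?thesis by simp
qed

lemma walks_generating_function:
  fixes H :: "(complex^'n^'n) measure"
  assumes H: "normalized_haar H"
    and x: "length x = CARD('n)" "sorted_wrt (<) x"
    and y: "length y = CARD('n)" "sorted_wrt (<) y"
    and mu: "is_partition mu" "num_parts mu \<le> CARD('n)"
    and lam: "is_partition lam" "num_parts lam \<le> CARD('n)"
    and mux: "\<forall>j<CARD('n). int (mu (CARD('n) - 1 - j)) = int (x ! j) - int j"
    and lamy: "\<forall>j<CARD('n). int (lam (CARD('n) - 1 - j)) = int (y ! j) - int j"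
  shows "(\<lambda>k. z ^ k / fact k * of_nat (num_walks k (map int x) (map int y)))
           sums schur_integral H lam mu z"
proof -
  let ?n = "CARD('n)"
  let ?s = "\<lambda>lam (M :: complex^'n^'n). jdet ?n (ptr M) (shifted ?n lam)"
  let ?q = "\<lambda>M :: complex^'n^'n. ptr M 1 + cnj (ptr M 1)"
  have link: "shifted ?n nu i = map int u ! (?n - Suc i)"
    if "length u = ?n" "\<forall>j<?n. int (nu (?n - 1 - j)) = int (u ! j) - int j" "i < ?n" for nu u i
  proof -
    have "?n - 1 - (?n - Suc i) = i" using that(3) by simp
    with that(2)[rule_format, of "?n - Suc i"] have "int (nu i) = int (u ! (?n - Suc i)) - int (?n - Suc i)"
      using that(3) by (simp only: diff_Suc_less zero_less_card_finite)
    thus ?thesis using that by (simp add: shifted_def staircase_eq)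
  qed
  have walks: "(\<integral>M. ?s lam M * cnj (?s mu M) * ?q M ^ k \<partial>H) = of_nat (num_walks k (map int x) (map int y))" for k
  proof -
    have "(\<integral>M. ?s mu M * cnj (?s lam M) * ?q M ^ k \<partial>H) = of_nat (num_walks k (map int x) (map int y))"
      by (rule haar_schur_walks[OF H])
         (use x y link[OF x(1) mux] link[OF y(1) lamy] in \<open>auto simp: sorted_wrt_map shifted_nonneg\<close>)
    \<comment> \<open>The pairing puts the start of the walk on the unconjugated factor, the
      integral to be evaluated has it on the conjugated one. Conjugation exchanges them and fixes
      the number of walks, which is real.\<close>
    hence "cnj (\<integral>M. ?s mu M * cnj (?s lam M) * ?q M ^ k \<partial>H) = of_nat (num_walks k (map int x) (map int y))"
      by simp
    moreover have "cnj (\<integral>M. ?s mu M * cnj (?s lam M) * ?q M ^ k \<partial>H) =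
        (\<integral>M. cnj (?s mu M * cnj (?s lam M) * ?q M ^ k) \<partial>H)"
      by (rule Bochner_Integration.integral_cnj[symmetric])
    ultimately show ?thesis by (simp add: mult.commute add.commute)
  qed
  have "(\<lambda>k. z ^ k / fact k * (\<integral>M. ?s lam M * cnj (?s mu M) * ?q M ^ k \<partial>H)) sums
     (\<integral>M. ?s lam M * cnj (?s mu M) * exp (z * ?q M) \<partial>H)"
    by (intro haar_sums_exp[OF H] continuous_on_mult continuous_on_cnj continuous_on_jdet_ptr continuous_on_hop_ptr)
  thus ?thesis by (simp only: walks schur_integral_eq[OF lam mu])
qed

section \<open>Schur functions in formal variables\<close>

declare One_nat_def [simp del]

lemma mcoeff_Abs [simp]: "mcoeff (Abs_mfps f) m = f m"
  by (simp add: Abs_mfps_inverse)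

lemma mcoeff_add [simp]: "mcoeff (f + g) m = mcoeff f m + mcoeff g m"
  and mcoeff_0 [simp]: "mcoeff 0 m = 0"
  and mcoeff_1: "mcoeff 1 m = (if m = 0 then 1 else 0)"
  and mcoeff_uminus [simp]: "mcoeff (- f) m = - mcoeff f m"
  and mcoeff_diff [simp]: "mcoeff (f - g) m = mcoeff f m - mcoeff g m"
  and mcoeff_mconst: "mcoeff (mconst c) m = (if m = 0 then c else 0)"
  and mcoeff_mvar: "mcoeff (mvar v) m = (if m = Poly_Mapping.single v 1 then 1 else 0)"
  by (simp_all add: plus_mfps.rep_eq zero_mfps.rep_eq one_mfps.rep_eq uminus_mfps.rep_eq minus_mfps.rep_eq
      mconst.rep_eq mvar.rep_eq)

lemma mcoeff_mult: "mcoeff (f * g) m = (\<Sum>p\<in>splits m. mcoeff f (fst p) * mcoeff g (snd p))"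
  by (simp add: times_mfps.rep_eq case_prod_beta)

lemma mcoeff_sum: "mcoeff (\<Sum>a\<in>A. f a) m = (\<Sum>a\<in>A. mcoeff (f a) m)"
  by (induction A rule: infinite_finite_induct) auto

lemma mcoeff_formal_sum: "mcoeff (formal_sum f A) m = (\<Sum>a | a \<in> A \<and> mcoeff (f a) m \<noteq> 0. mcoeff (f a) m)"
  by (simp add: formal_sum_def)

lemma mcoeff_mconst_mult:
  fixes f :: "'v mfps"
  shows "mcoeff (mconst c * f) m = c * mcoeff f m"
proof -
  have "mcoeff (mconst c * f) m = (\<Sum>p\<in>{(0, m)}. mcoeff (mconst c :: 'v mfps) (fst p) * mcoeff f (snd p))"
    unfolding mcoeff_mult
    by (rule sum.mono_neutral_right[OF finite_splits]) (auto simp: splits_def mcoeff_mconst)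
  thus ?thesis by (simp add: mcoeff_mconst)
qed

lemma mconst_mult: "mconst (a * b) = mconst a * mconst b"
  by (rule mfps_eqI) (simp add: mcoeff_mconst_mult mcoeff_mconst)

lemma mconst_1: "mconst 1 = 1"
  by (rule mfps_eqI) (simp add: mcoeff_mconst mcoeff_1)

lemma mconst_prod: "mconst (\<Prod>a\<in>A. f a) = (\<Prod>a\<in>A. mconst (f a))"
  by (induction A rule: infinite_finite_induct) (auto simp: mconst_1 mconst_mult)

lemma of_nat_eq_mconst: "(of_nat k :: 'v mfps) = mconst (of_nat k)"
proof (induction k)
  case 0
  show ?case by (rule mfps_eqI) (simp add: mcoeff_mconst)
next
  case (Suc k)
  show ?case unfolding of_nat_Suc Suc by (rule mfps_eqI) (simp add: mcoeff_mconst mcoeff_1)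
qed

lemma of_int_sign_eq_mconst: "(of_int (sign \<sigma>) :: 'v mfps) = mconst (of_int (sign \<sigma>))"
  by (rule mfps_eqI) (simp add: sign_def mcoeff_mconst mcoeff_1)

section \<open>Weighted degree and exponential series\<close>

text \<open>Used with two weights: the constant 1, which orders the exponential series by total
  degree, and the index of a variable, for which Schur polynomials are homogeneous.\<close>

definition mdeg :: "('v \<Rightarrow> nat) \<Rightarrow> ('v \<Rightarrow>\<^sub>0 nat) \<Rightarrow> nat" where
  "mdeg w m = (\<Sum>v\<in>Poly_Mapping.keys m. w v * Poly_Mapping.lookup m v)"

lemma mdeg_superset:
  "finite V \<Longrightarrow> Poly_Mapping.keys m \<subseteq> V \<Longrightarrow> mdeg w m = (\<Sum>v\<in>V. w v * Poly_Mapping.lookup m v)"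
  unfolding mdeg_def by (rule sum.mono_neutral_left) (auto simp: in_keys_iff)

lemma mdeg_0 [simp]: "mdeg w 0 = 0"
  by (simp add: mdeg_def)

lemma mdeg_add: "mdeg w (a + b) = mdeg w a + mdeg w b"
proof -
  let ?V = "Poly_Mapping.keys a \<union> Poly_Mapping.keys b"
  have "mdeg w (a + b) = (\<Sum>v\<in>?V. w v * Poly_Mapping.lookup (a + b) v)"
    by (rule mdeg_superset; simp add: Poly_Mapping.keys_add)
  moreover have "mdeg w a = (\<Sum>v\<in>?V. w v * Poly_Mapping.lookup a v)"
    "mdeg w b = (\<Sum>v\<in>?V. w v * Poly_Mapping.lookup b v)"
    by (intro mdeg_superset; simp)+
  ultimately show ?thesis by (simp add: lookup_add distrib_left sum.distrib)
qed

lemma mdeg_single: "mdeg w (Poly_Mapping.single v 1) = w v"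
  by (simp add: mdeg_def)

lemma minus_single_add:
  assumes "v \<in> Poly_Mapping.keys m"
  shows "Poly_Mapping.single v (1 :: nat) + (m - Poly_Mapping.single v 1) = m"
proof (rule poly_mapping_eqI)
  fix u
  show "Poly_Mapping.lookup (Poly_Mapping.single v 1 + (m - Poly_Mapping.single v 1)) u = Poly_Mapping.lookup m u"
    using assms by (auto simp: lookup_add lookup_minus lookup_single when_def in_keys_iff)
qed

lemma mdeg_minus_single:
  "v \<in> Poly_Mapping.keys m \<Longrightarrow> mdeg w m = w v + mdeg w (m - Poly_Mapping.single v 1)"
  using mdeg_add[of w "Poly_Mapping.single v 1" "m - Poly_Mapping.single v 1"] minus_single_add[of v m]
  by (simp add: mdeg_single)

text \<open>The possibly infinite linear combination of all variables with coefficients c. At most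
  one summand is nonzero for each monomial.\<close>

definition linear_form :: "('v \<Rightarrow> complex) \<Rightarrow> 'v mfps" where
  "linear_form c = Abs_mfps (\<lambda>m. \<Sum>v\<in>Poly_Mapping.keys m. if m = Poly_Mapping.single v 1 then c v else 0)"

lemma mcoeff_linear_form_single [simp]: "mcoeff (linear_form c) (Poly_Mapping.single v 1) = c v"
  by (simp add: linear_form_def)

lemma mcoeff_linear_form_eq_0: "(\<And>v. m \<noteq> Poly_Mapping.single v 1) \<Longrightarrow> mcoeff (linear_form c) m = 0"
  by (simp add: linear_form_def)

lemma mcoeff_linear_form_mult:
  "mcoeff (linear_form c * f) m =
     (\<Sum>v\<in>Poly_Mapping.keys m. c v * mcoeff f (m - Poly_Mapping.single v 1))"
proof -
  define h where "h = (\<lambda>v. (Poly_Mapping.single v (1 :: nat), m - Poly_Mapping.single v 1))"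
  have inj: "inj_on h (Poly_Mapping.keys m)"
  proof (rule inj_onI)
    fix u v assume "h u = h v"
    hence "Poly_Mapping.keys (Poly_Mapping.single u (1 :: nat)) = Poly_Mapping.keys (Poly_Mapping.single v (1 :: nat))"
      by (simp add: h_def)
    thus "u = v" by simp
  qed
  have "mcoeff (linear_form c * f) m = (\<Sum>p\<in>h ` Poly_Mapping.keys m. mcoeff (linear_form c) (fst p) * mcoeff f (snd p))"
    unfolding mcoeff_mult
  proof (rule sum.mono_neutral_right[OF finite_splits])
    show "h ` Poly_Mapping.keys m \<subseteq> splits m"
      by (auto simp: h_def splits_def minus_single_add)
    show "\<forall>p\<in>splits m - h ` Poly_Mapping.keys m. mcoeff (linear_form c) (fst p) * mcoeff f (snd p) = 0"
    proof
      fix p assume p: "p \<in> splits m - h ` Poly_Mapping.keys m"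
      obtain a b where ab: "p = (a, b)" "a + b = m" using p by (cases p) (auto simp: splits_def)
      have "a \<noteq> Poly_Mapping.single v 1" for v
      proof
        assume a: "a = Poly_Mapping.single v 1"
        have "Poly_Mapping.lookup m v = 1 + Poly_Mapping.lookup b v"
          using ab(2) a by (auto simp: lookup_add)
        hence "v \<in> Poly_Mapping.keys m" by (simp add: in_keys_iff)
        moreover have "b = m - Poly_Mapping.single v 1" using ab(2) a by auto
        ultimately show False using p ab a by (auto simp: h_def)
      qed
      thus "mcoeff (linear_form c) (fst p) * mcoeff f (snd p) = 0"
        by (simp add: mcoeff_linear_form_eq_0 ab)
    qed
  qed
  also have "\<dots> = (\<Sum>v\<in>Poly_Mapping.keys m. c v * mcoeff f (m - Poly_Mapping.single v 1))"
    unfolding sum.reindex[OF inj] o_def by (rule sum.cong) (use mcoeff_linear_form_single[of c] in \<open>auto simp: h_def\<close>)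
  finally show ?thesis .
qed

lemma linear_form_add: "linear_form (\<lambda>v. c v + d v) = linear_form c + linear_form d"
proof (rule mfps_eqI)
  fix m
  have "mcoeff (linear_form (\<lambda>v. c v + d v)) m =
     (\<Sum>v\<in>Poly_Mapping.keys m. (if m = Poly_Mapping.single v 1 then c v else 0) +
        (if m = Poly_Mapping.single v 1 then d v else 0))"
    unfolding linear_form_def mcoeff_Abs by (intro sum.cong) auto
  thus "mcoeff (linear_form (\<lambda>v. c v + d v)) m = mcoeff (linear_form c + linear_form d) m"
    by (simp only: sum.distrib mcoeff_add) (simp only: linear_form_def mcoeff_Abs)
qed

text \<open>The exponential of the linear form with coefficients c, given directly by its
  multinomial coefficients; the agreement with \<open>mexp\<close> is
  \<open>mexp_linear_form\<close>.\<close>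

definition exp_series :: "('v \<Rightarrow> complex) \<Rightarrow> 'v mfps" where
  "exp_series c = Abs_mfps (\<lambda>m. \<Prod>v\<in>Poly_Mapping.keys m.
     c v ^ Poly_Mapping.lookup m v / fact (Poly_Mapping.lookup m v))"

lemma mcoeff_exp_series_superset:
  "finite V \<Longrightarrow> Poly_Mapping.keys m \<subseteq> V \<Longrightarrow>
     mcoeff (exp_series c) m = (\<Prod>v\<in>V. c v ^ Poly_Mapping.lookup m v / fact (Poly_Mapping.lookup m v))"
  unfolding exp_series_def mcoeff_Abs by (rule prod.mono_neutral_left) (auto simp: in_keys_iff)

lemma mcoeff_exp_series_0 [simp]: "mcoeff (exp_series c) 0 = 1"
  by (simp add: exp_series_def)

lemma mcoeff_exp_series_eq_0:
  "v \<in> Poly_Mapping.keys m \<Longrightarrow> c v = 0 \<Longrightarrow> mcoeff (exp_series c) m = 0"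
  unfolding exp_series_def mcoeff_Abs by (rule prod_zero) (auto simp: in_keys_iff)

text \<open>The equation that the partial derivative of the exponential in the variable v is
  \<open>c v\<close> times the exponential, read off at one monomial.\<close>

lemma mcoeff_exp_series_lower:
  assumes v: "v \<in> Poly_Mapping.keys m"
  shows "c v * mcoeff (exp_series c) (m - Poly_Mapping.single v 1) =
     of_nat (Poly_Mapping.lookup m v) * mcoeff (exp_series c) m"
proof -
  let ?K = "Poly_Mapping.keys m" and ?l = "Poly_Mapping.lookup m"
  obtain k where k: "?l v = Suc k" using v by (cases "?l v") (auto simp: in_keys_iff)
  have l: "Poly_Mapping.lookup (m - Poly_Mapping.single v 1) u = (if u = v then k else ?l u)" for u
    using k by (auto simp: lookup_minus lookup_single when_def)
  have "Poly_Mapping.keys (m - Poly_Mapping.single v 1) \<subseteq> ?K"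
    using v by (auto simp: in_keys_iff l split: if_splits)
  hence "mcoeff (exp_series c) (m - Poly_Mapping.single v 1) =
      (\<Prod>u\<in>?K. c u ^ (if u = v then k else ?l u) / fact (if u = v then k else ?l u))"
    by (subst mcoeff_exp_series_superset[of ?K]) (auto simp: l)
  also have "\<dots> = c v ^ k / fact k * (\<Prod>u\<in>?K - {v}. c u ^ ?l u / fact (?l u))"
    using v by (subst prod.remove[of ?K v]) (auto intro!: prod.cong)
  finally have 1: "mcoeff (exp_series c) (m - Poly_Mapping.single v 1) =
      c v ^ k / fact k * (\<Prod>u\<in>?K - {v}. c u ^ ?l u / fact (?l u))" .
  have 2: "mcoeff (exp_series c) m = c v ^ Suc k / fact (Suc k) * (\<Prod>u\<in>?K - {v}. c u ^ ?l u / fact (?l u))"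
    using v k by (subst mcoeff_exp_series_superset[of ?K], simp, simp, subst prod.remove[of ?K v]) auto
  have "of_nat (Suc k) * (c v ^ Suc k / fact (Suc k)) = c v * (c v ^ k / fact k)"
    by (simp add: divide_simps del: of_nat_Suc)
  thus ?thesis unfolding 1 2 k by (simp only: mult.assoc[symmetric])
qed

text \<open>The Euler operator with weights w, a derivation that multiplies each monomial by its
  weighted degree.\<close>

definition mder :: "('v \<Rightarrow> nat) \<Rightarrow> 'v mfps \<Rightarrow> 'v mfps" where
  "mder w f = Abs_mfps (\<lambda>m. of_nat (mdeg w m) * mcoeff f m)"

lemma mder_mult: "mder w (f * g) = mder w f * g + f * mder w g"
proof (rule mfps_eqI)
  fix m
  have "of_nat (mdeg w m) * (mcoeff f (fst p) * mcoeff g (snd p)) =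
      of_nat (mdeg w (fst p)) * mcoeff f (fst p) * mcoeff g (snd p) +
      mcoeff f (fst p) * (of_nat (mdeg w (snd p)) * mcoeff g (snd p))" if "p \<in> splits m" for p
  proof -
    have "mdeg w m = mdeg w (fst p) + mdeg w (snd p)"
      using that mdeg_add[of w "fst p" "snd p"] by (auto simp: splits_def)
    thus ?thesis by (simp add: algebra_simps)
  qed
  note leibniz = this
  have "mcoeff (mder w (f * g)) m = (\<Sum>p\<in>splits m. of_nat (mdeg w m) * (mcoeff f (fst p) * mcoeff g (snd p)))"
    by (simp only: mder_def mcoeff_Abs mcoeff_mult sum_distrib_left)
  also have "\<dots> = (\<Sum>p\<in>splits m. of_nat (mdeg w (fst p)) * mcoeff f (fst p) * mcoeff g (snd p) +
      mcoeff f (fst p) * (of_nat (mdeg w (snd p)) * mcoeff g (snd p)))"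
    by (intro sum.cong refl leibniz)
  also have "\<dots> = mcoeff (mder w f * g + f * mder w g) m"
    by (simp only: sum.distrib mcoeff_add mcoeff_mult mder_def mcoeff_Abs)
  finally show "mcoeff (mder w (f * g)) m = mcoeff (mder w f * g + f * mder w g) m" .
qed

lemma mder_exp_series: "mder w (exp_series c) = linear_form (\<lambda>v. of_nat (w v) * c v) * exp_series c"
proof (rule mfps_eqI)
  fix m
  have "mcoeff (linear_form (\<lambda>v. of_nat (w v) * c v) * exp_series c) m =
     (\<Sum>v\<in>Poly_Mapping.keys m. of_nat (w v * Poly_Mapping.lookup m v) * mcoeff (exp_series c) m)"
    unfolding mcoeff_linear_form_mult
    by (intro sum.cong refl) (simp add: mult.assoc mcoeff_exp_series_lower del: One_nat_def)
  thus "mcoeff (mder w (exp_series c)) m = mcoeff (linear_form (\<lambda>v. of_nat (w v) * c v) * exp_series c) m"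
    by (simp add: mder_def mdeg_def sum_distrib_right)
qed

text \<open>The differential equation expresses a coefficient of total degree d > 0 through
  coefficients of degree d - 1, and the constant term starts the recursion.\<close>

lemma exp_series_unique:
  assumes f0: "mcoeff f 0 = 1" and der: "mder (\<lambda>_. 1) f = linear_form c * f"
  shows "f = exp_series c"
proof (rule mfps_eqI)
  fix m
  show "mcoeff f m = mcoeff (exp_series c) m"
  proof (induction "mdeg (\<lambda>_. 1) m" arbitrary: m rule: less_induct)
    case less
    show ?case
    proof (cases "m = 0")
      case False
      have rec: "of_nat (mdeg (\<lambda>_. 1) m) * mcoeff g m =
          (\<Sum>v\<in>Poly_Mapping.keys m. c v * mcoeff g (m - Poly_Mapping.single v 1))"
        if "mder (\<lambda>_. 1) g = linear_form c * g" for g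
        using arg_cong[OF that, of "\<lambda>h. mcoeff h m"] unfolding mcoeff_linear_form_mult by (simp add: mder_def)
      obtain v where "v \<in> Poly_Mapping.keys m" using False by fastforce
      hence pos: "mdeg (\<lambda>_. 1) m > 0" using mdeg_minus_single[of v m "\<lambda>_. 1"] by simp
      have "of_nat (mdeg (\<lambda>_. 1) m) * mcoeff f m =
          (\<Sum>v\<in>Poly_Mapping.keys m. c v * mcoeff (exp_series c) (m - Poly_Mapping.single v 1))"
        unfolding rec[OF der]
      proof (rule sum.cong)
        fix v assume "v \<in> Poly_Mapping.keys m"
        hence "mdeg (\<lambda>_. 1) (m - Poly_Mapping.single v 1) < mdeg (\<lambda>_. 1) m"
          using mdeg_minus_single[of v m "\<lambda>_. 1"] by simp
        thus "c v * mcoeff f (m - Poly_Mapping.single v 1) = c v * mcoeff (exp_series c) (m - Poly_Mapping.single v 1)"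
          using less by simp
      qed simp
      also have "\<dots> = of_nat (mdeg (\<lambda>_. 1) m) * mcoeff (exp_series c) m"
        by (rule rec[symmetric]) (simp add: mder_exp_series)
      finally show ?thesis using pos by simp
    qed (simp add: f0)
  qed
qed

lemma exp_series_mult: "exp_series c * exp_series d = exp_series (\<lambda>v. c v + d v)"
proof (rule exp_series_unique)
  have "splits (0 :: 'a \<Rightarrow>\<^sub>0 nat) = {(0, 0)}"
  proof -
    have "p = (0, 0)" if "p \<in> splits 0" for p :: "('a \<Rightarrow>\<^sub>0 nat) \<times> ('a \<Rightarrow>\<^sub>0 nat)"
    proof -
      have "fst p + snd p = 0" using that by (auto simp: splits_def)
      hence "Poly_Mapping.lookup (fst p + snd p) u = 0" for u by simp
      hence "Poly_Mapping.lookup (fst p) u = 0" "Poly_Mapping.lookup (snd p) u = 0" for u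
        by (simp_all add: lookup_add)
      thus ?thesis by (intro prod_eqI poly_mapping_eqI) simp_all
    qed
    moreover have "(0, 0) \<in> splits (0 :: 'a \<Rightarrow>\<^sub>0 nat)" by (simp add: splits_def)
    ultimately show ?thesis by blast
  qed
  thus "mcoeff (exp_series c * exp_series d) 0 = 1" by (simp add: mcoeff_mult)
  show "mder (\<lambda>_. 1) (exp_series c * exp_series d) = linear_form (\<lambda>v. c v + d v) * (exp_series c * exp_series d)"
    by (simp add: mder_mult mder_exp_series linear_form_add algebra_simps)
qed

text \<open>The multinomial theorem: k! times the product of the c_v^{m_v} / m_v! in total degree k.
  Hence exactly one power contributes to each coefficient of the exponential.\<close>

lemma mcoeff_linear_form_power:
  "mcoeff (linear_form c ^ k) m = (if mdeg (\<lambda>_. 1) m = k then fact k * mcoeff (exp_series c) m else 0)"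
proof (induction k arbitrary: m)
  case 0
  have "mdeg (\<lambda>_. 1) m = 0 \<longleftrightarrow> m = 0"
    by (auto simp: mdeg_def in_keys_iff intro!: poly_mapping_eqI)
  thus ?case by (auto simp: mcoeff_1)
next
  case (Suc k)
  have "mcoeff (linear_form c ^ Suc k) m =
      (\<Sum>v\<in>Poly_Mapping.keys m. if mdeg (\<lambda>_. 1) m = Suc k
         then fact k * (of_nat (1 * Poly_Mapping.lookup m v) * mcoeff (exp_series c) m) else 0)"
    unfolding power_Suc mcoeff_linear_form_mult Suc
  proof (rule sum.cong)
    fix v assume v: "v \<in> Poly_Mapping.keys m"
    show "c v * (if mdeg (\<lambda>_. 1) (m - Poly_Mapping.single v 1) = k
        then fact k * mcoeff (exp_series c) (m - Poly_Mapping.single v 1) else 0) =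
      (if mdeg (\<lambda>_. 1) m = Suc k then fact k * (of_nat (1 * Poly_Mapping.lookup m v) * mcoeff (exp_series c) m) else 0)"
      using mcoeff_exp_series_lower[OF v, of c] mdeg_minus_single[OF v, of "\<lambda>_. 1"]
      by (simp add: mult.left_commute del: One_nat_def)
  qed simp
  also have "\<dots> = (if mdeg (\<lambda>_. 1) m = Suc k then fact k * (of_nat (mdeg (\<lambda>_. 1) m) * mcoeff (exp_series c) m) else 0)"
  proof -
    have "(\<Sum>v\<in>Poly_Mapping.keys m. fact k * (of_nat (1 * Poly_Mapping.lookup m v) * mcoeff (exp_series c) m)) =
        fact k * (of_nat (mdeg (\<lambda>_. 1) m) * mcoeff (exp_series c) m)"
      unfolding mdeg_def of_nat_sum sum_distrib_right sum_distrib_left ..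
    thus ?thesis by (cases "mdeg (\<lambda>_. 1) m = Suc k") (simp_all del: of_nat_Suc)
  qed
  finally show ?case by (auto simp: algebra_simps)
qed

lemma mexp_linear_form:
  fixes c :: "'v \<Rightarrow> complex"
  shows "mexp (linear_form c) = exp_series c"
proof (rule mfps_eqI)
  fix m :: "'v \<Rightarrow>\<^sub>0 nat"
  let ?d = "mdeg (\<lambda>_. 1) m"
  have coeff: "mcoeff (mconst (1 / fact k) * linear_form c ^ k) m = (if ?d = k then mcoeff (exp_series c) m else 0)" for k
    by (simp add: mcoeff_mconst_mult mcoeff_linear_form_power)
  have "mcoeff (mexp (linear_form c)) m = (\<Sum>k | (if ?d = k then mcoeff (exp_series c) m else 0) \<noteq> 0.
      if ?d = k then mcoeff (exp_series c) m else 0)"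
    by (simp only: mexp_def mcoeff_formal_sum coeff UNIV_I simp_thms)
  also have "\<dots> = (\<Sum>k\<in>{?d}. if ?d = k then mcoeff (exp_series c) m else 0)"
    by (rule sum.mono_neutral_left) auto
  finally show "mcoeff (mexp (linear_form c)) m = mcoeff (exp_series c) m" by simp
qed

definition homogeneous :: "('v \<Rightarrow> nat) \<Rightarrow> int \<Rightarrow> 'v mfps \<Rightarrow> bool" where
  "homogeneous w k f \<longleftrightarrow> (\<forall>m. mcoeff f m \<noteq> 0 \<longrightarrow> int (mdeg w m) = k)"

lemma homogeneous_mult:
  assumes "homogeneous w k f" "homogeneous w l g"
  shows "homogeneous w (k + l) (f * g)"
  unfolding homogeneous_def
proof (intro allI impI)
  fix m assume "mcoeff (f * g) m \<noteq> 0"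
  then obtain p where p: "p \<in> splits m" "mcoeff f (fst p) * mcoeff g (snd p) \<noteq> 0"
    unfolding mcoeff_mult by (rule sum.not_neutral_contains_not_neutral)
  hence "int (mdeg w (fst p)) = k" "int (mdeg w (snd p)) = l"
    using assms by (auto simp: homogeneous_def)
  moreover have "m = fst p + snd p" using p(1) by (auto simp: splits_def)
  ultimately show "int (mdeg w m) = k + l" by (simp add: mdeg_add)
qed

lemma homogeneous_prod:
  assumes "finite A" "\<And>a. a \<in> A \<Longrightarrow> homogeneous w (k a) (f a)"
  shows "homogeneous w (\<Sum>a\<in>A. k a) (\<Prod>a\<in>A. f a)"
  using assms
proof (induction A rule: finite_induct)
  case empty
  show ?case by (simp add: homogeneous_def mcoeff_1)
next
  case (insert a A)
  thus ?case by (simp add: homogeneous_mult)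
qed

lemma homogeneous_sum:
  assumes "\<And>a. a \<in> A \<Longrightarrow> homogeneous w k (f a)"
  shows "homogeneous w k (\<Sum>a\<in>A. f a)"
  unfolding homogeneous_def
proof (intro allI impI)
  fix m assume "mcoeff (\<Sum>a\<in>A. f a) m \<noteq> 0"
  then obtain a where "a \<in> A" "mcoeff (f a) m \<noteq> 0"
    unfolding mcoeff_sum by (rule sum.not_neutral_contains_not_neutral)
  thus "int (mdeg w m) = k" using assms by (auto simp: homogeneous_def)
qed

lemma homogeneous_mconst_mult: "homogeneous w k f \<Longrightarrow> homogeneous w k (mconst c * f)"
  by (auto simp: homogeneous_def mcoeff_mconst_mult)

section \<open>Schur polynomials in one family of formal variables\<close>

text \<open>One argument for both families: the i-th argument of the Schur polynomials is s times
  the variable \<open>\<iota> i\<close>, with s = 1 for the t_i and s = -1 for the s_i. The weight w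
  recovers the index and is a common grading for both families.\<close>

locale var_family =
  fixes \<iota> :: "nat \<Rightarrow> 'v" and w :: "'v \<Rightarrow> nat" and s :: complex
  assumes w_iota [simp]: "w (\<iota> i) = i"
begin

text \<open>The coefficients for which \<open>exp_series (fam p)\<close> is the exponential of the
  sum over i >= 1 of s p_i times the i-th variable; variables outside the family get 0.\<close>

definition fam :: "(nat \<Rightarrow> complex) \<Rightarrow> 'v \<Rightarrow> complex" where
  "fam p v = (if \<exists>i\<ge>1. v = \<iota> i then s * p (w v) else 0)"

definition tvar :: "nat \<Rightarrow> 'v mfps" where
  "tvar i = linear_form (\<lambda>v. if v = \<iota> i then s else 0)"

lemma inj_iota: "inj \<iota>"
  by (rule inj_on_inverseI[of _ w]) simp

lemma mcoeff_tvar_mult: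
  "mcoeff (tvar i * f) m =
     (if \<iota> i \<in> Poly_Mapping.keys m then s * mcoeff f (m - Poly_Mapping.single (\<iota> i) 1) else 0)"
proof -
  have "mcoeff (tvar i * f) m =
      (\<Sum>v\<in>Poly_Mapping.keys m. if v = \<iota> i then s * mcoeff f (m - Poly_Mapping.single (\<iota> i) 1) else 0)"
    unfolding tvar_def mcoeff_linear_form_mult by (intro sum.cong) auto
  thus ?thesis by (simp add: sum.delta')
qed

lemma fam_iota: "i \<ge> 1 \<Longrightarrow> fam p (\<iota> i) = s * p i"
  by (auto simp: fam_def)

text \<open>The elementary Schur polynomial is the part of weight k of the exponential of the sum of
  the arguments. Newton's recursion on the left matches, on the right, the fact that the i-weighted
  exponents of a monomial add up to its weight.\<close>

lemma elem_schur_tvar_nat: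
  "mcoeff (elem_schur tvar (int k)) m = (if mdeg w m = k then mcoeff (exp_series (fam (\<lambda>_. 1))) m else 0)"
proof (induction k arbitrary: m rule: less_induct)
  case (less k)
  let ?c = "fam (\<lambda>_. 1)" and ?K = "Poly_Mapping.keys m" and ?l = "Poly_Mapping.lookup m"
  let ?E = "mcoeff (exp_series ?c)"
  have supp: "\<exists>i\<ge>1. v = \<iota> i" if "?E m \<noteq> 0" "v \<in> ?K" for v
  proof -
    have "?c v \<noteq> 0" using mcoeff_exp_series_eq_0[OF that(2), of ?c] that(1) by blast
    thus ?thesis unfolding fam_def by presburger
  qed
  show ?case
  proof (cases "k = 0")
    case True
    \<comment> \<open>The exponential involves only variables of index at least 1, so no monomial
      other than 1 has weight 0 and a nonzero coefficient.\<close>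
    have "?E m = (if m = 0 then 1 else 0)" if deg: "mdeg w m = 0"
    proof (cases "m = 0")
      case False
      then obtain v where v: "v \<in> ?K" by fastforce
      hence "w v = 0" using deg mdeg_minus_single[OF v, of w] by simp
      hence "?E m = 0" using supp[OF _ v] by force
      thus ?thesis using False by simp
    qed simp
    thus ?thesis using True by (auto simp: mcoeff_1)
  next
    case False
    have "of_nat k * mcoeff (elem_schur tvar (int k)) m =
        mcoeff (\<Sum>i=1..k. of_nat i * tvar i * elem_schur tvar (int k - int i)) m"
    proof -
      have "mcoeff (of_nat k * elem_schur tvar (int k)) m = of_nat k * mcoeff (elem_schur tvar (int k)) m"
        unfolding of_nat_eq_mconst[where 'v = 'v] by (rule mcoeff_mconst_mult)
      thus ?thesis by (simp only: elem_schur_newton)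
    qed
    also have "\<dots> = (\<Sum>i=1..k. if mdeg w m = k then of_nat (i * ?l (\<iota> i)) * ?E m else 0)"
      unfolding mcoeff_sum
    proof (rule sum.cong)
      fix i assume i: "i \<in> {1..k}"
      have ki: "int k - int i = int (k - i)" using i by auto
      have "mcoeff (of_nat i * tvar i * elem_schur tvar (int k - int i)) m =
          of_nat i * (if \<iota> i \<in> ?K then s * mcoeff (elem_schur tvar (int (k - i))) (m - Poly_Mapping.single (\<iota> i) 1) else 0)"
        unfolding of_nat_eq_mconst mult.assoc mcoeff_mconst_mult mcoeff_tvar_mult ki ..
      also have "\<dots> = (if mdeg w m = k then of_nat (i * ?l (\<iota> i)) * ?E m else 0)"
      proof (cases "\<iota> i \<in> ?K")
        case True
        have "mcoeff (elem_schur tvar (int (k - i))) (m - Poly_Mapping.single (\<iota> i) 1) =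
            (if mdeg w m = k then ?E (m - Poly_Mapping.single (\<iota> i) 1) else 0)"
          using less[of "k - i" "m - Poly_Mapping.single (\<iota> i) 1"] i mdeg_minus_single[OF True, of w] by auto
        moreover have "s * ?E (m - Poly_Mapping.single (\<iota> i) 1) = of_nat (?l (\<iota> i)) * ?E m"
          using mcoeff_exp_series_lower[OF True, of ?c] i by (simp add: fam_iota)
        ultimately show ?thesis using True by simp
      qed (simp add: in_keys_iff)
      finally show "mcoeff (of_nat i * tvar i * elem_schur tvar (int k - int i)) m =
          (if mdeg w m = k then of_nat (i * ?l (\<iota> i)) * ?E m else 0)" .
    qed simp
    also have "\<dots> = (if mdeg w m = k then of_nat k * ?E m else 0)"
    proof (cases "mdeg w m = k \<and> ?E m \<noteq> 0")
      case True
      have "?K \<subseteq> \<iota> ` {1..k}"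
      proof
        fix v assume v: "v \<in> ?K"
        then obtain i where i: "i \<ge> 1" "v = \<iota> i" using supp True by blast
        have "i \<le> k" using mdeg_minus_single[OF v, of w] True i by simp
        with i show "v \<in> \<iota> ` {1..k}" by auto
      qed
      hence "mdeg w m = (\<Sum>v\<in>\<iota> ` {1..k}. w v * ?l v)" by (intro mdeg_superset) auto
      also have "\<dots> = (\<Sum>i=1..k. i * ?l (\<iota> i))"
        by (subst sum.reindex) (auto intro: inj_on_subset[OF inj_iota])
      finally have "(of_nat k :: complex) = (\<Sum>i=1..k. of_nat (i * ?l (\<iota> i)))"
        using True by (metis of_nat_sum)
      thus ?thesis using True by (simp add: sum_distrib_right)
    qed auto
    finally have "of_nat k * mcoeff (elem_schur tvar (int k)) m = of_nat k * (if mdeg w m = k then ?E m else 0)"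
      by simp
    thus ?thesis using False by (simp only: mult_cancel_left of_nat_eq_0_iff) simp
  qed
qed

lemma homogeneous_elem_schur: "homogeneous w k (elem_schur tvar k)"
proof (cases "k < 0")
  case False
  thus ?thesis using elem_schur_tvar_nat[of "nat k"] by (auto simp: homogeneous_def split: if_splits)
qed (simp add: homogeneous_def)

text \<open>Expanded so that the permutation acts on the parts of the partition and not on the
  columns; in this form it matches \<open>alt_coeff\<close> in the Cauchy identity.\<close>

lemma schur_eq_sum:
  assumes "is_partition lam" "num_parts lam \<le> n"
  shows "schur lam tvar = (\<Sum>\<sigma> | \<sigma> permutes {..<n}. mconst (of_int (sign \<sigma>)) *
     (\<Prod>j<n. elem_schur tvar (shifted n lam (\<sigma> j) - staircase n j)))"
proof -
  let ?A = "Matrix.mat n n (\<lambda>(i, j). elem_schur tvar (int (lam i) - int i + int j))"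
  have "schur lam tvar = (\<Sum>\<sigma> | \<sigma> permutes {0..<n}. of_int (sign \<sigma>) * (\<Prod>j<n. ?A $$ (\<sigma> j, j)))"
    unfolding schur_eq_det[OF assms] by (rule det_col) simp
  also have "\<dots> = (\<Sum>\<sigma> | \<sigma> permutes {..<n}. mconst (of_int (sign \<sigma>)) *
     (\<Prod>j<n. elem_schur tvar (shifted n lam (\<sigma> j) - staircase n j)))"
    unfolding of_int_sign_eq_mconst atLeast0LessThan
  proof (intro sum.cong refl arg_cong2[where f = "(*)"] prod.cong)
    fix \<sigma> j assume "\<sigma> \<in> {\<sigma>. \<sigma> permutes {..<n}}" "j \<in> {..<n}"
    hence "\<sigma> j < n" "j < n" using permutes_in_image[of \<sigma> "{..<n}" j] by auto
    thus "?A $$ (\<sigma> j, j) = elem_schur tvar (shifted n lam (\<sigma> j) - staircase n j)"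
      by (simp add: shifted_def staircase_def algebra_simps)
  qed
  finally show ?thesis .
qed

lemma homogeneous_schur:
  assumes "is_partition lam" "num_parts lam \<le> n"
  shows "homogeneous w (\<Sum>i<n. int (lam i)) (schur lam tvar)"
  unfolding schur_eq_sum[OF assms]
proof (intro homogeneous_sum homogeneous_mconst_mult)
  fix \<sigma> assume "\<sigma> \<in> {\<sigma>. \<sigma> permutes {..<n}}"
  hence s: "\<sigma> permutes {..<n}" by simp
  have "(\<Sum>j<n. shifted n lam (\<sigma> j) - staircase n j) = (\<Sum>i<n. int (lam i))"
    using sum.reindex_bij_betw[OF permutes_imp_bij[OF s], of "shifted n lam"]
    by (simp add: sum_subtractf shifted_def sum.distrib)
  moreover have "homogeneous w (\<Sum>j<n. shifted n lam (\<sigma> j) - staircase n j)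
      (\<Prod>j<n. elem_schur tvar (shifted n lam (\<sigma> j) - staircase n j))"
    by (intro homogeneous_prod homogeneous_elem_schur) auto
  ultimately show "homogeneous w (\<Sum>i<n. int (lam i))
      (\<Prod>j<n. elem_schur tvar (shifted n lam (\<sigma> j) - staircase n j))" by simp
qed

end

section \<open>The Cauchy identity\<close>

text \<open>A finite set that contains all partitions contributing to coefficients of weight at most
  D, since a Schur polynomial has weight equal to the size of its partition.\<close>

definition parts :: "nat \<Rightarrow> nat \<Rightarrow> (nat \<Rightarrow> nat) set" where
  "parts n D = {l. is_partition l \<and> num_parts l \<le> n \<and> l 0 \<le> D}"

lemma finite_parts: "finite (parts n D)"
proof (rule finite_subset)
  show "parts n D \<subseteq> {f. \<forall>i. (i \<in> {..<n} \<longrightarrow> f i \<in> {..D}) \<and> (i \<notin> {..<n} \<longrightarrow> f i = 0)}"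
  proof
    fix l assume l: "l \<in> parts n D"
    have "l i \<le> D" for i
    proof -
      have "l i \<le> l 0" using l by (auto simp: parts_def is_partition_def intro: antimonoD)
      thus ?thesis using l by (simp add: parts_def)
    qed
    moreover have "l i = 0" if "i \<notin> {..<n}" for i
      using l that by (auto simp: parts_def intro: partition_eq_0)
    ultimately show "l \<in> {f. \<forall>i. (i \<in> {..<n} \<longrightarrow> f i \<in> {..D}) \<and> (i \<notin> {..<n} \<longrightarrow> f i = 0)}"
      by simp
  qed
  show "finite {f. \<forall>i. (i \<in> {..<n} \<longrightarrow> f i \<in> {..D}) \<and> (i \<notin> {..<n} \<longrightarrow> f i = (0 :: nat))}"
    by (rule finite_set_of_finite_funs) auto
qed

lemma shifted_decreasing: "is_partition l \<Longrightarrow> i < j \<Longrightarrow> shifted n l j < shifted n l i"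
  using antimonoD[of l i j] by (auto simp: shifted_def staircase_def is_partition_def)

lemma partition_of_decreasing:
  assumes dec: "\<And>i j. i < j \<Longrightarrow> j < n \<Longrightarrow> b j < b i" and nonneg: "\<And>i. i < n \<Longrightarrow> 0 \<le> b i"
    and bound: "n > 0 \<Longrightarrow> b 0 \<le> int D + staircase n 0"
  obtains l where "l \<in> parts n D" "\<And>i. i < n \<Longrightarrow> shifted n l i = b i"
proof -
  have mono: "b j - staircase n j \<le> b i - staircase n i" if "i \<le> j" "j < n" for i j
    using that
  proof (induction j rule: dec_induct)
    case (step j)
    have "b (Suc j) - staircase n (Suc j) \<le> b j - staircase n j"
      using dec[of j "Suc j"] step by (simp add: staircase_def)
    with step show ?case by simp
  qed simp
  have ge: "0 \<le> b i - staircase n i" if "i < n" for i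
  proof -
    have "b (n - 1) - staircase n (n - 1) \<le> b i - staircase n i" using that by (intro mono) auto
    moreover have "0 \<le> b (n - 1)" using that by (intro nonneg) auto
    moreover have "staircase n (n - 1) = 0" using that by (simp add: staircase_def)
    ultimately show ?thesis by simp
  qed
  define l where "l = (\<lambda>i. if i < n then nat (b i - staircase n i) else 0)"
  have supp: "{i. l i \<noteq> 0} \<subseteq> {..<n}" by (auto simp: l_def)
  have "antimono l"
  proof (rule antimonoI)
    fix i j :: nat assume "i \<le> j"
    thus "l j \<le> l i" using mono[of i j] by (auto simp: l_def intro: nat_mono)
  qed
  moreover have "finite {i. l i \<noteq> 0}" using supp by (rule finite_subset) simp
  moreover have "num_parts l \<le> n" unfolding num_parts_def using card_mono[OF _ supp] by simp
  moreover have "l 0 \<le> D" using bound by (auto simp: l_def)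
  ultimately have "l \<in> parts n D" by (simp add: parts_def is_partition_def)
  moreover have "shifted n l i = b i" if "i < n" for i
    using ge[OF that] that by (simp add: shifted_def l_def)
  ultimately show ?thesis by (rule that)
qed

lemma partition_eqI:
  assumes "l \<in> parts n D" "l' \<in> parts n D'" "\<And>i. i < n \<Longrightarrow> shifted n l i = shifted n l' i"
  shows "l = l'"
proof
  fix i
  show "l i = l' i"
  proof (cases "i < n")
    case True
    thus ?thesis using assms(3)[of i] by (simp add: shifted_def)
  next
    case False
    thus ?thesis using assms(1,2) by (auto simp: parts_def partition_eq_0)
  qed
qed

text \<open>If a has a repeated entry, both sides vanish. Otherwise a is a rearrangement of lambda +
  delta for exactly one partition lambda, and since the entries of a are at most D + n - 1, the
  first part of lambda is at most D.\<close>

lemma alternant_expand: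
  assumes D: "\<And>i. i < n \<Longrightarrow> \<kappa> i \<le> D"
  defines "a \<equiv> (\<lambda>i. staircase n i + int (\<kappa> i))"
  shows "alternant n a x = (\<Sum>l\<in>parts n D. alt_coeff n a (shifted n l) * alternant n (shifted n l) x)"
proof (cases "inj_on a {..<n}")
  case False
  then obtain i j where "i < n" "j < n" "i \<noteq> j" "a i = a j" by (auto simp: inj_on_def)
  note rep = this
  show ?thesis by (simp add: alternant_repeated[OF rep] alt_coeff_repeated[OF rep])
next
  case True
  then obtain \<tau> where t: "\<tau> permutes {..<n}"
    and dec: "\<And>i j. i < j \<Longrightarrow> j < n \<Longrightarrow> (a \<circ> \<tau>) j < (a \<circ> \<tau>) i"
    by (rule decreasing_rearrangement) blast
  have tn: "\<tau> i < n" if "i < n" for i using permutes_in_image[OF t, of i] that by simp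
  have "0 \<le> (a \<circ> \<tau>) i" if "i < n" for i
    using tn[OF that] by (simp add: a_def staircase_def)
  moreover have "(a \<circ> \<tau>) 0 \<le> int D + staircase n 0" if "n > 0"
    using D[OF tn[OF that]] by (simp add: a_def staircase_def)
  ultimately obtain l where l: "l \<in> parts n D" "\<And>i. i < n \<Longrightarrow> shifted n l i = (a \<circ> \<tau>) i"
    using partition_of_decreasing[of n "a \<circ> \<tau>" D] dec by metis
  have coeff: "of_int (sign \<tau>) * alt_coeff n a (shifted n l') = (if l' = l then 1 else 0)"
    if l': "l' \<in> parts n D" for l'
  proof -
    have "of_int (sign \<tau>) * alt_coeff n a (shifted n l') = alt_coeff n (a \<circ> \<tau>) (shifted n l')"
      by (rule alt_coeff_permute[OF t, symmetric])
    also have "\<dots> = (if \<forall>i<n. (a \<circ> \<tau>) i = shifted n l' i then 1 else 0)"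
      using l' by (intro alt_coeff_decreasing dec shifted_decreasing) (auto simp: parts_def)
    also have "(\<forall>i<n. (a \<circ> \<tau>) i = shifted n l' i) \<longleftrightarrow> l' = l"
      using partition_eqI[OF l' l(1)] l(2) by auto
    finally show ?thesis .
  qed
  have "of_int (sign \<tau>) * (\<Sum>l'\<in>parts n D. alt_coeff n a (shifted n l') * alternant n (shifted n l') x) =
      (\<Sum>l'\<in>parts n D. if l' = l then alternant n (shifted n l) x else 0)"
    unfolding sum_distrib_left mult.assoc[symmetric]
    by (intro sum.cong refl) (simp only: coeff, simp)
  also have "\<dots> = alternant n (shifted n l) x"
    using l(1) by (simp add: sum.delta finite_parts)
  also have "\<dots> = alternant n (a \<circ> \<tau>) x" by (rule alternant_cong) (use l(2) in auto)
  also have "\<dots> = of_int (sign \<tau>) * alternant n a x" by (rule alternant_permute[OF t])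
  finally show ?thesis by (auto simp: sign_def split: if_splits)
qed

text \<open>Congruence modulo terms of weight above D. It is compatible with products because
  weights are nonnegative.\<close>

definition agree :: "('v \<Rightarrow> nat) \<Rightarrow> nat \<Rightarrow> 'v mfps \<Rightarrow> 'v mfps \<Rightarrow> bool" where
  "agree w D f g \<longleftrightarrow> (\<forall>m. mdeg w m \<le> D \<longrightarrow> mcoeff f m = mcoeff g m)"

lemma agree_mult:
  assumes "agree w D f f'" "agree w D g g'"
  shows "agree w D (f * g) (f' * g')"
  unfolding agree_def
proof (intro allI impI)
  fix m assume m: "mdeg w m \<le> D"
  have "mcoeff f (fst p) * mcoeff g (snd p) = mcoeff f' (fst p) * mcoeff g' (snd p)" if "p \<in> splits m" for p
  proof -
    have "mdeg w m = mdeg w (fst p) + mdeg w (snd p)"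
      using that mdeg_add[of w "fst p" "snd p"] by (auto simp: splits_def)
    thus ?thesis using assms m by (simp add: agree_def)
  qed
  thus "mcoeff (f * g) m = mcoeff (f' * g') m"
    unfolding mcoeff_mult by (rule sum.cong[OF refl])
qed

lemma agree_prod:
  assumes "\<And>a. a \<in> A \<Longrightarrow> agree w D (f a) (g a)"
  shows "agree w D (\<Prod>a\<in>A. f a) (\<Prod>a\<in>A. g a)"
  using assms
proof (induction A rule: infinite_finite_induct)
  case (insert a A)
  thus ?case by (simp add: agree_mult)
qed (simp_all add: agree_def)

lemma mcoeff_prod_split: "p \<in> splits m \<Longrightarrow> mdeg w (fst p) \<le> mdeg w m \<and> mdeg w (snd p) \<le> mdeg w m"
  using mdeg_add[of w "fst p" "snd p"] by (auto simp: splits_def)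

context var_family
begin

lemma fam_eq: "fam p v = fam (\<lambda>_. 1) v * p (w v)"
  unfolding fam_def by (cases "\<exists>i\<ge>1. v = \<iota> i") (simp_all only: if_True if_False, simp_all)

lemma fam_psum: "fam (psum n x) v = (\<Sum>j<n. fam (\<lambda>r. x j ^ r) v)"
  unfolding fam_def psum_def
  by (cases "\<exists>i\<ge>1. v = \<iota> i") (simp_all only: if_True if_False sum_distrib_left sum.neutral_const)

lemma exp_series_fam_psum:
  "exp_series (fam (psum n x)) = (\<Prod>j<n. exp_series (fam (\<lambda>r. x j ^ r)))"
proof -
  have "exp_series (\<lambda>v. \<Sum>j<n. c j v) = (\<Prod>j<n. exp_series (c j))" for c :: "nat \<Rightarrow> 'v \<Rightarrow> complex"
  proof (induction n)
    case 0
    have "exp_series (\<lambda>_. 0) = (1 :: 'v mfps)"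
    proof (rule mfps_eqI)
      fix m :: "'v \<Rightarrow>\<^sub>0 nat"
      show "mcoeff (exp_series (\<lambda>_. 0)) m = mcoeff 1 m"
      proof (cases "m = 0")
        case False
        then obtain v where "v \<in> Poly_Mapping.keys m" by fastforce
        thus ?thesis using False mcoeff_exp_series_eq_0[of v m "\<lambda>_. 0"] by (simp add: mcoeff_1)
      qed (simp add: mcoeff_1)
    qed
    thus ?case by simp
  next
    case (Suc n)
    thus ?case by (simp add: exp_series_mult[symmetric])
  qed
  thus ?thesis unfolding fam_psum[abs_def] .
qed

lemma mcoeff_exp_series_fam_power:
  "mcoeff (exp_series (fam (\<lambda>r. y ^ r))) m = y ^ mdeg w m * mcoeff (exp_series (fam (\<lambda>_. 1))) m"
proof -
  have "mcoeff (exp_series (fam (\<lambda>r. y ^ r))) m =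
     (\<Prod>v\<in>Poly_Mapping.keys m. y ^ (w v * Poly_Mapping.lookup m v) *
        (fam (\<lambda>_. 1) v ^ Poly_Mapping.lookup m v / fact (Poly_Mapping.lookup m v)))"
    unfolding exp_series_def mcoeff_Abs
    by (intro prod.cong refl) (subst fam_eq, simp add: power_mult_distrib power_mult)
  thus ?thesis
    by (simp only: prod.distrib exp_series_def mcoeff_Abs mdeg_def power_sum)
qed

text \<open>The exponential factors over the variables x_j, and the factor of x_j is the generating
  series of the elementary Schur polynomials at x_j. Below weight D each factor may be cut at degree
  D, so the product is a finite sum.\<close>

lemma exp_series_fam_psum_expand:
  assumes m: "mdeg w m \<le> D"
  shows "mcoeff (exp_series (fam (psum n x))) m =
    (\<Sum>\<kappa>\<in>{..<n} \<rightarrow>\<^sub>E {..D}. lmon n (\<lambda>i. int (\<kappa> i)) x * mcoeff (\<Prod>j<n. elem_schur tvar (int (\<kappa> j))) m)"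
proof -
  define A where "A = (\<lambda>y. \<Sum>k\<le>D. mconst (y ^ k) * elem_schur tvar (int k))"
  have "agree w D (exp_series (fam (\<lambda>r. y ^ r))) (A y)" for y
    unfolding agree_def
  proof (intro allI impI)
    fix m assume m: "mdeg w m \<le> D"
    have "mcoeff (A y) m = (\<Sum>k\<le>D. if mdeg w m = k then y ^ mdeg w m * mcoeff (exp_series (fam (\<lambda>_. 1))) m else 0)"
      unfolding A_def mcoeff_sum by (intro sum.cong refl) (simp add: mcoeff_mconst_mult elem_schur_tvar_nat)
    also have "\<dots> = y ^ mdeg w m * mcoeff (exp_series (fam (\<lambda>_. 1))) m"
      using m by (simp add: sum.delta)
    finally show "mcoeff (exp_series (fam (\<lambda>r. y ^ r))) m = mcoeff (A y) m"
      by (simp only: mcoeff_exp_series_fam_power)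
  qed
  hence "agree w D (exp_series (fam (psum n x))) (\<Prod>j<n. A (x j))"
    unfolding exp_series_fam_psum by (intro agree_prod)
  hence "mcoeff (exp_series (fam (psum n x))) m = mcoeff (\<Prod>j<n. A (x j)) m"
    using m by (simp add: agree_def)
  also have "(\<Prod>j<n. A (x j)) = (\<Sum>\<kappa>\<in>{..<n} \<rightarrow>\<^sub>E {..D}. \<Prod>j<n. mconst (x j ^ \<kappa> j) * elem_schur tvar (int (\<kappa> j)))"
    unfolding A_def by (rule prod_sum_PiE) auto
  also have "\<dots> = (\<Sum>\<kappa>\<in>{..<n} \<rightarrow>\<^sub>E {..D}. mconst (lmon n (\<lambda>i. int (\<kappa> i)) x) * (\<Prod>j<n. elem_schur tvar (int (\<kappa> j))))"
    by (simp add: prod.distrib mconst_prod lmon_def)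
  finally show ?thesis by (simp only: mcoeff_sum mcoeff_mconst_mult)
qed

text \<open>For each permutation at most one \<kappa> satisfies the equations of
  \<open>alt_coeff\<close>, and its product of elementary Schur polynomials is the corresponding
  term of the determinant. The range of \<kappa> omits nothing: terms with an index outside 0..D do
  not contribute to m.\<close>

lemma sum_alt_coeff_schur:
  assumes l: "l \<in> parts n D" and m: "mdeg w m \<le> D"
  shows "(\<Sum>\<kappa>\<in>{..<n} \<rightarrow>\<^sub>E {..D}. mcoeff (\<Prod>j<n. elem_schur tvar (int (\<kappa> j))) m *
      alt_coeff n (\<lambda>i. staircase n i + int (\<kappa> i)) (shifted n l)) = mcoeff (schur l tvar) m"
proof -
  let ?B = "\<lambda>\<kappa>. mcoeff (\<Prod>j<n. elem_schur tvar (int (\<kappa> j))) m"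
  let ?P = "{\<sigma>. \<sigma> permutes {..<n}}" and ?K = "{..<n} \<rightarrow>\<^sub>E {..D}"
  let ?e = "\<lambda>\<sigma> j. shifted n l (\<sigma> j) - staircase n j"
  have "(\<Sum>\<kappa>\<in>?K. ?B \<kappa> * alt_coeff n (\<lambda>i. staircase n i + int (\<kappa> i)) (shifted n l)) =
     (\<Sum>\<kappa>\<in>?K. \<Sum>\<sigma>\<in>?P. of_int (sign \<sigma>) * (if \<forall>i<n. staircase n i + int (\<kappa> i) = shifted n l (\<sigma> i) then ?B \<kappa> else 0))"
  proof -
    have "b * (c * (if Q then 1 else 0)) = c * (if Q then b else 0)" for b c :: complex and Q
      by simp
    thus ?thesis unfolding alt_coeff_def sum_distrib_left by (intro sum.cong refl)
  qed
  also have "\<dots> = (\<Sum>\<sigma>\<in>?P. \<Sum>\<kappa>\<in>?K. of_int (sign \<sigma>) * (if \<forall>i<n. staircase n i + int (\<kappa> i) = shifted n l (\<sigma> i) then ?B \<kappa> else 0))"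
    by (rule sum.swap)
  also have "\<dots> = (\<Sum>\<sigma>\<in>?P. of_int (sign \<sigma>) * (\<Sum>\<kappa>\<in>?K. if \<forall>i<n. staircase n i + int (\<kappa> i) = shifted n l (\<sigma> i) then ?B \<kappa> else 0))"
    by (simp only: sum_distrib_left)
  also have "\<dots> = (\<Sum>\<sigma>\<in>?P. of_int (sign \<sigma>) * mcoeff (\<Prod>j<n. elem_schur tvar (?e \<sigma> j)) m)"
  proof (intro sum.cong refl arg_cong2[where f = "(*)"])
    fix \<sigma>
    have iff: "(\<forall>i<n. staircase n i + int (\<kappa> i) = shifted n l (\<sigma> i)) \<longleftrightarrow> (\<forall>i<n. int (\<kappa> i) = ?e \<sigma> i)" for \<kappa>
      by (auto simp: algebra_simps)
    show "(\<Sum>\<kappa>\<in>?K. if \<forall>i<n. staircase n i + int (\<kappa> i) = shifted n l (\<sigma> i) then ?B \<kappa> else 0) =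
        mcoeff (\<Prod>j<n. elem_schur tvar (?e \<sigma> j)) m"
    proof (cases "\<forall>i<n. 0 \<le> ?e \<sigma> i \<and> ?e \<sigma> i \<le> int D")
      case True
      define k0 where "k0 = restrict (\<lambda>i. nat (?e \<sigma> i)) {..<n}"
      have k0: "k0 \<in> ?K" using True by (auto simp: k0_def nat_le_iff)
      have unique: "(\<forall>i<n. int (\<kappa> i) = ?e \<sigma> i) \<longleftrightarrow> \<kappa> = k0" if "\<kappa> \<in> ?K" for \<kappa>
      proof
        assume eq: "\<forall>i<n. int (\<kappa> i) = ?e \<sigma> i"
        show "\<kappa> = k0"
        proof (rule PiE_ext[OF that k0])
          fix i assume "i \<in> {..<n}"
          hence "int (\<kappa> i) = ?e \<sigma> i" using eq by simp
          thus "\<kappa> i = k0 i" using \<open>i \<in> _\<close> by (simp add: k0_def flip: \<open>int (\<kappa> i) = ?e \<sigma> i\<close>)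
        qed
      qed (use True in \<open>auto simp: k0_def\<close>)
      have "(\<Sum>\<kappa>\<in>?K. if \<forall>i<n. staircase n i + int (\<kappa> i) = shifted n l (\<sigma> i) then ?B \<kappa> else 0) =
          (\<Sum>\<kappa>\<in>?K. if \<kappa> = k0 then ?B k0 else 0)"
        unfolding iff by (intro sum.cong refl) (simp only: unique, simp)
      also have "\<dots> = ?B k0" using k0 by (simp add: sum.delta finite_PiE)
      also have "\<dots> = mcoeff (\<Prod>j<n. elem_schur tvar (?e \<sigma> j)) m"
        using True by (intro arg_cong[where f = "\<lambda>f. mcoeff f m"] prod.cong) (auto simp: k0_def)
      finally show ?thesis .
    next
      case False
      have "\<not> (\<forall>i<n. int (\<kappa> i) = ?e \<sigma> i)" if "\<kappa> \<in> ?K" for \<kappa>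
      proof
        assume eq: "\<forall>i<n. int (\<kappa> i) = ?e \<sigma> i"
        have "0 \<le> ?e \<sigma> i \<and> ?e \<sigma> i \<le> int D" if "i < n" for i
        proof -
          have "\<kappa> i \<le> D" using \<open>\<kappa> \<in> ?K\<close> that by (auto simp: PiE_def Pi_def)
          thus ?thesis using eq that by (metis of_nat_0_le_iff of_nat_le_iff)
        qed
        with False show False by blast
      qed
      hence "(\<Sum>\<kappa>\<in>?K. if \<forall>i<n. staircase n i + int (\<kappa> i) = shifted n l (\<sigma> i) then ?B \<kappa> else 0) = 0"
        unfolding iff by (intro sum.neutral) auto
      \<comment> \<open>A negative index makes a factor zero. An index above D, with all others
        nonnegative, raises the weight of the product above that of m.\<close>
      also have "0 = mcoeff (\<Prod>j<n. elem_schur tvar (?e \<sigma> j)) m"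
      proof (cases "\<exists>i<n. ?e \<sigma> i < 0")
        case True
        then obtain i where i: "i < n" "?e \<sigma> i < 0" by blast
        hence "(\<Prod>j<n. elem_schur tvar (?e \<sigma> j)) = 0" by (intro prod_zero) (auto intro!: bexI[of _ i])
        thus ?thesis by simp
      next
        case nonneg: False
        with False obtain i where i: "i < n" "?e \<sigma> i > int D" by (auto simp: not_le)
        have nn: "0 \<le> ?e \<sigma> j" if "j < n" for j using nonneg that by (meson not_le)
        have "?e \<sigma> i \<le> (\<Sum>j<n. ?e \<sigma> j)" by (rule member_le_sum) (use i nn in auto)
        hence "int (mdeg w m) \<noteq> (\<Sum>j<n. ?e \<sigma> j)" using i m by linarith
        moreover have "homogeneous w (\<Sum>j<n. ?e \<sigma> j) (\<Prod>j<n. elem_schur tvar (?e \<sigma> j))"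
          by (intro homogeneous_prod homogeneous_elem_schur) auto
        ultimately show ?thesis by (auto simp: homogeneous_def)
      qed
      finally show ?thesis .
    qed
  qed
  also have "\<dots> = mcoeff (schur l tvar) m"
    using l by (subst schur_eq_sum[of l n]) (auto simp: parts_def mcoeff_sum mcoeff_mconst_mult)
  finally show ?thesis .
qed

text \<open>One coefficient of the Cauchy identity, after multiplication by the Vandermonde.
  Expanding the exponential into monomials turns the antisymmetrization into alternants; sorting
  their exponents and collecting equal alternants gives the Schur polynomials. The Vandermonde is
  cancelled at the end.\<close>

lemma cauchy_coeff:
  assumes x: "x \<in> torus n" and m: "mdeg w m \<le> D"
  shows "mcoeff (exp_series (fam (psum n x))) m =
    (\<Sum>l\<in>parts n D. jdet n (psum n x) (shifted n l) * mcoeff (schur l tvar) m)"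
proof (rule laurent_cancel_alternant[OF _ _ _ x])
  let ?K = "{..<n} \<rightarrow>\<^sub>E {..D}"
  let ?B = "\<lambda>\<kappa>. mcoeff (\<Prod>j<n. elem_schur tvar (int (\<kappa> j))) m"
  let ?E = "\<lambda>x. mcoeff (exp_series (fam (psum n x))) m"
  show "laurent n ?E"
    unfolding exp_series_fam_psum_expand[OF m]
    by (intro laurent_sum laurent_mult laurent_lmon laurent_const)
  show "laurent n (\<lambda>x. \<Sum>l\<in>parts n D. jdet n (psum n x) (shifted n l) * mcoeff (schur l tvar) m)"
    by (intro laurent_sum laurent_mult laurent_jdet laurent_const)
  fix x assume x: "x \<in> torus n"
  have "?E x * alternant n (staircase n) x =
      (\<Sum>\<sigma> | \<sigma> permutes {..<n}. \<Sum>\<kappa>\<in>?K. ?B \<kappa> * (of_int (sign \<sigma>) * lmon n (\<lambda>i. staircase n i + int (\<kappa> i)) (x \<circ> \<sigma>)))"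
    unfolding alternant_def sum_distrib_left
  proof (rule sum.cong)
    fix \<sigma> assume "\<sigma> \<in> {\<sigma>. \<sigma> permutes {..<n}}"
    hence s: "\<sigma> permutes {..<n}" by simp
    have "?E x = (\<Sum>\<kappa>\<in>?K. lmon n (\<lambda>i. int (\<kappa> i)) (x \<circ> \<sigma>) * ?B \<kappa>)"
      unfolding exp_series_fam_psum_expand[OF m, symmetric] psum_permute[OF s] ..
    hence "?E x * (of_int (sign \<sigma>) * lmon n (staircase n) (x \<circ> \<sigma>)) =
        (\<Sum>\<kappa>\<in>?K. lmon n (\<lambda>i. int (\<kappa> i)) (x \<circ> \<sigma>) * ?B \<kappa> * (of_int (sign \<sigma>) * lmon n (staircase n) (x \<circ> \<sigma>)))"
      by (simp only: sum_distrib_right)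
    also have "\<dots> = (\<Sum>\<kappa>\<in>?K. ?B \<kappa> * (of_int (sign \<sigma>) * lmon n (\<lambda>i. staircase n i + int (\<kappa> i)) (x \<circ> \<sigma>)))"
      by (intro sum.cong refl) (simp only: lmon_add[OF torus_permute[OF x s]] mult_ac)
    finally show "?E x * (of_int (sign \<sigma>) * lmon n (staircase n) (x \<circ> \<sigma>)) =
        (\<Sum>\<kappa>\<in>?K. ?B \<kappa> * (of_int (sign \<sigma>) * lmon n (\<lambda>i. staircase n i + int (\<kappa> i)) (x \<circ> \<sigma>)))" .
  qed simp
  also have "\<dots> = (\<Sum>\<kappa>\<in>?K. ?B \<kappa> * alternant n (\<lambda>i. staircase n i + int (\<kappa> i)) x)"
    unfolding alternant_def sum_distrib_left by (rule sum.swap)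
  also have "\<dots> = (\<Sum>\<kappa>\<in>?K. \<Sum>l\<in>parts n D. ?B \<kappa> * alt_coeff n (\<lambda>i. staircase n i + int (\<kappa> i)) (shifted n l) * alternant n (shifted n l) x)"
  proof (rule sum.cong)
    fix \<kappa> assume "\<kappa> \<in> ?K"
    hence "\<And>i. i < n \<Longrightarrow> \<kappa> i \<le> D" by (auto simp: PiE_def Pi_def)
    from alternant_expand[of n \<kappa> D x, OF this]
    show "?B \<kappa> * alternant n (\<lambda>i. staircase n i + int (\<kappa> i)) x =
        (\<Sum>l\<in>parts n D. ?B \<kappa> * alt_coeff n (\<lambda>i. staircase n i + int (\<kappa> i)) (shifted n l) * alternant n (shifted n l) x)"
      by (simp only: sum_distrib_left mult.assoc)
  qed simp
  also have "\<dots> = (\<Sum>l\<in>parts n D. \<Sum>\<kappa>\<in>?K. ?B \<kappa> * alt_coeff n (\<lambda>i. staircase n i + int (\<kappa> i)) (shifted n l) * alternant n (shifted n l) x)"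
    by (rule sum.swap)
  also have "\<dots> = (\<Sum>l\<in>parts n D. jdet n (psum n x) (shifted n l) * mcoeff (schur l tvar) m) * alternant n (staircase n) x"
    unfolding sum_distrib_right[of _ "parts n D"]
  proof (rule sum.cong)
    fix l assume l: "l \<in> parts n D"
    have "alternant n (shifted n l) x = jdet n (psum n x) (shifted n l) * alternant n (staircase n) x"
      by (rule jacobi_trudi) (rule shifted_nonneg)
    thus "(\<Sum>\<kappa>\<in>?K. ?B \<kappa> * alt_coeff n (\<lambda>i. staircase n i + int (\<kappa> i)) (shifted n l) * alternant n (shifted n l) x) =
        jdet n (psum n x) (shifted n l) * mcoeff (schur l tvar) m * alternant n (staircase n) x"
      unfolding sum_distrib_right[symmetric] sum_alt_coeff_schur[OF l m] by simp
  qed simp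
  finally show "?E x * alternant n (staircase n) x =
      (\<Sum>l\<in>parts n D. jdet n (psum n x) (shifted n l) * mcoeff (schur l tvar) m) * alternant n (staircase n) x" .
qed

text \<open>By homogeneity the size of the partition is the weight of m, and the first part is at
  most the size. This yields formal summability.\<close>

lemma schur_coeff_nonzero:
  assumes "is_partition l" "num_parts l \<le> n" "mcoeff (schur l tvar) m \<noteq> 0" "mdeg w m \<le> D" "n > 0"
  shows "l \<in> parts n D"
proof -
  have "int (mdeg w m) = (\<Sum>i<n. int (l i))"
    using homogeneous_schur[OF assms(1,2)] assms(3) by (auto simp: homogeneous_def)
  moreover have "int (l 0) \<le> (\<Sum>i<n. int (l i))" using assms(5) by (intro member_le_sum) auto
  ultimately show ?thesis using assms by (simp add: parts_def)
qed

end

section \<open>The two families of variables together\<close>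

definition ts_weight :: "ts_var \<Rightarrow> nat" where
  "ts_weight v = (case v of T i \<Rightarrow> i | S i \<Rightarrow> i)"

interpretation Tv: var_family T ts_weight 1
  by standard (simp add: ts_weight_def)

text \<open>The sign -1 occurs twice in the identity, in the arguments -s_i of the Schur function
  and in the exponent; one locale parameter covers both.\<close>

interpretation Sv: var_family S ts_weight "-1"
  by standard (simp add: ts_weight_def)

lemma single_eq_iff: "Poly_Mapping.single u (1 :: nat) = Poly_Mapping.single v 1 \<longleftrightarrow> u = v"
proof
  assume "Poly_Mapping.single u (1 :: nat) = Poly_Mapping.single v 1"
  hence "Poly_Mapping.keys (Poly_Mapping.single u (1 :: nat)) = Poly_Mapping.keys (Poly_Mapping.single v (1 :: nat))"
    by simp
  thus "u = v" by simp
qed simp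

lemma linear_form_delta: "linear_form (\<lambda>v. if v = u then c else 0) = mconst c * mvar u"
proof (rule mfps_eqI)
  fix m
  show "mcoeff (linear_form (\<lambda>v. if v = u then c else 0)) m = mcoeff (mconst c * mvar u) m"
  proof (cases "\<exists>v. m = Poly_Mapping.single v 1")
    case True
    then obtain v where "m = Poly_Mapping.single v 1" by blast
    thus ?thesis by (simp only: mcoeff_linear_form_single mcoeff_mconst_mult mcoeff_mvar single_eq_iff) simp
  next
    case False
    thus ?thesis by (subst mcoeff_linear_form_eq_0) (auto simp: mcoeff_mconst_mult mcoeff_mvar)
  qed
qed

lemma Tv_tvar: "Tv.tvar = (\<lambda>i. mvar (T i))"
  by (simp add: fun_eq_iff Tv.tvar_def linear_form_delta mconst_1)

lemma Sv_tvar: "Sv.tvar = (\<lambda>i. - mvar (S i))"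
  by (rule ext, rule mfps_eqI) (simp add: Sv.tvar_def linear_form_delta mcoeff_mconst_mult)

lemma ts_exponent_eq:
  "ts_exponent M = linear_form (\<lambda>v. Tv.fam (ptr M) v + Sv.fam (\<lambda>r. cnj (ptr M r)) v)"
proof (rule mfps_eqI)
  fix m :: "ts_var \<Rightarrow>\<^sub>0 nat"
  define co where "co = (\<lambda>i. ptr M i * (if m = Poly_Mapping.single (T i) 1 then 1 else 0) -
     cnj (ptr M i) * (if m = Poly_Mapping.single (S i) 1 then 1 else 0))"
  have lhs: "mcoeff (ts_exponent M) m = (\<Sum>i | i \<in> {1..} \<and> co i \<noteq> 0. co i)"
    unfolding ts_exponent_def mcoeff_formal_sum ptr_def[symmetric] ptr_cnj co_def
    by (simp only: mcoeff_diff mcoeff_mconst_mult mcoeff_mvar)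
  have pick: "(\<Sum>i | i \<in> {1..} \<and> co i \<noteq> 0. co i) = (if j \<ge> 1 then co j else 0)"
    if "\<And>i. i \<noteq> j \<Longrightarrow> co i = 0" for j
  proof -
    have "(\<Sum>i | i \<in> {1..} \<and> co i \<noteq> 0. co i) = (\<Sum>i\<in>{j} \<inter> {1..}. co i)"
      using that by (intro sum.mono_neutral_left) auto
    thus ?thesis by auto
  qed
  consider j where "m = Poly_Mapping.single (T j) 1" | j where "m = Poly_Mapping.single (S j) 1"
    | "\<And>v. m \<noteq> Poly_Mapping.single v 1" by (metis ts_var.exhaust)
  thus "mcoeff (ts_exponent M) m =
      mcoeff (linear_form (\<lambda>v. Tv.fam (ptr M) v + Sv.fam (\<lambda>r. cnj (ptr M r)) v)) m"
  proof cases
    case (1 j)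
    have co: "co i = (if i = j then ptr M j else 0)" for i
      unfolding co_def 1 single_eq_iff by simp
    have "mcoeff (ts_exponent M) m = (if j \<ge> 1 then ptr M j else 0)"
      unfolding lhs by (subst pick[of j]) (simp_all add: co)
    thus ?thesis
      unfolding 1 mcoeff_linear_form_single by (auto simp: Tv.fam_def Sv.fam_def ts_weight_def)
  next
    case (2 j)
    have co: "co i = (if i = j then - cnj (ptr M j) else 0)" for i
      unfolding co_def 2 single_eq_iff by simp
    have "mcoeff (ts_exponent M) m = (if j \<ge> 1 then - cnj (ptr M j) else 0)"
      unfolding lhs by (subst pick[of j]) (simp_all add: co)
    thus ?thesis
      unfolding 2 mcoeff_linear_form_single by (auto simp: Tv.fam_def Sv.fam_def ts_weight_def)
  next
    case 3
    have "co i = 0" for i unfolding co_def using 3 by simp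
    thus ?thesis unfolding lhs by (simp add: mcoeff_linear_form_eq_0[OF 3])
  qed
qed

text \<open>The exponential factors into a series in the t_i and one in the s_i. The Cauchy identity
  is applied to the spectrum x in the first factor and to its conjugate in the second, and the same
  bound D suffices for both since neither part of a split monomial exceeds the weight of m.\<close>

lemma mexp_ts_exponent_coeff:
  fixes M :: "complex^'n^'n"
  assumes M: "M \<in> unitary_group" and D: "mdeg ts_weight m \<le> D"
  shows "mcoeff (mexp (ts_exponent M)) m = (\<Sum>p\<in>splits m. \<Sum>l\<in>parts CARD('n) D. \<Sum>l'\<in>parts CARD('n) D.
     jdet CARD('n) (ptr M) (shifted CARD('n) l) * cnj (jdet CARD('n) (ptr M) (shifted CARD('n) l')) *
     (mcoeff (schur l (\<lambda>i. mvar (T i))) (fst p) * mcoeff (schur l' (\<lambda>i. - mvar (S i))) (snd p)))"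
proof -
  let ?n = "CARD('n)"
  obtain x where x: "x \<in> torus ?n" "ptr M = psum ?n x" by (rule unitary_spectrum[OF M])
  have xc: "(\<lambda>i. cnj (x i)) \<in> torus ?n" using x(1) by (simp add: torus_def)
  have cnj: "(\<lambda>r. cnj (ptr M r)) = psum ?n (\<lambda>i. cnj (x i))"
    by (simp add: x(2) psum_def fun_eq_iff)
  have "mcoeff (mexp (ts_exponent M)) m =
     (\<Sum>p\<in>splits m. mcoeff (exp_series (Tv.fam (ptr M))) (fst p) *
        mcoeff (exp_series (Sv.fam (\<lambda>r. cnj (ptr M r)))) (snd p))"
    unfolding ts_exponent_eq mexp_linear_form exp_series_mult[symmetric] mcoeff_mult ..
  also have "\<dots> = (\<Sum>p\<in>splits m.
     (\<Sum>l\<in>parts ?n D. jdet ?n (ptr M) (shifted ?n l) * mcoeff (schur l (\<lambda>i. mvar (T i))) (fst p)) *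
     (\<Sum>l'\<in>parts ?n D. cnj (jdet ?n (ptr M) (shifted ?n l')) * mcoeff (schur l' (\<lambda>i. - mvar (S i))) (snd p)))"
  proof (rule sum.cong)
    fix p assume "p \<in> splits m"
    hence "mdeg ts_weight (fst p) \<le> D" "mdeg ts_weight (snd p) \<le> D"
      using mcoeff_prod_split[of p m ts_weight] D by auto
    note deg = this
    have "mcoeff (exp_series (Tv.fam (ptr M))) (fst p) =
        (\<Sum>l\<in>parts ?n D. jdet ?n (ptr M) (shifted ?n l) * mcoeff (schur l (\<lambda>i. mvar (T i))) (fst p))"
      unfolding x(2) Tv_tvar[symmetric] by (rule Tv.cauchy_coeff[OF x(1) deg(1)])
    moreover have "mcoeff (exp_series (Sv.fam (\<lambda>r. cnj (ptr M r)))) (snd p) =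
        (\<Sum>l'\<in>parts ?n D. cnj (jdet ?n (ptr M) (shifted ?n l')) * mcoeff (schur l' (\<lambda>i. - mvar (S i))) (snd p))"
      unfolding jdet_cnj[symmetric] cnj Sv_tvar[symmetric] by (rule Sv.cauchy_coeff[OF xc deg(2)])
    ultimately show "mcoeff (exp_series (Tv.fam (ptr M))) (fst p) *
        mcoeff (exp_series (Sv.fam (\<lambda>r. cnj (ptr M r)))) (snd p) =
     (\<Sum>l\<in>parts ?n D. jdet ?n (ptr M) (shifted ?n l) * mcoeff (schur l (\<lambda>i. mvar (T i))) (fst p)) *
     (\<Sum>l'\<in>parts ?n D. cnj (jdet ?n (ptr M) (shifted ?n l')) * mcoeff (schur l' (\<lambda>i. - mvar (S i))) (snd p))"
      by simp
  qed simp
  also have "\<dots> = (\<Sum>p\<in>splits m. \<Sum>l\<in>parts CARD('n) D. \<Sum>l'\<in>parts CARD('n) D.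
     jdet CARD('n) (ptr M) (shifted CARD('n) l) * cnj (jdet CARD('n) (ptr M) (shifted CARD('n) l')) *
     (mcoeff (schur l (\<lambda>i. mvar (T i))) (fst p) * mcoeff (schur l' (\<lambda>i. - mvar (S i))) (snd p)))"
    by (intro sum.cong refl) (simp only: sum_product mult_ac)
  finally show ?thesis .
qed

theorem mainTheorem4:
  fixes H :: "(complex^'n^'n) measure"
    and x y :: "nat list"
    and lam mu :: "nat \<Rightarrow> nat"
    and z :: complex
  assumes "normalized_haar H"
    and "length x = CARD('n)" and "sorted_wrt (<) x"
    and "length y = CARD('n)" and "sorted_wrt (<) y"
    and "is_partition mu" and "num_parts mu \<le> CARD('n)"
    and "is_partition lam" and "num_parts lam \<le> CARD('n)"
    and "\<forall>j<CARD('n). int (mu (CARD('n) - 1 - j)) = int (x ! j) - int j"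
    and "\<forall>j<CARD('n). int (lam (CARD('n) - 1 - j)) = int (y ! j) - int j"
  shows "(\<lambda>k. z ^ k / fact k * of_nat (num_walks k (map int x) (map int y)))
           sums schur_integral H lam mu z \<and>
    (let P = {l. is_partition l \<and> num_parts l \<le> CARD('n)};
         summand = (\<lambda>(l, m). mconst (schur_integral H l m z)
                       * schur l (\<lambda>i. mvar (T i)) * schur m (\<lambda>i. - mvar (S i)))
     in formal_summable summand (P \<times> P) \<and>
        formal_sum summand (P \<times> P) =
          formal_integral H (\<lambda>M. mconst (exp (z * Determinants.trace (M + matrix_cnj M)))
                                 * mexp (ts_exponent M)))"
proof -
  let ?n = "CARD('n)"
  note H = assms(1)
  define P where "P = {l. is_partition l \<and> num_parts l \<le> ?n}"
  define A where "A = (\<lambda>l. schur l (\<lambda>i. mvar (T i)) :: ts_var mfps)"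
  define B where "B = (\<lambda>l. schur l (\<lambda>i. - mvar (S i)) :: ts_var mfps)"
  define summand where "summand = (\<lambda>(l, m). mconst (schur_integral H l m z) * A l * B m)"
  have coeff: "mcoeff (summand q) m = schur_integral H (fst q) (snd q) z *
      (\<Sum>p\<in>splits m. mcoeff (A (fst q)) (fst p) * mcoeff (B (snd q)) (snd p))" for q m
    by (simp only: summand_def case_prod_beta mult.assoc mcoeff_mconst_mult) (simp only: mcoeff_mult)
  \<comment> \<open>A nonzero coefficient needs a splitting of m to which both Schur polynomials
    contribute; homogeneity then confines both partitions to a finite set depending on m
    only.\<close>
  have supp: "q \<in> parts ?n (mdeg ts_weight m) \<times> parts ?n (mdeg ts_weight m)"
    if q: "q \<in> P \<times> P" and nz: "mcoeff (summand q) m \<noteq> 0" for q m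
  proof -
    have "(\<Sum>p\<in>splits m. mcoeff (A (fst q)) (fst p) * mcoeff (B (snd q)) (snd p)) \<noteq> 0"
      using nz by (auto simp: coeff)
    then obtain p where p: "p \<in> splits m" "mcoeff (A (fst q)) (fst p) * mcoeff (B (snd q)) (snd p) \<noteq> 0"
      by (rule sum.not_neutral_contains_not_neutral)
    have deg: "mdeg ts_weight (fst p) \<le> mdeg ts_weight m" "mdeg ts_weight (snd p) \<le> mdeg ts_weight m"
      using mcoeff_prod_split[OF p(1), of ts_weight] by auto
    have "fst q \<in> parts ?n (mdeg ts_weight m)"
      by (rule Tv.schur_coeff_nonzero[OF _ _ _ deg(1)])
         (use q p(2) in \<open>auto simp: P_def A_def Tv_tvar mem_Times_iff\<close>)
    moreover have "snd q \<in> parts ?n (mdeg ts_weight m)"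
      by (rule Sv.schur_coeff_nonzero[OF _ _ _ deg(2)])
         (use q p(2) in \<open>auto simp: P_def B_def Sv_tvar mem_Times_iff\<close>)
    ultimately show ?thesis by (simp add: mem_Times_iff)
  qed
  have fin: "finite {q \<in> P \<times> P. mcoeff (summand q) m \<noteq> 0}" for m
    by (rule finite_subset[of _ "parts ?n (mdeg ts_weight m) \<times> parts ?n (mdeg ts_weight m)"])
       (use supp in \<open>auto simp: finite_parts\<close>)
  have "formal_sum summand (P \<times> P) =
      formal_integral H (\<lambda>M. mconst (exp (z * Determinants.trace (M + matrix_cnj M))) * mexp (ts_exponent M))"
  proof (rule mfps_eqI)
    fix m
    \<comment> \<open>For a fixed monomial every sum over partitions becomes finite with this bound,
      so interchanging sum and Haar integral is finite additivity and needs no convergence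
      argument.\<close>
    define D where "D = mdeg ts_weight m"
    let ?s = "\<lambda>l (M :: complex^'n^'n). jdet ?n (ptr M) (shifted ?n l)"
    let ?e = "\<lambda>M :: complex^'n^'n. exp (z * (ptr M 1 + cnj (ptr M 1)))"
    let ?t = "\<lambda>p l l' M. mcoeff (A l) (fst p) * mcoeff (B l') (snd p) * (?s l M * cnj (?s l' M) * ?e M)"
    have cont: "continuous_on unitary_group (?t p l l')" for p l l'
      by (intro continuous_on_mult continuous_on_const continuous_on_cnj continuous_on_jdet_ptr
            continuous_on_exp continuous_on_hop_ptr)
    have PP: "parts ?n D \<times> parts ?n D \<subseteq> P \<times> P" by (auto simp: parts_def P_def)
    have prod_sum: "(\<Sum>q\<in>parts ?n D \<times> parts ?n D. f q) = (\<Sum>l\<in>parts ?n D. \<Sum>l'\<in>parts ?n D. f (l, l'))"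
      for f :: "(nat \<Rightarrow> nat) \<times> (nat \<Rightarrow> nat) \<Rightarrow> complex"
      by (simp only: sum.cartesian_product case_prod_eta)
    have "mcoeff (formal_sum summand (P \<times> P)) m =
        (\<Sum>q\<in>parts ?n D \<times> parts ?n D. mcoeff (summand q) m)"
      unfolding mcoeff_formal_sum
      by (rule sum.mono_neutral_left) (use supp PP in \<open>auto simp: finite_parts D_def\<close>)
    also have "\<dots> = (\<Sum>l\<in>parts ?n D. \<Sum>l'\<in>parts ?n D. \<Sum>p\<in>splits m.
        mcoeff (A l) (fst p) * mcoeff (B l') (snd p) * schur_integral H l l' z)"
      unfolding prod_sum by (intro sum.cong refl) (simp only: coeff fst_conv snd_conv sum_distrib_left mult.commute)
    also have "\<dots> = (\<Sum>l\<in>parts ?n D. \<Sum>l'\<in>parts ?n D. \<Sum>p\<in>splits m. \<integral>M. ?t p l l' M \<partial>H)"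
    proof (intro sum.cong refl)
      fix l l' p assume "l \<in> parts ?n D" "l' \<in> parts ?n D"
      hence "is_partition l" "num_parts l \<le> ?n" "is_partition l'" "num_parts l' \<le> ?n"
        by (auto simp: parts_def)
      from schur_integral_eq[OF this, of H z]
      show "mcoeff (A l) (fst p) * mcoeff (B l') (snd p) * schur_integral H l l' z = (\<integral>M. ?t p l l' M \<partial>H)"
        by simp
    qed
    also have "\<dots> = (\<Sum>p\<in>splits m. \<Sum>l\<in>parts ?n D. \<Sum>l'\<in>parts ?n D. \<integral>M. ?t p l l' M \<partial>H)"
      by (rule sum_rotate[symmetric])
    also have "\<dots> = (\<Sum>p\<in>splits m. \<Sum>l\<in>parts ?n D. \<integral>M. (\<Sum>l'\<in>parts ?n D. ?t p l l' M) \<partial>H)"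
      by (intro sum.cong refl Bochner_Integration.integral_sum[symmetric] haar_integrable H cont)
    also have "\<dots> = (\<Sum>p\<in>splits m. \<integral>M. (\<Sum>l\<in>parts ?n D. \<Sum>l'\<in>parts ?n D. ?t p l l' M) \<partial>H)"
      by (intro sum.cong refl Bochner_Integration.integral_sum[symmetric] haar_integrable H continuous_on_sum cont)
    also have "\<dots> = (\<integral>M. (\<Sum>p\<in>splits m. \<Sum>l\<in>parts ?n D. \<Sum>l'\<in>parts ?n D. ?t p l l' M) \<partial>H)"
      by (intro Bochner_Integration.integral_sum[symmetric] haar_integrable H continuous_on_sum cont)
    also have "\<dots> = (\<integral>M. mcoeff (mconst (exp (z * Determinants.trace (M + matrix_cnj M))) * mexp (ts_exponent M)) m \<partial>H)"
    proof (rule Bochner_Integration.integral_cong[OF refl])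
      fix M assume "M \<in> space H"
      hence M: "M \<in> unitary_group" by (simp add: haar_space[OF H])
      have "mcoeff (mconst (exp (z * Determinants.trace (M + matrix_cnj M))) * mexp (ts_exponent M)) m =
         ?e M * mcoeff (mexp (ts_exponent M)) m"
        by (simp only: mcoeff_mconst_mult trace_plus_cnj)
      also have "mcoeff (mexp (ts_exponent M)) m = (\<Sum>p\<in>splits m. \<Sum>l\<in>parts ?n D. \<Sum>l'\<in>parts ?n D.
          ?s l M * cnj (?s l' M) * (mcoeff (A l) (fst p) * mcoeff (B l') (snd p)))"
        unfolding A_def B_def by (rule mexp_ts_exponent_coeff[OF M]) (simp add: D_def)
      also have "?e M * \<dots> = (\<Sum>p\<in>splits m. \<Sum>l\<in>parts ?n D. \<Sum>l'\<in>parts ?n D. ?t p l l' M)"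
        unfolding sum_distrib_left by (intro sum.cong refl) (simp only: mult_ac)
      finally show "(\<Sum>p\<in>splits m. \<Sum>l\<in>parts ?n D. \<Sum>l'\<in>parts ?n D. ?t p l l' M) =
          mcoeff (mconst (exp (z * Determinants.trace (M + matrix_cnj M))) * mexp (ts_exponent M)) m" ..
    qed
    finally show "mcoeff (formal_sum summand (P \<times> P)) m =
        mcoeff (formal_integral H (\<lambda>M. mconst (exp (z * Determinants.trace (M + matrix_cnj M))) * mexp (ts_exponent M))) m"
      by (simp only: formal_integral_def mcoeff_Abs)
  qed
  moreover have "formal_summable summand (P \<times> P)"
    unfolding formal_summable_def using fin by blast
  moreover have "(\<lambda>k. z ^ k / fact k * of_nat (num_walks k (map int x) (map int y)))
           sums schur_integral H lam mu z"
    by (rule walks_generating_function) (use assms in auto)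
  ultimately show ?thesis
    unfolding Let_def P_def summand_def A_def B_def by blast
qed

end
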